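(* Let $\delta$ be a real constant and let $T_1\mathbb{C}P^n$ be the Berger tangent sphere bundle over the complex projective space $\mathbb{C}P^n$, with bundle projection $\pi:T_1\mathbb{C}P^n\to\mathbb{C}P^n$. Let $\Gamma$ be a geodesic of $T_1\mathbb{C}P^n$ and $\gamma=\pi\circ\Gamma$. Then the geodesic curvatures $k_1,\dots,k_{2n-1}$ of $\gamma$ are all constant and $k_6=\dots=k_{2n-1}=0$.
   Context: $M=\mathbb{C}P^n$ (real dimension $2n$) carries its standard complex structure $J$ and Kähler metric $g=\langle\cdot,\cdot\rangle$ of constant holomorphic sectional curvature $m>0$ (Fubini–Study metric), so that its curvature tensor is $R(X,Y)Z=\frac m4\big(\langle Y,Z\rangle X-\langle X,Z\rangle Y+\langle JY,Z\rangle JX-\langle JX,Z\rangle JY+2\langle X,JY\rangle JZ\big)$. $\nabla$ is the Levi-Civita connection of $g$. Lifts: in the natural local coordinates $(x^i;\xi^i)$ on $TM$, with $\partial_i=\partial/\partial x^i$, $\partial_{2n+i}=\partial/\partial\xi^i$ and $\Gamma^i_{jk}$ the Christoffel symbols of $g$, the horizontal and vertical lifts at $Q=(q,\xi)\in TM$ of $X=X^i\partial_i\in T_qM$ are $X^h=X^i\partial_i-\Gamma^i_{jk}\xi^jX^k\partial_{2n+i}$ and $X^v=X^i\partial_{2n+i}$. Berger tangent bundle: $TM$ with the Riemannian metric $\langle\langle\cdot,\cdot\rangle\rangle$ defined at $(q,\xi)$ by $\langle\langle X^h,Y^h\rangle\rangle=\langle X,Y\rangle$, $\langle\langle X^h,Y^v\rangle\rangle=0$,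 $\langle\langle X^v,Y^v\rangle\rangle=\langle X,Y\rangle+\delta^2\langle X,J\xi\rangle\langle Y,J\xi\rangle$, where $\delta$ is a constant. The Berger tangent sphere bundle is $T_1M=\{(q,\xi)\in TM:|\xi|=1\}$ with the induced metric. Geodesic curvatures: for a (non-constant, regular) curve $\gamma$ in $M$ parametrized by arc length $s$, the Frenet frame $\nu_1=\gamma'_s,\nu_2,\dots$ and the geodesic curvatures $k_1,\dots,k_{2n-1}$ are those of the usual Frenet formulas $\nabla_{\nu_1}\nu_1=k_1\nu_2$, $\nabla_{\nu_1}\nu_i=-k_{i-1}\nu_{i-1}+k_i\nu_{i+1}$; if some $k_i$ vanishes identically, the subsequent ones are taken to be zero. The condition $k_6=\dots=k_{2n-1}=0$ is vacuous when $2n-1<6$. *)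

theory Defs
  imports "HOL-Analysis.Analysis"
begin

section \<open>Local differential geometry in coordinates\<close>

text \<open>
  A coordinate space is a linear subspace \<open>H\<close> of a Euclidean space. This allows coordinate
  spaces of any dimension. Functions on a relatively open part of \<open>H\<close> are only ever
  differentiated in directions that lie in \<open>H\<close>.
\<close>

definition dir_deriv ::
    "('a::real_normed_vector \<Rightarrow> 'b::real_normed_vector) \<Rightarrow> 'a \<Rightarrow> 'a \<Rightarrow> 'b" where
  "dir_deriv f x v = vector_derivative (\<lambda>s. f (x + s *\<^sub>R v)) (at 0)"

text \<open>For open \<open>U\<close> in a finite-dimensional space, \<open>Ck_on k f U\<close> says that \<open>f\<close> is of class
  \<open>C\<close>-\<open>k\<close> on \<open>U\<close>.\<close>

primrec Ck_on ::
    "nat \<Rightarrow> ('a::real_normed_vector \<Rightarrow> 'b::real_normed_vector) \<Rightarrow> 'a set \<Rightarrow> bool" where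
  "Ck_on 0 f U \<longleftrightarrow> continuous_on U f"
| "Ck_on (Suc k) f U \<longleftrightarrow>
     (\<forall>x\<in>U. f differentiable (at x)) \<and>
     (\<forall>v. Ck_on k (\<lambda>x. frechet_derivative f (at x) v) U)" for f

definition smooth_on ::
    "'a::real_normed_vector set \<Rightarrow> ('a \<Rightarrow> 'b::real_normed_vector) \<Rightarrow> bool" where
  "smooth_on U f \<longleftrightarrow> (\<forall>k. Ck_on k f U)"

text \<open>The Levi-Civita connection of a metric \<open>G\<close> on an open part of \<open>H\<close>. In components,
  \<open>christoffel H G x u v\<close> is the vector \<open>\<Gamma>\<^sup>i\<^sub>j\<^sub>k u\<^sup>j v\<^sup>k \<partial>\<^sub>i\<close> at \<open>x\<close>. The defining equation is
  the usual formula for the Christoffel symbols of the first kind.\<close>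

definition christoffel ::
    "'a::euclidean_space set \<Rightarrow> ('a \<Rightarrow> 'a \<Rightarrow> 'a \<Rightarrow> real) \<Rightarrow> 'a \<Rightarrow> 'a \<Rightarrow> 'a \<Rightarrow> 'a" where
  "christoffel H G x u v = (THE w. w \<in> H \<and>
     (\<forall>z\<in>H. G x w z = (dir_deriv (\<lambda>y. G y v z) x u + dir_deriv (\<lambda>y. G y u z) x v
                        - dir_deriv (\<lambda>y. G y u v) x z) / 2))"

definition geodesic_in_coordinates ::
    "'a::euclidean_space set \<Rightarrow> ('a \<Rightarrow> 'a \<Rightarrow> 'a \<Rightarrow> real) \<Rightarrow> real set \<Rightarrow> (real \<Rightarrow> 'a) \<Rightarrow> bool" where
  "geodesic_in_coordinates H G T u \<longleftrightarrow>
     smooth_on T u \<and>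
     (\<forall>t\<in>T. vector_derivative (\<lambda>s. vector_derivative u (at s)) (at t)
             + christoffel H G (u t) (vector_derivative u (at t)) (vector_derivative u (at t)) = 0)"

text \<open>Local parametrizations of an embedded submanifold \<open>S\<close>, with parameter domain \<open>W \<inter> H\<close>.\<close>

definition local_parametrization ::
    "'a::euclidean_space set \<Rightarrow> 'a set \<Rightarrow> ('a \<Rightarrow> 'b::euclidean_space) \<Rightarrow> 'b set \<Rightarrow> bool" where
  "local_parametrization H W \<phi> S \<longleftrightarrow>
     subspace H \<and> open W \<and> smooth_on W \<phi> \<and>
     (\<forall>y\<in>W \<inter> H. \<forall>a\<in>H. dir_deriv \<phi> y a = 0 \<longrightarrow> a = 0) \<and>
     openin (top_of_set S) (\<phi> ` (W \<inter> H)) \<and>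
     (\<exists>\<psi>. homeomorphism (W \<inter> H) (\<phi> ` (W \<inter> H)) \<phi> \<psi>)"

definition pullback_metric ::
    "('a::real_normed_vector \<Rightarrow> 'b::real_normed_vector) \<Rightarrow> ('b \<Rightarrow> 'b \<Rightarrow> 'b \<Rightarrow> real) \<Rightarrow>
     'a \<Rightarrow> 'a \<Rightarrow> 'a \<Rightarrow> real" where
  "pullback_metric \<phi> G y a b = G (\<phi> y) (dir_deriv \<phi> y a) (dir_deriv \<phi> y b)"


section \<open>Complex projective space\<close>

text \<open>
  For an index type \<open>'k\<close> with \<open>n + 1\<close> elements, \<open>CP\<close> is the set of complex lines in
  \<open>complex ^ 'k\<close>. The affine chart belonging to \<open>i\<close> sends the line with homogeneous coordinates
  \<open>w\<close>, \<open>w $ i \<noteq> 0\<close>, to \<open>w / w $ i\<close> with the entry \<open>1\<close> at \<open>i\<close> replaced by \<open>0\<close>; its coordinate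
  space is \<open>affine_space i\<close>, of complex dimension \<open>n\<close>.
\<close>

definition complex_line :: "complex ^ 'k \<Rightarrow> (complex ^ 'k) set" where
  "complex_line w = range (\<lambda>c. c *s w)"

definition CP :: "(complex ^ 'k::finite) set set" where
  "CP = complex_line ` (- {0})"

definition chart_domain :: "'k::finite \<Rightarrow> (complex ^ 'k) set set" where
  "chart_domain i = {L \<in> CP. \<exists>w\<in>L. w $ i \<noteq> 0}"

definition affine_space :: "'k \<Rightarrow> (complex ^ 'k::finite) set" where
  "affine_space i = {z. z $ i = 0}"

definition affine_point :: "'k \<Rightarrow> complex ^ 'k \<Rightarrow> (complex ^ 'k::finite) set" where
  "affine_point i z = complex_line (z + axis i 1)"

definition affine_coord :: "'k \<Rightarrow> (complex ^ 'k::finite) set \<Rightarrow> complex ^ 'k" where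
  "affine_coord i L = (THE z. z \<in> affine_space i \<and> z + axis i 1 \<in> L)"

lemma affine_coord_affine_point:
  assumes "z \<in> affine_space i"
  shows "affine_coord i (affine_point i z) = z"
  unfolding affine_coord_def
proof (rule the_equality)
  show "z \<in> affine_space i \<and> z + axis i 1 \<in> affine_point i z"
    using assms by (auto simp: affine_point_def complex_line_def intro!: range_eqI[of _ _ 1])
next
  fix y assume y: "y \<in> affine_space i \<and> y + axis i 1 \<in> affine_point i z"
  then obtain c where c: "y + axis i 1 = c *s (z + axis i 1)"
    by (auto simp: affine_point_def complex_line_def)
  from arg_cong[OF c, of "\<lambda>v. v $ i"] have "c = 1"
    using y assms by (simp add: affine_space_def axis_def)
  with c show "y = z" by simp
qed

text \<open>A tangent vector at \<open>L\<close> is the family of its coordinate vectors in all the affine charts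
  around \<open>L\<close>; they are related by the differentials of the coordinate changes. The entries that
  belong to charts not containing \<open>L\<close> carry no information and are set to \<open>0\<close>.\<close>

definition tangent_space :: "(complex ^ 'k::finite) set \<Rightarrow> ('k \<Rightarrow> complex ^ 'k) set" where
  "tangent_space L = {v.
     (\<forall>i. L \<in> chart_domain i \<longrightarrow> v i \<in> affine_space i) \<and>
     (\<forall>i j. L \<in> chart_domain i \<longrightarrow> L \<in> chart_domain j \<longrightarrow>
        v j = dir_deriv (\<lambda>z. affine_coord j (affine_point i z)) (affine_coord i L) (v i)) \<and>
     (\<forall>i. L \<notin> chart_domain i \<longrightarrow> v i = 0)}"

definition herm :: "complex ^ 'k \<Rightarrow> complex ^ 'k \<Rightarrow> complex" where
  "herm u v = (\<Sum>i\<in>UNIV. u $ i * cnj (v $ i))"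

text \<open>The Fubini--Study metric of constant holomorphic sectional curvature \<open>m\<close> in affine
  coordinates (same expression in every affine chart). For \<open>n = 1\<close> it is
  \<open>4 \<bar>dz\<bar>\<^sup>2 / (m (1 + \<bar>z\<bar>\<^sup>2)\<^sup>2)\<close>, the round metric of curvature \<open>m\<close>. The standard complex
  structure is multiplication by \<open>\<i>\<close> in affine coordinates.\<close>

definition fubini_study ::
    "real \<Rightarrow> complex ^ 'k::finite \<Rightarrow> complex ^ 'k \<Rightarrow> complex ^ 'k \<Rightarrow> real" where
  "fubini_study m z u v =
     4 / m * (((1 + (norm z)\<^sup>2) * Re (herm u v) - Re (herm u z * herm z v)) / (1 + (norm z)\<^sup>2)\<^sup>2)"

definition cplx_struct :: "complex ^ 'k \<Rightarrow> complex ^ 'k" where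
  "cplx_struct u = \<i> *s u"

text \<open>The metric on tangent vectors. The affine coordinate changes are isometries for
  \<open>fubini_study m\<close>, so the choice of the chart is irrelevant.\<close>

definition CP_metric ::
    "real \<Rightarrow> (complex ^ 'k::finite) set \<Rightarrow> ('k \<Rightarrow> complex ^ 'k) \<Rightarrow> ('k \<Rightarrow> complex ^ 'k) \<Rightarrow> real" where
  "CP_metric m L v w =
     (let i = (SOME i. L \<in> chart_domain i) in fubini_study m (affine_coord i L) (v i) (w i))"

definition CP_norm :: "real \<Rightarrow> (complex ^ 'k::finite) set \<Rightarrow> ('k \<Rightarrow> complex ^ 'k) \<Rightarrow> real" where
  "CP_norm m L v = sqrt (CP_metric m L v v)"

abbreviation CP_christoffel ::
    "real \<Rightarrow> 'k::finite \<Rightarrow> complex ^ 'k \<Rightarrow> complex ^ 'k \<Rightarrow> complex ^ 'k \<Rightarrow> complex ^ 'k" where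
  "CP_christoffel m i \<equiv> christoffel (affine_space i) (fubini_study m)"


section \<open>The Berger tangent sphere bundle\<close>

definition CP_unit_tangent_bundle ::
    "real \<Rightarrow> ((complex ^ 'k::finite) set \<times> ('k \<Rightarrow> complex ^ 'k)) set" where
  "CP_unit_tangent_bundle m = {(L, v). L \<in> CP \<and> v \<in> tangent_space L \<and> CP_norm m L v = 1}"

text \<open>The natural coordinates \<open>(x; \<xi>)\<close> on the tangent bundle induced by the chart \<open>i\<close>.\<close>

definition TM_coord ::
    "'k::finite \<Rightarrow> (complex ^ 'k) set \<times> ('k \<Rightarrow> complex ^ 'k) \<Rightarrow> (complex ^ 'k) \<times> (complex ^ 'k)" where
  "TM_coord i Q = (affine_coord i (fst Q), snd Q i)"

definition hlift ::
    "real \<Rightarrow> 'k::finite \<Rightarrow> (complex ^ 'k) \<times> (complex ^ 'k) \<Rightarrow> complex ^ 'k \<Rightarrow>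
     (complex ^ 'k) \<times> (complex ^ 'k)" where
  "hlift m i = (\<lambda>(x, \<xi>) X. (X, - CP_christoffel m i x \<xi> X))"

definition vlift :: "complex ^ 'k \<Rightarrow> (complex ^ 'k) \<times> (complex ^ 'k)" where
  "vlift X = (0, X)"

text \<open>Every tangent vector \<open>A\<close> of the tangent bundle at \<open>Q = (x, \<xi>)\<close> is uniquely of the form
  \<open>X\<^sup>h + Y\<^sup>v\<close>, namely with \<open>X = fst A\<close> and the following \<open>Y\<close>.\<close>

definition vertical_part ::
    "real \<Rightarrow> 'k::finite \<Rightarrow> (complex ^ 'k) \<times> (complex ^ 'k) \<Rightarrow> (complex ^ 'k) \<times> (complex ^ 'k) \<Rightarrow>
     complex ^ 'k" where
  "vertical_part m i = (\<lambda>(x, \<xi>) (X, \<Xi>). \<Xi> + CP_christoffel m i x \<xi> X)"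

lemma lift_decomposition: "A = hlift m i Q (fst A) + vlift (vertical_part m i Q A)"
  by (cases A; cases Q) (simp add: hlift_def vlift_def vertical_part_def)

definition berger_metric ::
    "real \<Rightarrow> real \<Rightarrow> 'k::finite \<Rightarrow> (complex ^ 'k) \<times> (complex ^ 'k) \<Rightarrow>
     (complex ^ 'k) \<times> (complex ^ 'k) \<Rightarrow> (complex ^ 'k) \<times> (complex ^ 'k) \<Rightarrow> real" where
  "berger_metric m \<delta> i Q A B =
     (let g = fubini_study m (fst Q); J\<xi> = cplx_struct (snd Q);
          K = vertical_part m i Q A; L = vertical_part m i Q B
      in g (fst A) (fst B) + g K L + \<delta>\<^sup>2 * g K J\<xi> * g L J\<xi>)"

text \<open>The values of the Berger metric on lifts. The lemma needs the vanishing of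
  \<open>christoffel\<close> in the argument \<open>0\<close>, hence the nondegeneracy of the Fubini--Study metric.\<close>

lemma fubini_study_nondegenerate:
  assumes "m > 0" "fubini_study m z w w = 0"
  shows "w = 0"
proof -
  have sq: "Re (herm w w) = (norm w)\<^sup>2"
    by (simp add: herm_def norm_vec_def L2_set_def sum_nonneg complex_norm_square[symmetric]
        complex_mult_cnj cmod_power2)
  have conj: "herm z w = cnj (herm w z)"
    by (simp add: herm_def mult.commute)
  have "norm (herm w z) \<le> (\<Sum>i\<in>UNIV. norm (w $ i) * norm (z $ i))"
    unfolding herm_def by (rule order_trans[OF norm_sum]) (simp add: norm_mult)
  also have "\<dots> \<le> norm w * norm z"
    unfolding norm_vec_def using L2_set_mult_ineq[of "\<lambda>i. norm (w $ i)" "\<lambda>i. norm (z $ i)" UNIV]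
    by simp
  finally have cs: "(norm (herm w z))\<^sup>2 \<le> (norm w)\<^sup>2 * (norm z)\<^sup>2"
    by (metis norm_ge_zero power_mono power_mult_distrib)
  have "Re (herm w z * herm z w) = (norm (herm w z))\<^sup>2"
    unfolding conj cmod_power2 by (simp add: power2_eq_square)
  moreover have "(1 + (norm z)\<^sup>2) * (norm w)\<^sup>2 - Re (herm w z * herm z w) = 0"
  proof -
    have "1 + (norm z)\<^sup>2 \<noteq> 0" by (smt (verit) zero_le_power2)
    then show ?thesis using assms by (simp add: fubini_study_def sq)
  qed
  moreover have "(1 + (norm z)\<^sup>2) * (norm w)\<^sup>2 = (norm w)\<^sup>2 + (norm w)\<^sup>2 * (norm z)\<^sup>2"
    by (simp add: algebra_simps)
  ultimately have "(norm w)\<^sup>2 \<le> 0" using cs by linarith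
  then show ?thesis by simp
qed

lemma CP_christoffel_0:
  assumes "m > 0"
  shows "CP_christoffel m i x \<xi> 0 = 0"
proof -
  have z: "fubini_study m y 0 a = 0" "fubini_study m y a 0 = 0" for y a :: "complex ^ 'a"
    by (simp_all add: fubini_study_def herm_def)
  have d: "dir_deriv (\<lambda>y. 0 :: real) x a = 0" "dir_deriv f x (0 :: complex ^ 'a) = 0"
    for a and f :: "complex ^ 'a \<Rightarrow> real"
    by (simp_all add: dir_deriv_def)
  show ?thesis
    unfolding christoffel_def
  proof (rule the_equality)
    show "0 \<in> affine_space i \<and> (\<forall>a\<in>affine_space i. fubini_study m x 0 a =
      (dir_deriv (\<lambda>y. fubini_study m y 0 a) x \<xi> + dir_deriv (\<lambda>y. fubini_study m y \<xi> a) x 0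
       - dir_deriv (\<lambda>y. fubini_study m y \<xi> 0) x a) / 2)"
      by (simp add: z d affine_space_def)
  next
    fix w
    assume "w \<in> affine_space i \<and> (\<forall>a\<in>affine_space i. fubini_study m x w a =
      (dir_deriv (\<lambda>y. fubini_study m y 0 a) x \<xi> + dir_deriv (\<lambda>y. fubini_study m y \<xi> a) x 0
       - dir_deriv (\<lambda>y. fubini_study m y \<xi> 0) x a) / 2)"
    then have "fubini_study m x w w = 0" by (auto simp: z d)
    with assms show "w = 0" by (rule fubini_study_nondegenerate)
  qed
qed

lemma berger_metric_lifts:
  assumes "m > 0"
  shows "berger_metric m \<delta> i (x, \<xi>) (hlift m i (x, \<xi>) X) (hlift m i (x, \<xi>) Y) = fubini_study m x X Y"
    and "berger_metric m \<delta> i (x, \<xi>) (hlift m i (x, \<xi>) X) (vlift Y) = 0"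
    and "berger_metric m \<delta> i (x, \<xi>) (vlift X) (vlift Y) = fubini_study m x X Y
           + \<delta>\<^sup>2 * fubini_study m x X (cplx_struct \<xi>) * fubini_study m x Y (cplx_struct \<xi>)"
proof -
  have z: "fubini_study m y 0 a = 0" "fubini_study m y a 0 = 0" for y a :: "complex ^ 'a"
    by (simp_all add: fubini_study_def herm_def)
  note defs = berger_metric_def vertical_part_def hlift_def vlift_def Let_def
    CP_christoffel_0[OF assms] z
  show "berger_metric m \<delta> i (x, \<xi>) (hlift m i (x, \<xi>) X) (hlift m i (x, \<xi>) Y) = fubini_study m x X Y"
    by (simp add: defs)
  show "berger_metric m \<delta> i (x, \<xi>) (hlift m i (x, \<xi>) X) (vlift Y) = 0"
    by (simp add: defs)
  show "berger_metric m \<delta> i (x, \<xi>) (vlift X) (vlift Y) = fubini_study m x X Y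
           + \<delta>\<^sup>2 * fubini_study m x X (cplx_struct \<xi>) * fubini_study m x Y (cplx_struct \<xi>)"
    by (simp add: defs)
qed

text \<open>A curve in the Berger tangent sphere bundle is a geodesic if near every parameter value it
  satisfies the geodesic equation of the induced metric in some local coordinate system of the
  sphere bundle, which has dimension \<open>4 n - 1\<close>.\<close>

definition berger_geodesic ::
    "real \<Rightarrow> real \<Rightarrow> real set \<Rightarrow>
     (real \<Rightarrow> (complex ^ 'k::finite) set \<times> ('k \<Rightarrow> complex ^ 'k)) \<Rightarrow> bool" where
  "berger_geodesic m \<delta> I \<Gamma> \<longleftrightarrow>
     (\<forall>t\<in>I. \<Gamma> t \<in> CP_unit_tangent_bundle m) \<and>
     (\<forall>t\<^sub>0\<in>I. \<exists>i T (H :: ((complex ^ 'k) \<times> (complex ^ 'k)) set) W \<phi> u.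
        open T \<and> t\<^sub>0 \<in> T \<and> T \<subseteq> I \<and>
        (\<forall>t\<in>T. fst (\<Gamma> t) \<in> chart_domain i) \<and>
        dim H = 4 * (CARD('k) - 1) - 1 \<and>
        local_parametrization H W \<phi>
          (TM_coord i ` {Q \<in> CP_unit_tangent_bundle m. fst Q \<in> chart_domain i}) \<and>
        (\<forall>t\<in>T. u t \<in> W \<inter> H \<and> \<phi> (u t) = TM_coord i (\<Gamma> t)) \<and>
        geodesic_in_coordinates H (pullback_metric \<phi> (berger_metric m \<delta> i)) T u)"


section \<open>Geodesic curvatures\<close>

definition velocity ::
    "(real \<Rightarrow> (complex ^ 'k::finite) set) \<Rightarrow> real \<Rightarrow> 'k \<Rightarrow> complex ^ 'k" where
  "velocity \<gamma> t = (\<lambda>i. if \<gamma> t \<in> chart_domain i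
     then vector_derivative (\<lambda>s. affine_coord i (\<gamma> s)) (at t) else 0)"

definition cov_deriv ::
    "real \<Rightarrow> (real \<Rightarrow> (complex ^ 'k::finite) set) \<Rightarrow> (real \<Rightarrow> 'k \<Rightarrow> complex ^ 'k) \<Rightarrow>
     real \<Rightarrow> 'k \<Rightarrow> complex ^ 'k" where
  "cov_deriv m \<gamma> Y t = (\<lambda>i. if \<gamma> t \<in> chart_domain i
     then vector_derivative (\<lambda>s. Y s i) (at t)
          + CP_christoffel m i (affine_coord i (\<gamma> t)) (velocity \<gamma> t i) (Y t i)
     else 0)"

definition speed :: "real \<Rightarrow> (real \<Rightarrow> (complex ^ 'k::finite) set) \<Rightarrow> real \<Rightarrow> real" where
  "speed m \<gamma> t = CP_norm m (\<gamma> t) (velocity \<gamma> t)"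

text \<open>The covariant derivative in the direction of the unit tangent, that is, with respect to arc
  length: \<open>d/ds = \<bar>\<gamma>'\<bar>\<^sup>-\<^sup>1 d/dt\<close>. The curve itself need not have unit speed.\<close>

definition arc_cov_deriv ::
    "real \<Rightarrow> (real \<Rightarrow> (complex ^ 'k::finite) set) \<Rightarrow> (real \<Rightarrow> 'k \<Rightarrow> complex ^ 'k) \<Rightarrow>
     real \<Rightarrow> 'k \<Rightarrow> complex ^ 'k" where
  "arc_cov_deriv m \<gamma> Y t = (\<lambda>i. cov_deriv m \<gamma> Y t i /\<^sub>R speed m \<gamma> t)"

text \<open>
  The Frenet frame and the geodesic curvatures, determined recursively by
  \<open>k\<^sub>j \<nu>\<^sub>j\<^sub>+\<^sub>1 = \<nabla>\<^bsub>\<nu>\<^sub>1\<^esub> \<nu>\<^sub>j + k\<^sub>j\<^sub>-\<^sub>1 \<nu>\<^sub>j\<^sub>-\<^sub>1\<close>, where \<open>k\<^sub>j \<ge> 0\<close> is the length of the right-hand side and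
  \<open>k\<^sub>0 = 0\<close>, \<open>\<nu>\<^sub>0 = 0\<close>. Since \<open>inverse 0 = 0\<close>, if \<open>k\<^sub>j\<close> vanishes identically, then so do
  \<open>\<nu>\<^sub>j\<^sub>+\<^sub>1\<close> and all the subsequent curvatures.
\<close>

fun frenet_vector ::
      "real \<Rightarrow> (real \<Rightarrow> (complex ^ 'k::finite) set) \<Rightarrow> nat \<Rightarrow> real \<Rightarrow> 'k \<Rightarrow> complex ^ 'k"
  and geodesic_curvature ::
      "real \<Rightarrow> (real \<Rightarrow> (complex ^ 'k::finite) set) \<Rightarrow> nat \<Rightarrow> real \<Rightarrow> real" where
  "frenet_vector m \<gamma> 0 = (\<lambda>t i. 0)"
| "frenet_vector m \<gamma> (Suc 0) = (\<lambda>t i. velocity \<gamma> t i /\<^sub>R speed m \<gamma> t)"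
| "frenet_vector m \<gamma> (Suc (Suc j)) = (\<lambda>t i.
     (arc_cov_deriv m \<gamma> (frenet_vector m \<gamma> (Suc j)) t i
        + geodesic_curvature m \<gamma> j t *\<^sub>R frenet_vector m \<gamma> j t i)
     /\<^sub>R geodesic_curvature m \<gamma> (Suc j) t)"
| "geodesic_curvature m \<gamma> 0 = (\<lambda>t. 0)"
| "geodesic_curvature m \<gamma> (Suc j) = (\<lambda>t. CP_norm m (\<gamma> t) (\<lambda>i.
     arc_cov_deriv m \<gamma> (frenet_vector m \<gamma> (Suc j)) t i
       + geodesic_curvature m \<gamma> j t *\<^sub>R frenet_vector m \<gamma> j t i))"

end

theory Submission
  imports Defs
begin

text \<open>
  Let \<open>\<xi>\<close> be the unit field along \<open>\<gamma>\<close> given by the geodesic. The Euler--Lagrange equations of the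
  energy \<open>\<bar>\<gamma>'\<bar>\<^sup>2 + \<bar>\<xi>'\<bar>\<^sup>2 + \<delta>\<^sup>2\<langle>\<xi>', J\<xi>\<rangle>\<^sup>2\<close> show that \<open>a = \<langle>\<xi>', J\<xi>\<rangle>\<close> is constant, that
  \<open>\<xi>'' + 2 \<delta>\<^sup>2 a J\<xi>'\<close> is a multiple of \<open>\<xi>\<close>, and that \<open>\<gamma>'' = \<Omega> \<gamma>'\<close> with the curvature operator
  \<open>\<Omega> = R(\<xi>' + \<delta>\<^sup>2 a J\<xi>, \<xi>)\<close>. Since \<open>R\<close> is parallel and \<open>J\<close>-invariant, \<open>\<Omega>\<close> is parallel along \<open>\<gamma>\<close>.
  Hence the covariant derivatives of \<open>\<gamma>'\<close> are \<open>\<Omega>\<^sup>k \<gamma>'\<close>, and as \<open>\<Omega>\<close> is skew, the Frenet vectors are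
  constant combinations of them of constant length and the curvatures are constant. On \<open>CP\<close> the
  operator \<open>\<Omega>\<close> preserves the complex span of \<open>\<gamma>'\<close>, \<open>\<xi>\<close>, \<open>\<xi>'\<close>, of real dimension at most 6, which
  leaves room for at most 6 Frenet vectors.

  The calculations take place in the sphere over \<open>CP\<close>, where tangent vectors become vectors of
  \<open>complex ^ 'k\<close> that are Hermitian orthogonal to the base point, in a form that is the same for
  all affine charts.
\<close>

section \<open>Geodesics of pulled back metrics\<close>

text \<open>Two obstacles shape the proof. A horizontal lift of the curve to the sphere would have
  to be produced by solving a differential equation. The section \<open>lift_point i\<close>
  replaces it; it is not horizontal, and \<open>\<theta>\<close> records the resulting motion along
  the Hopf fibre. Hence the \<open>\<theta>\<close> terms in derivatives of lifts, and the demand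
  that the one-form defining the metric annihilate the Hopf direction. Secondly, the geodesic is
  given in an unknown parametrization of the sphere bundle, whose Christoffel symbols are out of
  reach. An Euler--Lagrange equation that sees the parametrization only through an exterior
  derivative can be evaluated on the sphere side.

  Constants: the unit sphere submerses onto the projective space of holomorphic curvature 4, so
  curvature \<open>m\<close> means a factor \<open>4 / m\<close>; unit vectors lift to squared
  length \<open>m / 4\<close>, and the Berger parameter becomes
  \<open>d = 4 * \<delta>\<^sup>2 / m\<close>.

  The curvature operator is parallel because its derivative reduces to a multiple of R(J xi, xi') -
  R(J xi', xi), which vanishes as R is J-invariant and alternating.\<close>

lemma has_derivative_along_line:
  assumes "(f has_derivative f') (at x)"
  shows "((\<lambda>s. f (x + s *\<^sub>R v)) has_vector_derivative f' v) (at 0)"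
proof -
  have 1: "((\<lambda>s. x + s *\<^sub>R v) has_vector_derivative v) (at 0)"
    by (auto intro!: derivative_eq_intros)
  have "(f has_derivative f') (at (x + 0 *\<^sub>R v))" using assms by simp
  from vector_derivative_diff_chain_within[OF 1, of f f'] this show ?thesis
    by (simp add: o_def has_derivative_at_withinI)
qed

lemma dir_deriv_eq:
  assumes "(f has_derivative f') (at x)"
  shows "dir_deriv f x v = f' v"
  unfolding dir_deriv_def by (rule vector_derivative_at[OF has_derivative_along_line[OF assms]])

text \<open>A metric is known in closed form only on \<open>W \<inter> H\<close>, so its directional
  derivatives are read off from an extension \<open>f\<close>. The line through \<open>x\<close> in
  a direction of \<open>H\<close> stays in \<open>W \<inter> H\<close> for small parameters, so
  agreement there suffices.\<close>

lemma dir_deriv_eq_on_subspace: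
  assumes "(f has_derivative f') (at x)" "open W" "x \<in> W \<inter> H" "subspace H" "v \<in> H"
    and eq: "\<And>y. y \<in> W \<inter> H \<Longrightarrow> g y = f y"
  shows "dir_deriv g x v = f' v"
proof -
  have "((\<lambda>s. x + s *\<^sub>R v) \<longlongrightarrow> x + 0 *\<^sub>R v) (nhds 0)"
    by (intro tendsto_intros filterlim_ident)
  then have "\<forall>\<^sub>F s in nhds 0. x + s *\<^sub>R v \<in> W"
    using assms(2,3) by (auto simp: topological_tendstoD)
  then have "\<forall>\<^sub>F s in nhds 0. f (x + s *\<^sub>R v) = g (x + s *\<^sub>R v)"
    by eventually_elim (use assms in \<open>auto simp: subspace_add subspace_scale\<close>)
  then obtain S where "open S" "0 \<in> S" and S: "\<And>s. s \<in> S \<Longrightarrow> f (x + s *\<^sub>R v) = g (x + s *\<^sub>R v)"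
    by (auto simp: eventually_nhds)
  from has_vector_derivative_transform_within_open[OF has_derivative_along_line[OF assms(1)] this]
  show ?thesis unfolding dir_deriv_def by (rule vector_derivative_at)
qed

lemma has_vector_derivative_in_subspace:
  fixes u :: "real \<Rightarrow> 'a::euclidean_space"
  assumes "(u has_vector_derivative d) (at t)" "open T" "t \<in> T" "subspace H" "\<And>s. s \<in> T \<Longrightarrow> u s \<in> H"
  shows "d \<in> H"
proof -
  obtain v v' where v: "v \<in> span H" "\<And>w. w \<in> span H \<Longrightarrow> orthogonal v' w" "d = v + v'"
    using orthogonal_subspace_decomp_exists by blast
  have "((\<lambda>s. u s \<bullet> v') has_vector_derivative d \<bullet> v') (at t)"
    by (rule bounded_linear.has_vector_derivative[OF bounded_linear_inner_left assms(1)])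
  moreover have "((\<lambda>s. u s \<bullet> v') has_vector_derivative 0) (at t)"
    by (rule has_vector_derivative_transform_within_open[of "\<lambda>s. 0", OF has_vector_derivative_const assms(2,3)])
      (use v(2)[OF span_base[OF assms(5)]] in \<open>simp add: orthogonal_def inner_commute\<close>)
  ultimately have "d \<bullet> v' = 0" using vector_derivative_unique_at by blast
  moreover have "v \<bullet> v' = 0" using v(2)[OF v(1)] by (simp add: orthogonal_def inner_commute[of v])
  ultimately have "v' = 0" by (simp add: v(3) inner_add_left)
  with v assms(4) show ?thesis by (simp add: span_eq_iff[THEN iffD2])
qed

text \<open>Riesz representation for the inner product pulled back by \<open>\<alpha>\<close>: a
  left inverse of \<open>\<alpha>\<close> moves \<open>f\<close> to the image of \<open>H\<close>,
  and the representing vector is projected onto that image. It supplies the existence half of the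
  definite description in \<open>christoffel\<close>.\<close>

lemma linear_functional_representation:
  fixes f :: "'a::euclidean_space \<Rightarrow> real" and \<alpha> :: "'a \<Rightarrow> 'b::euclidean_space"
  assumes "linear f" "linear \<alpha>" "subspace H" "\<And>a. a \<in> H \<Longrightarrow> \<alpha> a = 0 \<Longrightarrow> a = 0"
  obtains w where "w \<in> H" "\<And>z. z \<in> H \<Longrightarrow> \<alpha> w \<bullet> \<alpha> z = f z"
proof -
  have "inj_on \<alpha> (span H)"
    using assms by (simp add: linear_inj_on_iff_eq_0 span_eq_iff[THEN iffD2])
  then obtain \<beta> where \<beta>: "linear \<beta>" "\<And>z. z \<in> H \<Longrightarrow> \<beta> (\<alpha> z) = z"
    using linear_exists_left_inverse_on[OF assms(2,3)] assms(3)
    by (auto simp: span_eq_iff[THEN iffD2])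
  define g where "g = adjoint (f \<circ> \<beta>) 1"
  have g: "f z = \<alpha> z \<bullet> g" if "z \<in> H" for z
    using adjoint_works[OF linear_compose[OF \<beta>(1) assms(1)], of "\<alpha> z" 1] \<beta>(2)[OF that]
    by (simp add: g_def)
  have V: "subspace (\<alpha> ` H)" using assms linear_subspace_image by blast
  obtain v v' where v: "v \<in> span (\<alpha> ` H)" "\<And>w. w \<in> span (\<alpha> ` H) \<Longrightarrow> orthogonal v' w" "g = v + v'"
    using orthogonal_subspace_decomp_exists by blast
  then obtain w where w: "w \<in> H" "v = \<alpha> w" using V by (auto simp: span_eq_iff[THEN iffD2])
  have "\<alpha> w \<bullet> \<alpha> z = f z" if "z \<in> H" for z
    using v(2)[of "\<alpha> z"] v(3) w that g[OF that]
    by (simp add: orthogonal_def inner_add_right inner_commute span_base)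
  with w show ?thesis using that by blast
qed

text \<open>Expanding the argument in a basis reduces the product rule to the maps
  \<open>\<lambda>y. \<alpha> y b\<close> with \<open>b\<close> fixed, so no joint differentiability
  in both arguments is involved.\<close>

lemma has_vector_derivative_linear_family:
  fixes \<alpha> :: "'a::euclidean_space \<Rightarrow> 'a \<Rightarrow> 'b::real_normed_vector"
  assumes "\<And>a. ((\<lambda>y. \<alpha> y a) has_derivative (\<lambda>v. \<alpha>' v a)) (at (u t))"
    and "\<And>y. y \<in> U \<Longrightarrow> linear (\<alpha> y)" "\<And>v. linear (\<alpha>' v)"
    and "open T" "t \<in> T" "\<And>s. s \<in> T \<Longrightarrow> u s \<in> U"
    and "(u has_vector_derivative u') (at t)" "(a has_vector_derivative a') (at t)"
  shows "((\<lambda>s. \<alpha> (u s) (a s)) has_vector_derivative \<alpha>' u' (a t) + \<alpha> (u t) a') (at t)"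
proof -
  have exp: "l x = (\<Sum>b\<in>Basis. (x \<bullet> b) *\<^sub>R l b)" if "linear l" for l :: "'a \<Rightarrow> 'b" and x
  proof -
    have "l (\<Sum>b\<in>Basis. (x \<bullet> b) *\<^sub>R b) = (\<Sum>b\<in>Basis. (x \<bullet> b) *\<^sub>R l b)"
      by (simp only: linear_sum[OF that] linear_scale[OF that])
    then show ?thesis by (simp only: euclidean_representation)
  qed
  have d: "((\<lambda>s. \<alpha> (u s) b) has_vector_derivative \<alpha>' u' b) (at t)" for b
    using vector_derivative_diff_chain_within[OF assms(7), of "\<lambda>y. \<alpha> y b" "\<lambda>v. \<alpha>' v b"] assms(1)[of b]
    by (simp add: o_def has_derivative_at_withinI)
  have "((\<lambda>s. \<Sum>b\<in>Basis. (a s \<bullet> b) *\<^sub>R \<alpha> (u s) b) has_vector_derivative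
      (\<Sum>b\<in>Basis. (a t \<bullet> b) *\<^sub>R \<alpha>' u' b + (a' \<bullet> b) *\<^sub>R \<alpha> (u t) b)) (at t)"
    by (intro has_vector_derivative_sum has_vector_derivative_scaleR d
        bounded_linear.has_vector_derivative[OF bounded_linear_inner_left assms(8),
          folded has_real_derivative_iff_has_vector_derivative])
  also have "(\<Sum>b\<in>Basis. (a t \<bullet> b) *\<^sub>R \<alpha>' u' b + (a' \<bullet> b) *\<^sub>R \<alpha> (u t) b)
      = \<alpha>' u' (a t) + \<alpha> (u t) a'"
    using assms(2)[OF assms(6)[OF assms(5)]] assms(3)[of u'] by (simp add: sum.distrib exp[symmetric])
  finally have *: "((\<lambda>s. \<Sum>b\<in>Basis. (a s \<bullet> b) *\<^sub>R \<alpha> (u s) b) has_vector_derivative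
      \<alpha>' u' (a t) + \<alpha> (u t) a') (at t)" .
  show ?thesis
  proof (rule has_vector_derivative_transform_within_open[OF * assms(4,5)])
    show "(\<Sum>b\<in>Basis. (a s \<bullet> b) *\<^sub>R \<alpha> (u s) b) = \<alpha> (u s) (a s)" if "s \<in> T" for s
      using exp[OF assms(2)[OF assms(6)[OF that]], of "a s"] by simp
  qed
qed

lemma smooth_on_curve:
  assumes "smooth_on T u" "t \<in> T" "open T"
  shows "(u has_vector_derivative vector_derivative u (at t)) (at t)"
    and "((\<lambda>s. vector_derivative u (at s)) has_vector_derivative
           vector_derivative (\<lambda>s. vector_derivative u (at s)) (at t)) (at t)"
proof -
  have "Ck_on 2 u T" using assms by (simp add: smooth_on_def)
  then have 1: "\<And>s. s \<in> T \<Longrightarrow> u differentiable (at s)"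
    and 2: "(\<lambda>x. frechet_derivative u (at x) 1) differentiable (at t)"
    using assms(2) by (auto simp: numeral_2_eq_2)
  have 3: "frechet_derivative u (at s) 1 = vector_derivative u (at s)" if "s \<in> T" for s
    using frechet_derivative_eq_vector_derivative[OF 1[OF that]] by simp
  show "(u has_vector_derivative vector_derivative u (at t)) (at t)"
    using 1[OF assms(2)] by (simp add: vector_derivative_works)
  obtain d where "((\<lambda>x. frechet_derivative u (at x) 1) has_vector_derivative d) (at t)"
    using 2 by (auto simp: vector_derivative_works)
  then have "((\<lambda>s. vector_derivative u (at s)) has_vector_derivative d) (at t)"
    by (rule has_vector_derivative_transform_within_open[OF _ assms(3,2)]) (simp add: 3)
  then show "((\<lambda>s. vector_derivative u (at s)) has_vector_derivative
           vector_derivative (\<lambda>s. vector_derivative u (at s)) (at t)) (at t)"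
    by (metis vector_derivative_at)
qed

text \<open>For a metric \<open>c \<bar>\<alpha>\<bar>\<^sup>2\<close> given by a vector valued one-form \<open>\<alpha>\<close>, the Euler--Lagrange equation
  of the energy is \<open>\<langle>\<alpha>(u')', \<alpha>(z)\<rangle> + \<langle>\<alpha>(u'), d\<alpha>(u', z)\<rangle> = 0\<close>. It only involves the exterior
  derivative of \<open>\<alpha>\<close>, which commutes with pullbacks.\<close>

lemma geodesic_euler_lagrange:
  fixes \<alpha> :: "'a::euclidean_space \<Rightarrow> 'a \<Rightarrow> 'b::euclidean_space" and c :: real
  assumes H: "subspace H" and W: "open W" and c: "c > 0"
    and G: "\<And>y a b. y \<in> W \<inter> H \<Longrightarrow> a \<in> H \<Longrightarrow> b \<in> H \<Longrightarrow> G y a b = c * (\<alpha> y a \<bullet> \<alpha> y b)"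
    and lin: "\<And>y. y \<in> W \<inter> H \<Longrightarrow> linear (\<alpha> y)"
    and der: "\<And>y a. y \<in> W \<inter> H \<Longrightarrow> ((\<lambda>y. \<alpha> y a) has_derivative (\<lambda>v. \<alpha>' y v a)) (at y)"
    and lin': "\<And>y v. y \<in> W \<inter> H \<Longrightarrow> linear (\<alpha>' y v)"
    and inj: "\<And>y a. y \<in> W \<inter> H \<Longrightarrow> a \<in> H \<Longrightarrow> \<alpha> y a = 0 \<Longrightarrow> a = 0"
    and T: "open T" "t \<in> T" "\<And>s. s \<in> T \<Longrightarrow> u s \<in> W \<inter> H"
    and geo: "geodesic_in_coordinates H G T u"
  obtains D where "((\<lambda>s. \<alpha> (u s) (vector_derivative u (at s))) has_vector_derivative D) (at t)"
    "vector_derivative u (at t) \<in> H"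
    "\<And>z. z \<in> H \<Longrightarrow> D \<bullet> \<alpha> (u t) z + \<alpha> (u t) (vector_derivative u (at t)) \<bullet>
       (\<alpha>' (u t) (vector_derivative u (at t)) z - \<alpha>' (u t) z (vector_derivative u (at t))) = 0"
proof -
  define u1 where "u1 s = vector_derivative u (at s)" for s
  define u2 where "u2 = vector_derivative (\<lambda>s. vector_derivative u (at s)) (at t)"
  define x v where "x = u t" and "v = u1 t"
  have sm: "smooth_on T u" using geo by (simp add: geodesic_in_coordinates_def)
  have u1: "(u has_vector_derivative u1 s) (at s)" if "s \<in> T" for s
    using smooth_on_curve(1)[OF sm that T(1)] by (simp add: u1_def)
  have u2: "(u1 has_vector_derivative u2) (at t)"
    using smooth_on_curve(2)[OF sm T(2,1)] by (simp add: u1_def[abs_def] u2_def)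
  have u1H: "u1 s \<in> H" if "s \<in> T" for s
    by (rule has_vector_derivative_in_subspace[OF u1[OF that] T(1) that H]) (use T in auto)
  have x: "x \<in> W \<inter> H" using T by (simp add: x_def)
  have v: "v \<in> H" using u1H T by (simp add: v_def)
  have dG: "dir_deriv (\<lambda>y. G y a b) x d = c * (\<alpha>' x d a \<bullet> \<alpha> x b + \<alpha> x a \<bullet> \<alpha>' x d b)"
    if "a \<in> H" "b \<in> H" "d \<in> H" for a b d
    by (rule dir_deriv_eq_on_subspace[OF _ W x H, where f = "\<lambda>y. c * (\<alpha> y a \<bullet> \<alpha> y b)"
          and f' = "\<lambda>d. c * (\<alpha>' x d a \<bullet> \<alpha> x b + \<alpha> x a \<bullet> \<alpha>' x d b)"])
      (use that G in \<open>auto intro!: derivative_eq_intros der[OF x] simp: algebra_simps\<close>)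
  \<comment> \<open>By the product rule, \<open>c * f z\<close> is the right-hand side of the
    Christoffel formula when both lower arguments are \<open>v\<close>.\<close>
  define f where "f z = \<alpha>' x v v \<bullet> \<alpha> x z + \<alpha> x v \<bullet> (\<alpha>' x v z - \<alpha>' x z v)" for z
  have linv: "linear (\<lambda>z. \<alpha>' x z v)"
    using der[OF x] has_derivative_linear by blast
  have "linear f"
    using lin[OF x] lin'[OF x, of v] linear_add[OF linv] linear_scale[OF linv]
    by (auto intro!: linearI simp: f_def linear_add linear_scale inner_add inner_diff algebra_simps)
  from linear_functional_representation[OF this lin[OF x] H inj[OF x]]
  obtain w where w: "w \<in> H" "\<And>z. z \<in> H \<Longrightarrow> \<alpha> x w \<bullet> \<alpha> x z = f z" by blast
  have rhs: "(dir_deriv (\<lambda>y. G y v z) x v + dir_deriv (\<lambda>y. G y v z) x v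
                        - dir_deriv (\<lambda>y. G y v v) x z) / 2 = c * f z" if "z \<in> H" for z
    using that v by (simp add: dG f_def inner_commute inner_diff_right field_simps)
  have "christoffel H G x v v = w"
    unfolding christoffel_def
  proof (rule the_equality)
    show "w \<in> H \<and> (\<forall>z\<in>H. G x w z = (dir_deriv (\<lambda>y. G y v z) x v + dir_deriv (\<lambda>y. G y v z) x v
                        - dir_deriv (\<lambda>y. G y v v) x z) / 2)"
      using w rhs G[OF x] by auto
  next
    fix w' assume w': "w' \<in> H \<and> (\<forall>z\<in>H. G x w' z = (dir_deriv (\<lambda>y. G y v z) x v
        + dir_deriv (\<lambda>y. G y v z) x v - dir_deriv (\<lambda>y. G y v v) x z) / 2)"
    then have "\<alpha> x w' \<bullet> \<alpha> x z = \<alpha> x w \<bullet> \<alpha> x z" if "z \<in> H" for z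
      using w rhs[OF that] G[OF x] c that by auto
    then have "\<alpha> x (w' - w) \<bullet> \<alpha> x (w' - w) = 0"
      using w w' H by (simp add: linear_diff[OF lin[OF x]] inner_diff_left inner_diff_right)
    then show "w' = w" using inj[OF x, of "w' - w"] w w' H by (simp add: subspace_diff)
  qed
  then have u2w: "u2 = - w"
    using geo T(2) unfolding geodesic_in_coordinates_def x_def v_def u1_def u2_def
    by (auto simp: eq_neg_iff_add_eq_0)
  show thesis
  proof (rule that)
    show "((\<lambda>s. \<alpha> (u s) (vector_derivative u (at s))) has_vector_derivative
        \<alpha>' x v v + \<alpha> x u2) (at t)"
      using has_vector_derivative_linear_family[OF der[OF x, unfolded x_def] lin lin'[OF x, unfolded x_def] T(1,2,3)
          u1[OF T(2)] u2] by (simp add: v_def x_def u1_def)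
    show "vector_derivative u (at t) \<in> H" using v by (simp add: v_def u1_def)
    show "(\<alpha>' x v v + \<alpha> x u2) \<bullet> \<alpha> (u t) z + \<alpha> (u t) (vector_derivative u (at t)) \<bullet>
       (\<alpha>' (u t) (vector_derivative u (at t)) z - \<alpha>' (u t) z (vector_derivative u (at t))) = 0"
      if "z \<in> H" for z
      using w(2)[OF that] unfolding f_def u2w linear_neg[OF lin[OF x]]
      by (simp add: x_def[symmetric] u1_def[symmetric] v_def[symmetric] inner_add_left algebra_simps)
  qed
qed


section \<open>Symmetry of second derivatives and naturality of the Euler--Lagrange equation\<close>

text \<open>The mean value theorem in direction \<open>a\<close> turns the second difference into
  \<open>h\<close> times a difference of values of \<open>\<lambda>x. f' x a\<close>.
  Differentiability of that map at the single point \<open>y\<close> then gives the limit.\<close>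

lemma second_difference_tendsto:
  fixes f :: "'a::real_normed_vector \<Rightarrow> real"
  assumes U: "open U" "y \<in> U" and f: "\<And>x. x \<in> U \<Longrightarrow> (f has_derivative f' x) (at x)"
    and A: "((\<lambda>x. f' x a) has_derivative A) (at y)"
  shows "((\<lambda>h. (f (y + h *\<^sub>R a + h *\<^sub>R b) - f (y + h *\<^sub>R a) - f (y + h *\<^sub>R b) + f y) / h\<^sup>2) \<longlongrightarrow> A b)
    (at_right 0)"
proof (rule tendstoI)
  fix e :: real assume "e > 0"
  \<comment> \<open>The linear approximation is used at two points, at distances at most
    \<open>h * (norm a + norm b)\<close> and \<open>h * norm a\<close> from \<open>y\<close>.
    Tolerance \<open>e / (2 * M)\<close> makes the total error at most \<open>h * e / 2\<close>; the
    summand 1 keeps \<open>M\<close> positive.\<close>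
  define M where "M = 2 * norm a + norm b + 1"
  have M: "M > 0" unfolding M_def by (smt (verit) norm_ge_zero)
  have linA: "linear A" using A has_derivative_linear by blast
  obtain d where d: "d > 0" "\<And>x. norm (x - y) < d \<Longrightarrow>
      norm (f' x a - f' y a - A (x - y)) \<le> e / (2 * M) * norm (x - y)"
    using A[unfolded has_derivative_at_alt] \<open>e > 0\<close> M
    by (metis divide_pos_pos mult_pos_pos zero_less_numeral)
  obtain d' where d': "d' > 0" "ball y d' \<subseteq> U" using U openE by blast
  define D where "D = min d d' / M"
  have "D > 0" using d d' M by (simp add: D_def)
  have main: "\<bar>(f (y + h *\<^sub>R a + h *\<^sub>R b) - f (y + h *\<^sub>R a) - f (y + h *\<^sub>R b) + f y) / h\<^sup>2 - A b\<bar> < e"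
    if h: "0 < h" "h < D" for h
  proof -
    have hM: "h * M < min d d'" using h M by (simp add: D_def pos_less_divide_eq)
    have small: "norm (s *\<^sub>R a + r *\<^sub>R b) \<le> h * (norm a + norm b)" "norm (s *\<^sub>R a + r *\<^sub>R b) < min d d'"
      if "0 \<le> s" "s \<le> h" "0 \<le> r" "r \<le> h" for s r
    proof -
      have "norm (s *\<^sub>R a + r *\<^sub>R b) \<le> s * norm a + r * norm b"
        using that by (metis norm_triangle_ineq norm_scaleR abs_of_nonneg)
      also have "\<dots> \<le> h * (norm a + norm b)"
        using that by (simp add: distrib_left add_mono mult_right_mono)
      finally show 1: "norm (s *\<^sub>R a + r *\<^sub>R b) \<le> h * (norm a + norm b)" .
      also have "\<dots> \<le> h * M" unfolding M_def using h by (intro mult_left_mono) auto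
      finally show "norm (s *\<^sub>R a + r *\<^sub>R b) < min d d'" using hM by linarith
    qed
    have inU: "y + s *\<^sub>R a + r *\<^sub>R b \<in> U" if "0 \<le> s" "s \<le> h" "0 \<le> r" "r \<le> h" for s r
    proof -
      have "y + s *\<^sub>R a + r *\<^sub>R b \<in> ball y d'"
        using small(2)[OF that] by (simp add: mem_ball dist_commute[of y] add.assoc) (simp add: dist_norm)
      then show ?thesis using d' by blast
    qed
    define g where "g s = f (y + s *\<^sub>R a + h *\<^sub>R b) - f (y + s *\<^sub>R a)" for s
    have line: "((\<lambda>s. f (y + s *\<^sub>R a + r *\<^sub>R b)) has_derivative (\<lambda>x. f' (y + s *\<^sub>R a + r *\<^sub>R b) (x *\<^sub>R a))) (at s)"
      if "0 \<le> s" "s \<le> h" "0 \<le> r" "r \<le> h" for s r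
    proof (rule has_derivative_compose[where g = f and f = "\<lambda>s. y + s *\<^sub>R a + r *\<^sub>R b"])
      show "((\<lambda>s. y + s *\<^sub>R a + r *\<^sub>R b) has_derivative (\<lambda>x. x *\<^sub>R a)) (at s)"
        by (auto intro!: derivative_eq_intros)
    qed (rule f[OF inU[OF that]])
    have lin': "linear (f' (y + s *\<^sub>R a + r *\<^sub>R b))" if "0 \<le> s" "s \<le> h" "0 \<le> r" "r \<le> h" for s r
      using f[OF inU[OF that]] has_derivative_linear by blast
    have "(g has_real_derivative f' (y + s *\<^sub>R a + h *\<^sub>R b) a - f' (y + s *\<^sub>R a) a) (at s)"
      if "0 \<le> s" "s \<le> h" for s
      unfolding g_def has_field_derivative_def
      using has_derivative_eq_rhs[OF has_derivative_diff[OF line[OF that, of h] line[OF that, of 0]],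
          of "(*) (f' (y + s *\<^sub>R a + h *\<^sub>R b) a - f' (y + s *\<^sub>R a) a)"] h
        linear_scale[OF lin'[OF that, of h]] linear_scale[OF lin'[OF that, of 0]]
      by (simp add: fun_eq_iff left_diff_distrib right_diff_distrib mult.commute)
    from MVT2[OF h(1) this] obtain s where s: "0 < s" "s < h"
      "g h - g 0 = (h - 0) * (f' (y + s *\<^sub>R a + h *\<^sub>R b) a - f' (y + s *\<^sub>R a) a)" by auto
    have e1: "norm (f' (y + s *\<^sub>R a + h *\<^sub>R b) a - f' y a - A (s *\<^sub>R a + h *\<^sub>R b)) \<le> e / (2 * M) * (h * (norm a + norm b))"
    proof -
      have n: "norm (s *\<^sub>R a + h *\<^sub>R b) \<le> h * (norm a + norm b)" "norm (s *\<^sub>R a + h *\<^sub>R b) < d"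
        using small[of s h] s h by auto
      then have "norm (f' (y + s *\<^sub>R a + h *\<^sub>R b) a - f' y a - A (s *\<^sub>R a + h *\<^sub>R b))
          \<le> e / (2 * M) * norm (s *\<^sub>R a + h *\<^sub>R b)"
        using d(2)[of "y + s *\<^sub>R a + h *\<^sub>R b"] by (simp add: add.assoc)
      also have "\<dots> \<le> e / (2 * M) * (h * (norm a + norm b))"
        using n(1) \<open>e > 0\<close> M by (intro mult_left_mono) auto
      finally show ?thesis .
    qed
    have e2: "norm (f' (y + s *\<^sub>R a) a - f' y a - A (s *\<^sub>R a)) \<le> e / (2 * M) * (h * norm a)"
    proof -
      have "norm (s *\<^sub>R a) < d" using small(2)[of s 0] s h by simp
      then have "norm (f' (y + s *\<^sub>R a) a - f' y a - A (s *\<^sub>R a)) \<le> e / (2 * M) * norm (s *\<^sub>R a)"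
        using d(2)[of "y + s *\<^sub>R a"] by simp
      also have "\<dots> \<le> e / (2 * M) * (h * norm a)"
        using s \<open>e > 0\<close> M by (intro mult_left_mono) (auto simp: mult_right_mono)
      finally show ?thesis .
    qed
    have "A (s *\<^sub>R a + h *\<^sub>R b) - A (s *\<^sub>R a) = h * A b"
      by (simp add: linear_add[OF linA] linear_scale[OF linA])
    then have "\<bar>(f' (y + s *\<^sub>R a + h *\<^sub>R b) a - f' (y + s *\<^sub>R a) a) - h * A b\<bar>
       \<le> e / (2 * M) * (h * (norm a + norm b)) + e / (2 * M) * (h * norm a)"
      using e1 e2 unfolding real_norm_def by linarith
    also have "\<dots> = h * (e * ((2 * norm a + norm b) / (2 * M)))"
      by (simp add: algebra_simps add_divide_distrib)
    also have "(2 * norm a + norm b) / (2 * M) \<le> 1 / 2"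
      using M by (simp add: M_def divide_simps)
    finally have "\<bar>(f' (y + s *\<^sub>R a + h *\<^sub>R b) a - f' (y + s *\<^sub>R a) a) - h * A b\<bar> \<le> h * (e * (1/2))"
      using h(1) \<open>e > 0\<close> by (simp add: mult_left_mono)
    then have "\<bar>(f' (y + s *\<^sub>R a + h *\<^sub>R b) a - f' (y + s *\<^sub>R a) a) - h * A b\<bar> < h * e"
      using mult_pos_pos[OF h(1) \<open>e > 0\<close>] by linarith
    moreover have "f (y + h *\<^sub>R a + h *\<^sub>R b) - f (y + h *\<^sub>R a) - f (y + h *\<^sub>R b) + f y = g h - g 0"
      by (simp add: g_def)
    moreover have "(h * q) / h\<^sup>2 - A b = (q - h * A b) / h" for q
      using h(1) by (simp add: power2_eq_square field_simps)
    ultimately have "(f (y + h *\<^sub>R a + h *\<^sub>R b) - f (y + h *\<^sub>R a) - f (y + h *\<^sub>R b) + f y) / h\<^sup>2 - A b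
       = (f' (y + s *\<^sub>R a + h *\<^sub>R b) a - f' (y + s *\<^sub>R a) a - h * A b) / h"
      and "\<bar>f' (y + s *\<^sub>R a + h *\<^sub>R b) a - f' (y + s *\<^sub>R a) a - h * A b\<bar> < e * h"
      using s(3) by (simp_all only: diff_0_right mult.commute[of e])
    then show ?thesis using h(1) by (simp only: abs_divide abs_of_pos pos_divide_less_eq)
  qed
  show "\<forall>\<^sub>F h in at_right 0. dist ((f (y + h *\<^sub>R a + h *\<^sub>R b) - f (y + h *\<^sub>R a) - f (y + h *\<^sub>R b) + f y) / h\<^sup>2) (A b) < e"
    unfolding eventually_at_right_field dist_real_def
    by (intro exI[of _ D] conjI \<open>D > 0\<close> allI impI main) simp_all
qed

text \<open>The second difference quotient is symmetric in \<open>a\<close> and \<open>b\<close> and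
  tends to either side; pairing with basis vectors reduces to real functions.\<close>

lemma second_derivative_symmetric:
  fixes f :: "'a::real_normed_vector \<Rightarrow> 'b::euclidean_space"
  assumes U: "open U" "y \<in> U" and f: "\<And>x. x \<in> U \<Longrightarrow> (f has_derivative f' x) (at x)"
    and A: "((\<lambda>x. f' x a) has_derivative A) (at y)" and B: "((\<lambda>x. f' x b) has_derivative B) (at y)"
  shows "A b = B a"
proof (rule euclidean_eqI)
  fix e :: 'b
  have "((\<lambda>h. (f (y + h *\<^sub>R a + h *\<^sub>R b) \<bullet> e - f (y + h *\<^sub>R a) \<bullet> e - f (y + h *\<^sub>R b) \<bullet> e + f y \<bullet> e) / h\<^sup>2)
      \<longlongrightarrow> A b \<bullet> e) (at_right 0)"
    by (rule second_difference_tendsto[OF U, where f' = "\<lambda>x v. f' x v \<bullet> e"])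
      (auto intro!: has_derivative_inner_left f A)
  moreover have "((\<lambda>h. (f (y + h *\<^sub>R b + h *\<^sub>R a) \<bullet> e - f (y + h *\<^sub>R b) \<bullet> e - f (y + h *\<^sub>R a) \<bullet> e + f y \<bullet> e) / h\<^sup>2)
      \<longlongrightarrow> B a \<bullet> e) (at_right 0)"
    by (rule second_difference_tendsto[OF U, where f' = "\<lambda>x v. f' x v \<bullet> e"])
      (auto intro!: has_derivative_inner_left f B)
  moreover have "y + h *\<^sub>R b + h *\<^sub>R a = y + h *\<^sub>R a + h *\<^sub>R b" for h by simp
  ultimately show "A b \<bullet> e = B a \<bullet> e"
    by (intro tendsto_unique[OF trivial_limit_at_right_real]) (auto simp: algebra_simps)
qed

text \<open>The one-form \<open>\<alpha> y a = \<omega> (F y) (DF y a)\<close> has an additional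
  derivative term with the second derivative of \<open>F\<close>. That term is symmetric, hence
  cancels in the exterior derivative, and the resulting equation only involves
  \<open>\<omega>\<close> and tangent vectors of the image of \<open>F\<close>.\<close>

lemma pullback_geodesic_euler_lagrange:
  fixes \<omega> :: "'b::euclidean_space \<Rightarrow> 'b \<Rightarrow> 'c::euclidean_space" and F :: "'a::euclidean_space \<Rightarrow> 'b"
  assumes H: "subspace H" and W: "open W" and c: "c > 0"
    and G: "\<And>y a b. y \<in> W \<inter> H \<Longrightarrow> a \<in> H \<Longrightarrow> b \<in> H \<Longrightarrow>
      G y a b = c * (\<omega> (F y) (DF y a) \<bullet> \<omega> (F y) (DF y b))"
    and F: "\<And>y. y \<in> W \<Longrightarrow> (F has_derivative DF y) (at y)"
    and DF: "\<And>y a. y \<in> W \<Longrightarrow> (\<lambda>y. DF y a) differentiable (at y)"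
    and \<omega>: "\<And>q a. ((\<lambda>(q, a). \<omega> q a) has_derivative (\<lambda>(b, c). \<omega>' q b a + \<omega> q c)) (at (q, a))"
    and inj: "\<And>y a. y \<in> W \<inter> H \<Longrightarrow> a \<in> H \<Longrightarrow> \<omega> (F y) (DF y a) = 0 \<Longrightarrow> a = 0"
    and lin: "\<And>q. linear (\<omega> q)" "\<And>q b. linear (\<omega>' q b)"
    and T: "open T" "t \<in> T" "\<And>s. s \<in> T \<Longrightarrow> u s \<in> W \<inter> H"
    and geo: "geodesic_in_coordinates H G T u"
  obtains D a where "\<And>s. s \<in> T \<Longrightarrow> ((\<lambda>s. F (u s)) has_vector_derivative DF (u s) (vector_derivative u (at s))) (at s)"
    "a = DF (u t) (vector_derivative u (at t))" "vector_derivative u (at t) \<in> H"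
    "((\<lambda>s. \<omega> (F (u s)) (DF (u s) (vector_derivative u (at s)))) has_vector_derivative D) (at t)"
    "\<And>z. z \<in> H \<Longrightarrow> D \<bullet> \<omega> (F (u t)) (DF (u t) z) +
       \<omega> (F (u t)) a \<bullet> (\<omega>' (F (u t)) a (DF (u t) z) - \<omega>' (F (u t)) (DF (u t) z) a) = 0"
proof -
  define D2 where "D2 y v a = frechet_derivative (\<lambda>y. DF y a) (at y) v" for y v a
  have D2: "((\<lambda>y. DF y a) has_derivative (\<lambda>v. D2 y v a)) (at y)" if "y \<in> W" for y a
    using DF[OF that] unfolding D2_def frechet_derivative_works .
  have linDF: "linear (DF y)" if "y \<in> W" for y using F[OF that] has_derivative_linear by blast
  have sym: "D2 y v a = D2 y a v" if "y \<in> W" for y v a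
    using second_derivative_symmetric[OF W that F D2[OF that, of a] D2[OF that, of v]] by simp
  define \<alpha> where "\<alpha> y a = \<omega> (F y) (DF y a)" for y a
  define \<alpha>' where "\<alpha>' y v a = \<omega>' (F y) (DF y v) (DF y a) + \<omega> (F y) (D2 y v a)" for y v a
  \<comment> \<open>A derivative is linear in its direction, the first vector argument of
    \<open>D2\<close>; symmetry carries this over to the second.\<close>
  have linD2: "linear (D2 y v)" if "y \<in> W" for y v
    using sym[OF that] D2[OF that, of v] has_derivative_linear by (metis (no_types, lifting) ext)
  have \<alpha>': "((\<lambda>y. \<alpha> y a) has_derivative (\<lambda>v. \<alpha>' y v a)) (at y)" if "y \<in> W \<inter> H" for y a
    using has_derivative_compose[OF has_derivative_Pair[OF F D2[of y a]] \<omega>] that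
    by (simp add: \<alpha>_def[abs_def] \<alpha>'_def)
  have lin\<alpha>: "linear (\<alpha> y)" if "y \<in> W \<inter> H" for y
    using linear_compose[OF linDF lin(1), of y "F y"] that by (simp add: \<alpha>_def[abs_def] o_def)
  have lin\<alpha>': "linear (\<alpha>' y v)" if "y \<in> W \<inter> H" for y v
    using linear_compose_add[OF linear_compose[OF linDF[of y] lin(2)[of "F y" "DF y v"]]
      linear_compose[OF linD2[of y v] lin(1)[of "F y"]]] that by (simp add: \<alpha>'_def[abs_def] o_def)
  have G': "G y a b = c * (\<alpha> y a \<bullet> \<alpha> y b)" if "y \<in> W \<inter> H" "a \<in> H" "b \<in> H" for y a b
    using G[OF that] by (simp only: \<alpha>_def)
  have inj': "a = 0" if "y \<in> W \<inter> H" "a \<in> H" "\<alpha> y a = 0" for y a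
    using inj[OF that(1,2)] that(3) by (simp only: \<alpha>_def)
  obtain D where D: "((\<lambda>s. \<alpha> (u s) (vector_derivative u (at s))) has_vector_derivative D) (at t)"
    "vector_derivative u (at t) \<in> H"
    "\<And>z. z \<in> H \<Longrightarrow> D \<bullet> \<alpha> (u t) z + \<alpha> (u t) (vector_derivative u (at t)) \<bullet>
       (\<alpha>' (u t) (vector_derivative u (at t)) z - \<alpha>' (u t) z (vector_derivative u (at t))) = 0"
    by (rule geodesic_euler_lagrange[where G = G and \<alpha> = \<alpha> and \<alpha>' = \<alpha>',
          OF H W c G' lin\<alpha> \<alpha>' lin\<alpha>' inj' T geo]; (rule that)?; assumption)
  have sm: "smooth_on T u" using geo by (simp add: geodesic_in_coordinates_def)
  show thesis
  proof (rule that[OF _ refl D(2) D(1)[unfolded \<alpha>_def]])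
    show "((\<lambda>s. F (u s)) has_vector_derivative DF (u s) (vector_derivative u (at s))) (at s)" if "s \<in> T" for s
      using vector_derivative_diff_chain_within[OF smooth_on_curve(1)[OF sm that T(1)], of F "DF (u s)"]
        F T(3)[OF that] by (simp add: o_def has_derivative_at_withinI)
    have "u t \<in> W" using T by blast
    then show "D \<bullet> \<omega> (F (u t)) (DF (u t) z) +
       \<omega> (F (u t)) (DF (u t) (vector_derivative u (at t))) \<bullet>
       (\<omega>' (F (u t)) (DF (u t) (vector_derivative u (at t))) (DF (u t) z) -
        \<omega>' (F (u t)) (DF (u t) z) (DF (u t) (vector_derivative u (at t)))) = 0" if "z \<in> H" for z
      using D(3)[OF that] by (simp add: \<alpha>_def \<alpha>'_def sym[of "u t" z])
  qed
qed

section \<open>The Fubini--Study and Berger metrics on the sphere\<close>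

lemma herm_add_left: "herm (u + v) w = herm u w + herm v w"
  by (simp add: herm_def distrib_right sum.distrib)

lemma herm_add_right: "herm w (u + v) = herm w u + herm w v"
  by (simp add: herm_def distrib_left sum.distrib)

lemma herm_scale_left: "herm (c *s u) v = c * herm u v"
  by (simp add: herm_def sum_distrib_left mult.assoc)

lemma herm_scale_right: "herm u (c *s v) = cnj c * herm u v"
  by (simp add: herm_def sum_distrib_left mult_ac)

lemma scaleR_conv_scale: "r *\<^sub>R v = complex_of_real r *s v"
  by (simp add: vec_eq_iff complex_eq_iff)

lemma herm_scaleR_left: "herm (r *\<^sub>R u) v = complex_of_real r * herm u v"
  by (simp add: scaleR_conv_scale herm_scale_left)

lemma herm_scaleR_right: "herm u (r *\<^sub>R v) = complex_of_real r * herm u v"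
  by (simp add: scaleR_conv_scale herm_scale_right)

lemma herm_minus_left: "herm (- u) v = - herm u v"
  by (simp add: herm_def sum_negf)

lemma herm_minus_right: "herm u (- v) = - herm u v"
  by (simp add: herm_def sum_negf)

lemma herm_diff_left: "herm (u - v) w = herm u w - herm v w"
  using herm_add_left[of u "- v" w] by (simp add: herm_minus_left)

lemma herm_diff_right: "herm w (u - v) = herm w u - herm w v"
  using herm_add_right[of w u "- v"] by (simp add: herm_minus_right)

lemma herm_zero [simp]: "herm 0 v = 0" "herm v 0 = 0"
  by (simp_all add: herm_def)

lemma cnj_herm: "cnj (herm u v) = herm v u"
  by (simp add: herm_def mult.commute)

lemma Re_herm_commute: "Re (herm u v) = Re (herm v u)"
  by (metis cnj.simps(1) cnj_herm)

lemma inner_conv_herm: "u \<bullet> v = Re (herm u v)"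
  by (simp add: inner_vec_def herm_def inner_complex_def)

lemma herm_self: "herm u u = complex_of_real (u \<bullet> u)"
proof -
  have "Im (herm u u) = - Im (herm u u)" by (metis cnj_herm cnj.simps(2))
  then show ?thesis by (simp add: complex_eq_iff inner_conv_herm)
qed

lemmas herm_simps = herm_add_left herm_add_right herm_diff_left herm_diff_right
  herm_scale_left herm_scale_right herm_scaleR_left herm_scaleR_right herm_minus_left herm_minus_right

lemma norm_scale: "norm (c *s (v :: complex ^ 'k::finite)) = cmod c * norm v"
  by (simp add: norm_vec_def norm_mult L2_set_right_distrib)

lemma norm_herm_le: "cmod (herm u v) \<le> norm u * norm v"
proof -
  have "norm (herm u v) \<le> (\<Sum>i\<in>UNIV. norm (u $ i) * norm (v $ i))"
    unfolding herm_def by (rule order_trans[OF norm_sum]) (simp add: norm_mult)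
  also have "\<dots> \<le> norm u * norm v"
    unfolding norm_vec_def using L2_set_mult_ineq[of "\<lambda>i. norm (u $ i)" "\<lambda>i. norm (v $ i)" UNIV]
    by simp
  finally show ?thesis .
qed

lemma bounded_bilinear_herm: "bounded_bilinear (herm :: complex ^ 'k::finite \<Rightarrow> _)"
  by (rule bounded_bilinear.intro)
    (auto simp: herm_simps scaleR_conv_of_real[where 'a = complex] intro!: exI[of _ 1] norm_herm_le)

lemma bounded_bilinear_scale: "bounded_bilinear ((*s) :: complex \<Rightarrow> complex ^ 'k::finite \<Rightarrow> _)"
  by (rule bounded_bilinear.intro)
    (auto simp: vec_eq_iff algebra_simps norm_scale intro!: exI[of _ 1])

lemmas herm_has_derivative [derivative_intros] = bounded_bilinear.FDERIV[OF bounded_bilinear_herm]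
lemmas scale_has_derivative [derivative_intros] = bounded_bilinear.FDERIV[OF bounded_bilinear_scale]
lemmas herm_has_vector_derivative [derivative_intros] =
  bounded_bilinear.has_vector_derivative[OF bounded_bilinear_herm]
lemmas scale_has_vector_derivative [derivative_intros] =
  bounded_bilinear.has_vector_derivative[OF bounded_bilinear_scale]

lemma Re_has_derivative [derivative_intros]:
  "(f has_derivative f') F \<Longrightarrow> ((\<lambda>x. Re (f x)) has_derivative (\<lambda>x. Re (f' x))) F"
  by (rule bounded_linear.has_derivative[OF bounded_linear_Re])

lemma Im_has_derivative [derivative_intros]:
  "(f has_derivative f') F \<Longrightarrow> ((\<lambda>x. Im (f x)) has_derivative (\<lambda>x. Im (f' x))) F"
  by (rule bounded_linear.has_derivative[OF bounded_linear_Im])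

section \<open>Christoffel symbols of the Fubini--Study metric\<close>

definition fs_christoffel :: "complex ^ 'k::finite \<Rightarrow> complex ^ 'k \<Rightarrow> complex ^ 'k \<Rightarrow> complex ^ 'k" where
  "fs_christoffel z u v = - ((herm u z *s v + herm v z *s u) /\<^sub>R (1 + (norm z)\<^sup>2))"

lemma one_plus_norm_sq_pos: "1 + (norm z)\<^sup>2 > 0"
  by (smt (verit) zero_le_power2)

lemma fubini_study_alt:
  "fubini_study m z u v = 4 / m * (Re (herm u v) * inverse (1 + Re (herm z z))
      - Re (herm u z * herm z v) * (inverse (1 + Re (herm z z)))\<^sup>2)"
proof -
  have *: "(norm z)\<^sup>2 = Re (herm z z)" by (simp add: power2_norm_eq_inner inner_conv_herm)
  have "1 + Re (herm z z) \<noteq> 0" using one_plus_norm_sq_pos[of z] unfolding * by simp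
  then show ?thesis unfolding fubini_study_def *
    by (simp add: diff_divide_distrib power2_eq_square divide_inverse left_diff_distrib)
qed

text \<open>Both halves of the definite description are checked: the closed form satisfies the
  Christoffel formula for every \<open>x\<close>, and two solutions differ by a vector of
  \<open>affine_space i\<close> that is null when tested against itself.\<close>

lemma CP_christoffel_eq:
  fixes u v z :: "complex ^ 'k::finite"
  assumes m: "m > 0" and uv: "u \<in> affine_space i" "v \<in> affine_space i"
  shows "CP_christoffel m i z u v = fs_christoffel z u v"
proof -
  define Q where "Q = inverse (1 + Re (herm z z))"
  have "(norm z)\<^sup>2 = Re (herm z z)" by (simp add: power2_norm_eq_inner inner_conv_herm)
  then have Q: "inverse (1 + (norm z)\<^sup>2) = Q" "1 + Re (herm z z) \<noteq> 0"
    using one_plus_norm_sq_pos[of z] by (simp_all add: Q_def)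
  \<comment> \<open>The derivative of the metric coefficient of \<open>a\<close> and
    \<open>b\<close> in direction \<open>d\<close>. With \<open>Q\<close> as an atom, the
    Christoffel formula becomes a polynomial identity in \<open>Q\<close> and the Hermitian
    products.\<close>
  define dfs where "dfs a b d = 4 / m * (- Re (herm a b) * (2 * Re (herm d z)) * Q\<^sup>2
     - (Re (herm a d * herm z b + herm a z * herm d b) * Q\<^sup>2
        - 2 * Re (herm a z * herm z b) * (2 * Re (herm d z)) * Q ^ 3))"
    for a b d :: "complex ^ 'k"
  have "((\<lambda>y. fubini_study m y a b) has_derivative dfs a b) (at z)" for a b
  proof -
    have c: "Re (herm z d) + Re (herm d z) = 2 * Re (herm d z)" for d
      using cnj_herm[of z d] by (metis cnj.simps(1) mult_2)
    have q: "((\<lambda>y. inverse (1 + Re (herm y y))) has_derivative (\<lambda>d. - (2 * Re (herm d z)) * Q\<^sup>2)) (at z)"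
      by (rule has_derivative_eq_rhs, (rule derivative_eq_intros refl Q(2))+)
        (simp add: fun_eq_iff Q_def[symmetric] c power2_eq_square)
    have r: "((\<lambda>y. Re (herm a y * herm y b)) has_derivative
        (\<lambda>d. Re (herm a d * herm z b + herm a z * herm d b))) (at z)"
      by (rule has_derivative_eq_rhs, (rule derivative_eq_intros refl)+) (simp add: fun_eq_iff)
    show ?thesis
      unfolding fubini_study_alt
      by (rule has_derivative_eq_rhs, (rule derivative_eq_intros q r refl)+)
        (simp add: fun_eq_iff Q_def[symmetric] dfs_def power2_eq_square power3_eq_cube algebra_simps)
  qed
  then have d: "dir_deriv (\<lambda>y. fubini_study m y a b) z d = dfs a b d" for a b d
    by (rule dir_deriv_eq)
  have key: "fubini_study m z (fs_christoffel z u v) x = (dfs v x u + dfs u x v - dfs u v x) / 2" for x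
  proof -
    have c: "herm z u = cnj (herm u z)" "herm z v = cnj (herm v z)" "herm z x = cnj (herm x z)"
      "herm v u = cnj (herm u v)" "herm x u = cnj (herm u x)" "herm x v = cnj (herm v x)"
      by (simp_all add: cnj_herm)
    have "Re (herm (fs_christoffel z u v) x) * Q - Re (herm (fs_christoffel z u v) z * herm z x) * Q\<^sup>2
      = ((- Re (herm v x) * (2 * Re (herm u z)) * Q\<^sup>2
     - (Re (herm v u * herm z x + herm v z * herm u x) * Q\<^sup>2
        - 2 * Re (herm v z * herm z x) * (2 * Re (herm u z)) * Q ^ 3)) +
     (- Re (herm u x) * (2 * Re (herm v z)) * Q\<^sup>2
     - (Re (herm u v * herm z x + herm u z * herm v x) * Q\<^sup>2
        - 2 * Re (herm u z * herm z x) * (2 * Re (herm v z)) * Q ^ 3)) -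
     (- Re (herm u v) * (2 * Re (herm x z)) * Q\<^sup>2
     - (Re (herm u x * herm z v + herm u z * herm x v) * Q\<^sup>2
        - 2 * Re (herm u z * herm z v) * (2 * Re (herm x z)) * Q ^ 3))) / 2"
      unfolding fs_christoffel_def herm_simps c Q(1)
      by (simp add: power2_eq_square power3_eq_cube algebra_simps)
    moreover have "k * A = (k * a + k * b - k * c) / 2" if "A = (a + b - c) / 2" for k A a b c :: real
      unfolding that by (simp add: algebra_simps)
    ultimately show ?thesis
      unfolding fubini_study_alt Q_def[symmetric] dfs_def by blast
  qed
  show ?thesis
    unfolding christoffel_def d
  proof (rule the_equality)
    show "fs_christoffel z u v \<in> affine_space i \<and> (\<forall>x\<in>affine_space i. fubini_study m z (fs_christoffel z u v) x =
        (dfs v x u + dfs u x v - dfs u v x) / 2)"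
      using uv key by (simp add: affine_space_def fs_christoffel_def)
  next
    fix w assume w: "w \<in> affine_space i \<and> (\<forall>x\<in>affine_space i. fubini_study m z w x =
        (dfs v x u + dfs u x v - dfs u v x) / 2)"
    define w' where "w' = w - fs_christoffel z u v"
    have "w' \<in> affine_space i"
      using uv w by (simp add: w'_def affine_space_def fs_christoffel_def)
    then have "fubini_study m z w w' = fubini_study m z (fs_christoffel z u v) w'"
      unfolding key using w by blast
    then have "fubini_study m z w' w' = 0"
      by (simp add: w'_def fubini_study_alt herm_simps algebra_simps)
    then have "w' = 0" by (rule fubini_study_nondegenerate[OF m])
    then show "w = fs_christoffel z u v" by (simp add: w'_def)
  qed
qed

lemma scaleR_complex: "r *\<^sub>R (c :: complex) = complex_of_real r * c"
  by (rule scaleR_conv_of_real)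

text \<open>An affine point \<open>z\<close> is represented by the unit vector \<open>lift_point i z\<close> on its line, and a
  tangent vector \<open>u\<close> at \<open>z\<close> by its lift that is orthogonal to this line; up to the factor
  \<open>4 / m\<close> this is a Riemannian submersion.\<close>

definition rho :: "complex ^ 'k::finite \<Rightarrow> real" where
  "rho z = inverse (sqrt (1 + Re (herm z z)))"

definition lift_point :: "'k::finite \<Rightarrow> complex ^ 'k \<Rightarrow> complex ^ 'k" where
  "lift_point i z = rho z *\<^sub>R (z + axis i 1)"

definition lift_vec :: "'k::finite \<Rightarrow> complex ^ 'k \<Rightarrow> complex ^ 'k \<Rightarrow> complex ^ 'k" where
  "lift_vec i z u = rho z *\<^sub>R (u - (rho z)\<^sup>2 *\<^sub>R (herm u z *s (z + axis i 1)))"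

lemma Re_herm_self_nonneg: "Re (herm z z) \<ge> 0"
  using inner_ge_zero[of z] by (simp add: inner_conv_herm)

lemma rho_pos: "rho z > 0"
  unfolding rho_def using Re_herm_self_nonneg[of z] by simp

lemma rho_sq: "(rho z)\<^sup>2 = inverse (1 + Re (herm z z))"
  unfolding rho_def using Re_herm_self_nonneg[of z] by (simp add: power_inverse)

lemma rho_sq_norm: "(rho z)\<^sup>2 = inverse (1 + (norm z)\<^sup>2)"
  by (simp add: rho_sq power2_norm_eq_inner inner_conv_herm)

lemma rho_sq_mult: "(rho z)\<^sup>2 * (1 + Re (herm z z)) = 1"
  unfolding rho_sq using Re_herm_self_nonneg[of z] by simp

lemma herm_axis: "herm u (axis i 1) = u $ i"
  by (simp add: herm_def axis_def if_distrib[of cnj] sum.delta' if_distrib[of "\<lambda>x. _ * x"] cong: if_cong)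

lemma herm_axis_left: "herm (axis i 1) u = cnj (u $ i)"
  by (metis cnj_herm herm_axis)

lemma herm_self_Re: "herm z z = complex_of_real (Re (herm z z))"
  using herm_self[of z] unfolding inner_conv_herm .

lemma rho_sq_mult_complex: "(complex_of_real (rho z))\<^sup>2 * (1 + herm z z) = 1"
proof -
  have "complex_of_real ((rho z)\<^sup>2 * (1 + Re (herm z z))) = 1"
    unfolding rho_sq_mult by simp
  then show ?thesis by (simp add: herm_self_Re[symmetric])
qed

lemma herm_lift_point: "z \<in> affine_space i \<Longrightarrow> herm (lift_point i z) (lift_point i z) = 1"
  using rho_sq_mult_complex[of z]
  by (simp add: lift_point_def herm_simps herm_axis herm_axis_left affine_space_def scaleR_complex power2_eq_square algebra_simps)

lemma herm_lift_vec_point: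
  assumes "z \<in> affine_space i" "u \<in> affine_space i"
  shows "herm (lift_vec i z u) (lift_point i z) = 0"
proof -
  have "herm (lift_vec i z u) (lift_point i z)
    = (complex_of_real (rho z))\<^sup>2 * herm u z * (1 - (complex_of_real (rho z))\<^sup>2 * (1 + herm z z))"
    using assms by (simp add: lift_vec_def lift_point_def herm_simps herm_axis herm_axis_left affine_space_def
        scaleR_complex power2_eq_square algebra_simps)
  then show ?thesis by (simp add: rho_sq_mult_complex)
qed

lemma herm_lift_vec:
  assumes "z \<in> affine_space i" "u \<in> affine_space i" "v \<in> affine_space i"
  shows "herm (lift_vec i z u) (lift_vec i z v)
    = (complex_of_real (rho z))\<^sup>2 * (herm u v - (complex_of_real (rho z))\<^sup>2 * herm u z * herm z v)"
proof -
  have "herm (lift_vec i z u) (lift_vec i z v)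
    = (complex_of_real (rho z))\<^sup>2 * (herm u v - (complex_of_real (rho z))\<^sup>2 * herm u z * herm z v
        - (complex_of_real (rho z))\<^sup>2 * herm u z * herm z v * (1 - (complex_of_real (rho z))\<^sup>2 * (1 + herm z z)))"
    using assms by (simp add: lift_vec_def lift_point_def herm_simps herm_axis herm_axis_left affine_space_def
        scaleR_complex cnj_herm power2_eq_square algebra_simps)
  then show ?thesis by (simp add: rho_sq_mult_complex)
qed

lemma fubini_study_lift_vec:
  assumes "z \<in> affine_space i" "u \<in> affine_space i" "v \<in> affine_space i"
  shows "fubini_study m z u v = 4 / m * (lift_vec i z u \<bullet> lift_vec i z v)"
  unfolding fubini_study_alt inner_conv_herm herm_lift_vec[OF assms] rho_sq[symmetric]
  by (simp add: power2_eq_square algebra_simps)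

lemma lift_vec_zero_iff:
  assumes "z \<in> affine_space i" "u \<in> affine_space i" "lift_vec i z u = 0"
  shows "u = 0"
  using fubini_study_nondegenerate[of 1 z u] fubini_study_lift_vec[OF assms(1,2,2), of 1] assms(3) by simp

lemma lift_vec_surj:
  assumes "z \<in> affine_space i" "herm P (lift_point i z) = 0"
  obtains u where "u \<in> affine_space i" "lift_vec i z u = P"
proof
  \<comment> \<open>Subtracting the multiple of \<open>z + axis i 1\<close> that kills entry
    \<open>i\<close> moves \<open>P\<close> into the chart. The projection in
    \<open>lift_vec\<close> restores exactly this multiple, since \<open>P\<close> is orthogonal to
    the line.\<close>
  define u where "u = inverse (rho z) *\<^sub>R (P - P $ i *s (z + axis i 1))"
  show u: "u \<in> affine_space i" using assms(1) by (simp add: u_def affine_space_def axis_def)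
  have 0: "herm P z = - (P $ i)"
    using assms(2) rho_pos[of z] by (simp add: lift_point_def herm_simps herm_axis eq_neg_iff_add_eq_0)
  have "(complex_of_real (rho z))\<^sup>2 * (rho z *\<^sub>R herm u z) = - (P $ i)"
  proof -
    have "rho z *\<^sub>R herm u z = - (P $ i) * (1 + herm z z)"
      using rho_pos[of z] assms(1) 0
      by (simp add: u_def herm_simps herm_axis_left affine_space_def scaleR_complex algebra_simps)
    then have "(complex_of_real (rho z))\<^sup>2 * (rho z *\<^sub>R herm u z)
        = - (P $ i) * ((complex_of_real (rho z))\<^sup>2 * (1 + herm z z))"
      by (simp only: mult.left_commute)
    then show ?thesis unfolding rho_sq_mult_complex by simp
  qed
  moreover have "rho z *\<^sub>R (rho z)\<^sup>2 *\<^sub>R (herm u z *s (z + axis i 1))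
      = ((complex_of_real (rho z))\<^sup>2 * (rho z *\<^sub>R herm u z)) *s (z + axis i 1)"
    by (simp add: vec_eq_iff scaleR_complex algebra_simps)
  moreover have "rho z *\<^sub>R u = P - P $ i *s (z + axis i 1)"
    using rho_pos[of z] by (simp add: u_def)
  ultimately show "lift_vec i z u = P"
    by (simp add: lift_vec_def scaleR_diff_right vector_smult_lneg)
qed

lemma rho_has_derivative [derivative_intros]:
  assumes "(f has_derivative f') (at x within S)"
  shows "((\<lambda>x. rho (f x)) has_derivative (\<lambda>h. - (Re (herm (f' h) (f x)) * rho (f x) ^ 3))) (at x within S)"
proof -
  have c: "Re (herm z d) + Re (herm d z) = 2 * Re (herm d z)" for z d :: "complex ^ 'b"
    using cnj_herm[of z d] by (metis cnj.simps(1) mult_2)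
  have pos: "1 + Re (herm (f x) (f x)) > 0" using Re_herm_self_nonneg[of "f x"] by simp
  have d: "((\<lambda>y. inverse (sqrt y)) has_real_derivative - (inverse (sqrt y) ^ 3 / 2)) (at y)" if "y > 0" for y
    using that by (auto intro!: derivative_eq_intros simp: divide_simps power2_eq_square power3_eq_cube)
  have e: "((\<lambda>x. 1 + Re (herm (f x) (f x))) has_derivative (\<lambda>h. 2 * Re (herm (f' h) (f x)))) (at x within S)"
    by (rule has_derivative_eq_rhs, (rule derivative_eq_intros assms refl)+) (simp add: fun_eq_iff c)
  from has_derivative_compose[OF e d[OF pos, unfolded has_field_derivative_def]] show ?thesis
    by (simp add: rho_def[symmetric] mult.commute)
qed

definition sphere_lift where
  "sphere_lift i = (\<lambda>(z, \<xi>). (lift_point i z, lift_vec i z \<xi>))"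

definition D_sphere_lift where
  "D_sphere_lift i = (\<lambda>(z, \<xi>) (X, \<Xi>).
     (- (Re (herm X z) * rho z ^ 3) *\<^sub>R (z + axis i 1) + rho z *\<^sub>R X,
      - (Re (herm X z) * rho z ^ 3) *\<^sub>R (\<xi> - (rho z)\<^sup>2 *\<^sub>R (herm \<xi> z *s (z + axis i 1)))
      + rho z *\<^sub>R (\<Xi> - (- (2 * Re (herm X z) * rho z ^ 4) *\<^sub>R (herm \<xi> z *s (z + axis i 1))
          + (rho z)\<^sup>2 *\<^sub>R ((herm \<Xi> z + herm \<xi> X) *s (z + axis i 1) + herm \<xi> z *s X)))))"

lemma sphere_lift_has_derivative:
  "(sphere_lift i has_derivative D_sphere_lift i Q) (at Q)"
  unfolding sphere_lift_def lift_point_def lift_vec_def case_prod_beta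
  by (rule has_derivative_eq_rhs, (rule derivative_eq_intros refl)+)
    (auto simp: D_sphere_lift_def fun_eq_iff case_prod_beta algebra_simps numeral_eq_Suc)

lemma D_sphere_lift_differentiable:
  "(\<lambda>(Q, A). D_sphere_lift i Q A) differentiable (at QA)"
  unfolding differentiable_def D_sphere_lift_def case_prod_beta
  by (rule exI, (rule derivative_intros)+)

text \<open>Sorts the raw differential into geometric parts: the lift of \<open>X\<close>, the lift
  of the covariant derivative of \<open>\<xi>\<close>, the infinitesimal Hopf rotation by
  \<open>\<theta>\<close> acting on both components, and the multiple of
  \<open>lift_point i z\<close> that keeps the second component orthogonal to the first. Its shape
  \<open>(P + \<tau> ip, Y + \<tau> i\<zeta> - herm \<zeta> P p)\<close> is the standard form of
  tangent vectors from here on.\<close>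

lemma D_sphere_lift_eq:
  assumes "z \<in> affine_space i" "\<xi> \<in> affine_space i" "X \<in> affine_space i" "\<Xi> \<in> affine_space i"
  defines "\<theta> \<equiv> (rho z)\<^sup>2 * Im (herm X z)"
  shows "D_sphere_lift i (z, \<xi>) (X, \<Xi>) =
    (lift_vec i z X + \<theta> *\<^sub>R (\<i> *s lift_point i z),
     lift_vec i z (\<Xi> + fs_christoffel z \<xi> X) + \<theta> *\<^sub>R (\<i> *s lift_vec i z \<xi>)
       - herm (lift_vec i z \<xi>) (lift_vec i z X) *s lift_point i z)"
proof -
  define x y where "x = Re (herm X z)" and "y = Im (herm X z)"
  have b: "herm X z = complex_of_real x + \<i> * complex_of_real y"
    "herm z X = complex_of_real x - \<i> * complex_of_real y"
    using complex_eq[of "herm X z"] cnj_herm[of X z] by (simp_all add: x_def y_def complex_eq_iff)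
  have K: "herm (\<Xi> + fs_christoffel z \<xi> X) z = herm \<Xi> z - 2 * (complex_of_real (rho z))\<^sup>2 * herm \<xi> z * herm X z"
    unfolding fs_christoffel_def rho_sq_norm[symmetric] herm_simps by (simp add: algebra_simps)
  have 1: "- (Re (herm X z) * rho z ^ 3) *\<^sub>R (z + axis i 1) + rho z *\<^sub>R X
    = lift_vec i z X + \<theta> *\<^sub>R (\<i> *s lift_point i z)"
    by (simp add: vec_eq_iff lift_vec_def lift_point_def \<theta>_def scaleR_complex b
        power2_eq_square power3_eq_cube algebra_simps)
  show ?thesis
    unfolding D_sphere_lift_def prod.case prod.inject 1
    unfolding herm_lift_vec[OF assms(1,2,3)]
    unfolding lift_vec_def lift_point_def
    unfolding K
    unfolding \<theta>_def fs_christoffel_def rho_sq_norm[symmetric] b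
    by (simp add: vec_eq_iff scaleR_complex
        power2_eq_square power3_eq_cube power4_eq_xxxx algebra_simps)
qed

text \<open>At \<open>(p, \<zeta>)\<close> the components of \<open>coframe d\<close> are the horizontal part of \<open>p'\<close>, the lift of the
  covariant derivative of \<open>\<zeta>\<close>, and \<open>sqrt d\<close> times the inner product of the latter with \<open>\<i>\<zeta>\<close>. The
  lifted Berger metric is a multiple of the sum of their squares. The vector \<open>(\<i>p, \<i>\<zeta>)\<close>, which is
  tangent to the Hopf fibre, is in the kernel.\<close>

definition coframe :: "real \<Rightarrow> (complex ^ 'k::finite) \<times> (complex ^ 'k) \<Rightarrow> (complex ^ 'k) \<times> (complex ^ 'k)
    \<Rightarrow> (complex ^ 'k) \<times> (complex ^ 'k) \<times> real" where
  "coframe d = (\<lambda>(p, \<zeta>) (a, b).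
     (a - Im (herm a p) *\<^sub>R (\<i> *s p),
      b - Im (herm a p) *\<^sub>R (\<i> *s \<zeta>) + herm \<zeta> a *s p,
      sqrt d * (Im (herm b \<zeta>) - Im (herm a p) * Re (herm \<zeta> \<zeta>))))"

definition D_coframe :: "real \<Rightarrow> (complex ^ 'k::finite) \<times> (complex ^ 'k) \<Rightarrow> (complex ^ 'k) \<times> (complex ^ 'k)
    \<Rightarrow> (complex ^ 'k) \<times> (complex ^ 'k) \<Rightarrow> (complex ^ 'k) \<times> (complex ^ 'k) \<times> real" where
  "D_coframe d = (\<lambda>(p, \<zeta>) (x, y) (a, b).
     (- (Im (herm a x) *\<^sub>R (\<i> *s p) + Im (herm a p) *\<^sub>R (\<i> *s x)),
      - (Im (herm a x) *\<^sub>R (\<i> *s \<zeta>) + Im (herm a p) *\<^sub>R (\<i> *s y)) + herm y a *s p + herm \<zeta> a *s x,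
      sqrt d * (Im (herm b y) - Im (herm a x) * Re (herm \<zeta> \<zeta>) - Im (herm a p) * (2 * Re (herm y \<zeta>)))))"

lemma coframe_has_derivative:
  "((\<lambda>(q, a). coframe d q a) has_derivative (\<lambda>(b, c). D_coframe d q b a + coframe d q c)) (at (q, a))"
proof -
  have c: "Re (herm z e) + Re (herm e z) = 2 * Re (herm e z)" for z e :: "complex ^ 'a"
    using cnj_herm[of z e] by (metis cnj.simps(1) mult_2)
  show ?thesis
    unfolding coframe_def D_coframe_def case_prod_beta
    by (rule has_derivative_eq_rhs, (rule derivative_eq_intros refl)+, rule ext)
      (simp add: case_prod_beta c, simp add: algebra_simps)
qed

lemma linear_coframe: "linear (coframe d q)"
  by (cases q) (auto intro!: linearI simp: coframe_def herm_simps vec_eq_iff scaleR_complex algebra_simps)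

lemma linear_D_coframe: "linear (D_coframe d q x)"
  by (cases q; cases x) (auto intro!: linearI simp: D_coframe_def herm_simps vec_eq_iff scaleR_complex algebra_simps)

text \<open>\<open>Im (herm a p)\<close> reads off \<open>\<tau>\<close> and
  \<open>herm \<zeta> a\<close> reads off the \<open>p\<close>-component, so the form removes both
  corrections of the standard tangent vector.\<close>

lemma coframe_eq:
  assumes "herm p p = 1" "herm \<zeta> p = 0" "herm P p = 0"
  shows "coframe d (p, \<zeta>) (P + \<tau> *\<^sub>R (\<i> *s p), Y + \<tau> *\<^sub>R (\<i> *s \<zeta>) - herm \<zeta> P *s p)
    = (P, Y, sqrt d * Im (herm Y \<zeta>))"
proof -
  have z: "herm p \<zeta> = 0" using assms(2) by (metis cnj_herm complex_cnj_zero)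
  show ?thesis
    by (simp add: coframe_def herm_simps assms z)
qed

text \<open>The exterior derivative of the coframe. The coefficients \<open>\<theta>\<close> and \<open>\<tau>\<close> measure the motion along
  the Hopf fibre, so that \<open>\<tau>\<close> must drop out.\<close>

lemma coframe_curvature:
  fixes \<theta> \<tau> :: real
  assumes "d \<ge> 0" "herm p p = 1" "herm \<zeta> p = 0" "herm X p = 0" "herm K p = 0" "herm P p = 0" "herm Y p = 0"
    and "Re (herm K \<zeta>) = 0" "Re (herm Y \<zeta>) = 0"
  defines "A \<equiv> (X + \<theta> *\<^sub>R (\<i> *s p), K + \<theta> *\<^sub>R (\<i> *s \<zeta>) - herm \<zeta> X *s p)"
    and "Z \<equiv> (P + \<tau> *\<^sub>R (\<i> *s p), Y + \<tau> *\<^sub>R (\<i> *s \<zeta>) - herm \<zeta> P *s p)"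
    and "c \<equiv> Im (herm K \<zeta>)"
  shows "(X, K, sqrt d * c) \<bullet> (D_coframe d (p, \<zeta>) A Z - D_coframe d (p, \<zeta>) Z A)
    = \<theta> * (Im (herm X P) + Im (herm K Y)) + 2 * c * (1 + d * Re (herm \<zeta> \<zeta>)) * Im (herm X P)
      + Re (herm \<zeta> P * herm X K) - Re (herm X \<zeta> * herm K P)
      + 2 * d * c * (Im (herm \<zeta> P * herm X \<zeta>) - Im (herm K Y))"
proof -
  have c: "herm p \<zeta> = 0" "herm p X = 0" "herm p K = 0" "herm p P = 0" "herm p Y = 0"
    using assms by (metis cnj_herm complex_cnj_zero)+
  have s: "herm X \<zeta> = cnj (herm \<zeta> X)" "herm P \<zeta> = cnj (herm \<zeta> P)" "herm K \<zeta> = cnj (herm \<zeta> K)"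
    "herm Y \<zeta> = cnj (herm \<zeta> Y)" "herm P X = cnj (herm X P)" "herm K X = cnj (herm X K)"
    "herm Y X = cnj (herm X Y)" "herm P K = cnj (herm K P)" "herm P Y = cnj (herm Y P)" "herm Y K = cnj (herm K Y)"
    by (simp_all add: cnj_herm)
  have r: "Re (herm \<zeta> K) = 0" "Re (herm \<zeta> Y) = 0"
    using assms(8,9) unfolding s by simp_all
  have dd: "sqrt d * (sqrt d * x) = d * x" for x
    using assms(1) by (simp flip: mult.assoc)
  have i: "Im (herm X X) = 0" "Im (herm K K) = 0" "Im (herm \<zeta> \<zeta>) = 0"
    unfolding herm_self by simp_all
  have t: "herm u (v * 2) = 2 * herm u v" for u v :: "complex ^ 'a"
    unfolding mult_2_right by (simp only: herm_add_right mult_2)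
  show ?thesis
    unfolding A_def Z_def c_def D_coframe_def prod.case inner_Pair minus_prod_def fst_conv snd_conv
      inner_conv_herm inner_real_def
    by (simp add: herm_simps assms(2-7) c s r i dd t algebra_simps)
qed

lemma lift_vec_cplx_struct: "lift_vec i z (cplx_struct u) = \<i> *s lift_vec i z u"
  by (simp add: lift_vec_def cplx_struct_def herm_simps vec_eq_iff scaleR_complex algebra_simps)

text \<open>The \<open>\<delta>\<^sup>2\<close> term is a product of two values of
  \<open>fubini_study\<close>, each contributing \<open>4 / m\<close>, whereas only one such factor
  is pulled out; the other is absorbed in \<open>d\<close>.\<close>

lemma berger_metric_coframe:
  fixes \<delta> m :: real
  assumes m: "m > 0" and af: "z \<in> affine_space i" "\<xi> \<in> affine_space i"
    "fst A \<in> affine_space i" "snd A \<in> affine_space i" "fst B \<in> affine_space i" "snd B \<in> affine_space i"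
  defines "d \<equiv> 4 * \<delta>\<^sup>2 / m"
  shows "berger_metric m \<delta> i (z, \<xi>) A B = 4 / m *
    (coframe d (sphere_lift i (z, \<xi>)) (D_sphere_lift i (z, \<xi>) A) \<bullet>
     coframe d (sphere_lift i (z, \<xi>)) (D_sphere_lift i (z, \<xi>) B))"
proof -
  obtain X \<Xi> X' \<Xi>' where AB: "A = (X, \<Xi>)" "B = (X', \<Xi>')" by fastforce
  have aff: "X \<in> affine_space i" "\<Xi> \<in> affine_space i" "X' \<in> affine_space i" "\<Xi>' \<in> affine_space i"
    using af AB by auto
  define K K' where "K = \<Xi> + fs_christoffel z \<xi> X" and "K' = \<Xi>' + fs_christoffel z \<xi> X'"
  have K: "K \<in> affine_space i" "K' \<in> affine_space i" "cplx_struct \<xi> \<in> affine_space i"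
    using af aff by (auto simp: K_def K'_def affine_space_def fs_christoffel_def cplx_struct_def)
  have dd: "sqrt d * x * (sqrt d * y) = d * x * y" for x y
  proof -
    have "d \<ge> 0" using m by (simp add: d_def)
    then show ?thesis by (simp add: mult.assoc mult.left_commute[of x] flip: mult.assoc[of "sqrt d" "sqrt d"])
  qed
  have J: "a \<bullet> (\<i> *s b) = Im (herm a b)" for a b :: "complex ^ 'a"
    by (simp add: inner_conv_herm herm_simps)
  have hz: "herm (lift_vec i z v) (lift_point i z) = 0" if "v \<in> affine_space i" for v
    using herm_lift_vec_point[OF af(1) that] .
  show ?thesis
    unfolding AB sphere_lift_def prod.case D_sphere_lift_eq[OF af(1,2) aff(1,2)] D_sphere_lift_eq[OF af(1,2) aff(3,4)]
      coframe_eq[OF herm_lift_point[OF af(1)] hz[OF af(2)] hz[OF aff(1)]]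
      coframe_eq[OF herm_lift_point[OF af(1)] hz[OF af(2)] hz[OF aff(3)]]
      berger_metric_def vertical_part_def fst_conv snd_conv Let_def
      CP_christoffel_eq[OF m af(2) aff(1)] CP_christoffel_eq[OF m af(2) aff(3)]
    unfolding K_def[symmetric] K'_def[symmetric] fubini_study_lift_vec[OF af(1) aff(1) aff(3)]
      fubini_study_lift_vec[OF af(1) K(1) K(2)] fubini_study_lift_vec[OF af(1) K(1) K(3)]
      fubini_study_lift_vec[OF af(1) K(2) K(3)] lift_vec_cplx_struct J inner_Pair inner_real_def dd
    by (simp add: d_def algebra_simps add_divide_distrib power2_eq_square)
qed

text \<open>The section is transversal to the Hopf fibres, so the degenerate direction of
  \<open>coframe\<close> is not met by vectors coming from the chart. This provides the injectivity
  assumption of the Euler--Lagrange lemma.\<close>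

lemma coframe_D_sphere_lift_eq_0:
  assumes "z \<in> affine_space i" "\<xi> \<in> affine_space i" "X \<in> affine_space i" "\<Xi> \<in> affine_space i"
    and 0: "coframe d (sphere_lift i (z, \<xi>)) (D_sphere_lift i (z, \<xi>) (X, \<Xi>)) = 0"
  shows "X = 0 \<and> \<Xi> = 0"
proof -
  define K where "K = \<Xi> + fs_christoffel z \<xi> X"
  have K: "K \<in> affine_space i"
    using assms by (auto simp: K_def affine_space_def fs_christoffel_def)
  have hz: "herm (lift_vec i z v) (lift_point i z) = 0" if "v \<in> affine_space i" for v
    using herm_lift_vec_point[OF assms(1) that] .
  have "lift_vec i z X = 0" "lift_vec i z K = 0"
    using 0 unfolding sphere_lift_def prod.case D_sphere_lift_eq[OF assms(1-4)]
      coframe_eq[OF herm_lift_point[OF assms(1)] hz[OF assms(2)] hz[OF assms(3)]] K_def[symmetric]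
    by (auto simp: zero_prod_def)
  then have X: "X = 0" and "K = 0" using lift_vec_zero_iff assms K by blast+
  then show ?thesis by (simp add: K_def fs_christoffel_def)
qed

section \<open>Tangent spaces of the sphere bundle and the lifted Euler--Lagrange equation\<close>

text \<open>The product is the orthogonal complement of four pairwise orthogonal real vectors, the
  real and imaginary directions of entry \<open>i\<close> in both factors.\<close>

lemma dim_affine_space_prod:
  "dim (affine_space i \<times> affine_space i :: ((complex ^ 'k::finite) \<times> (complex ^ 'k)) set) = 4 * (CARD('k) - 1)"
proof -
  define A :: "((complex ^ 'k) \<times> (complex ^ 'k)) set"
    where "A = {(axis i 1, 0), (axis i \<i>, 0), (0, axis i 1), (0, axis i \<i>)}"
  have ax: "axis i a \<bullet> axis i b = a \<bullet> b" "axis i a = axis i b \<longleftrightarrow> a = b" "axis i a = 0 \<longleftrightarrow> a = 0"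
    "axis i a \<bullet> z = a \<bullet> (z $ i)"
    for a b :: complex and z :: "complex ^ 'k"
    by (auto simp add: inner_axis_axis axis_eq_axis inner_axis')
  have "independent A"
    by (rule pairwise_orthogonal_independent)
      (auto simp: A_def pairwise_def orthogonal_def ax zero_prod_def inner_complex_def)
  then have "dim (span A) = card A"
    by (rule dim_span_eq_card_independent)
  also have "card A = 4" by (simp add: A_def ax)
  finally have "dim (span A) = 4" .
  moreover have "affine_space i \<times> affine_space i = {y \<in> UNIV. \<forall>x\<in>span A. orthogonal x y}"
  proof (intro set_eqI iffI)
    fix y :: "(complex ^ 'k) \<times> (complex ^ 'k)"
    assume "y \<in> {y \<in> UNIV. \<forall>x\<in>span A. orthogonal x y}"
    then have "\<forall>x\<in>A. orthogonal x y" by (simp add: span_base)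
    then show "y \<in> affine_space i \<times> affine_space i"
      by (cases y) (auto simp: A_def orthogonal_def ax inner_complex_def affine_space_def complex_eq_iff)
  next
    fix y :: "(complex ^ 'k) \<times> (complex ^ 'k)"
    assume "y \<in> affine_space i \<times> affine_space i"
    then have "\<forall>x\<in>A. orthogonal y x"
      by (cases y) (auto simp: A_def orthogonal_def ax inner_commute[of _ "axis i _"] affine_space_def)
    then have *: "orthogonal y x" if "x \<in> A" for x using that by blast
    have "orthogonal y x" if "x \<in> span A" for x
      by (rule orthogonal_to_span[OF that *])
    then show "y \<in> {y \<in> UNIV. \<forall>x\<in>span A. orthogonal x y}"
      by (simp add: orthogonal_commute)
  qed
  ultimately show ?thesis
    using dim_subspace_orthogonal_to_vectors[of "span A" UNIV] by (simp add: dim_UNIV)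
qed

lemma subspace_affine_space: "subspace (affine_space i :: (complex ^ 'k::finite) set)"
  by (auto simp: subspace_def affine_space_def)

lemma smooth_on_imp_has_derivative:
  assumes "smooth_on W \<phi>" "y \<in> W"
  shows "(\<phi> has_derivative frechet_derivative \<phi> (at y)) (at y)"
    and "(\<lambda>y. frechet_derivative \<phi> (at y) a) differentiable (at y)"
proof -
  have "Ck_on 2 \<phi> W" using assms by (simp add: smooth_on_def)
  then show "(\<phi> has_derivative frechet_derivative \<phi> (at y)) (at y)"
    and "(\<lambda>y. frechet_derivative \<phi> (at y) a) differentiable (at y)"
    using assms(2) by (auto simp: numeral_2_eq_2 frechet_derivative_works)
qed

lemma derivative_in_subspace:
  fixes \<phi> :: "'a::real_normed_vector \<Rightarrow> 'b::euclidean_space"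
  assumes "(\<phi> has_derivative \<phi>') (at y)" "open W" "subspace H" "y \<in> W \<inter> H" "a \<in> H" "subspace V"
    and "\<And>y. y \<in> W \<inter> H \<Longrightarrow> \<phi> y \<in> V"
  shows "\<phi>' a \<in> V"
proof (rule has_vector_derivative_in_subspace[OF has_derivative_along_line[OF assms(1)]])
  have "continuous_on UNIV (\<lambda>s. y + s *\<^sub>R a)" by (intro continuous_intros)
  from open_vimage[OF assms(2) this] show "open ((\<lambda>s. y + s *\<^sub>R a) -` W)" .
qed (use assms in \<open>auto simp: subspace_add subspace_scale\<close>)

definition unit_tangent_coords :: "real \<Rightarrow> 'k::finite \<Rightarrow> ((complex ^ 'k) \<times> (complex ^ 'k)) set" where
  "unit_tangent_coords m i = {(z, \<xi>). z \<in> affine_space i \<and> \<xi> \<in> affine_space i \<and> fubini_study m z \<xi> \<xi> = 1}"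

text \<open>\<open>X\<close> and \<open>K\<close> lift \<open>\<gamma>'\<close> and the covariant derivative of the unit field \<open>\<xi>\<close> with lift \<open>\<zeta>\<close>. The
  last clause is the Euler--Lagrange equation, with \<open>P\<close> and \<open>Y\<close> the horizontal and vertical parts
  of the variation.\<close>

definition lifted_geodesic ::
    "real \<Rightarrow> real \<Rightarrow> real set \<Rightarrow> (real \<Rightarrow> complex ^ 'k::finite) \<Rightarrow> (real \<Rightarrow> complex ^ 'k) \<Rightarrow>
     (real \<Rightarrow> complex ^ 'k) \<Rightarrow> (real \<Rightarrow> complex ^ 'k) \<Rightarrow> (real \<Rightarrow> real) \<Rightarrow> bool" where
  "lifted_geodesic d \<kappa> T p \<zeta> X K \<theta> \<longleftrightarrow> (\<forall>t\<in>T.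
     herm (p t) (p t) = 1 \<and> herm (\<zeta> t) (p t) = 0 \<and> Re (herm (\<zeta> t) (\<zeta> t)) = \<kappa> \<and>
     herm (X t) (p t) = 0 \<and> herm (K t) (p t) = 0 \<and> Re (herm (K t) (\<zeta> t)) = 0 \<and>
     (p has_vector_derivative X t + \<theta> t *\<^sub>R (\<i> *s p t)) (at t) \<and>
     (\<zeta> has_vector_derivative K t + \<theta> t *\<^sub>R (\<i> *s \<zeta> t) - herm (\<zeta> t) (X t) *s p t) (at t) \<and>
     (\<exists>X' K' c'. (X has_vector_derivative X') (at t) \<and> (K has_vector_derivative K') (at t) \<and>
        ((\<lambda>s. Im (herm (K s) (\<zeta> s))) has_vector_derivative c') (at t) \<and>
        (\<forall>P Y. herm P (p t) = 0 \<longrightarrow> herm Y (p t) = 0 \<longrightarrow> Re (herm Y (\<zeta> t)) = 0 \<longrightarrow>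
           Re (herm X' P) + Re (herm K' Y) + d * c' * Im (herm Y (\<zeta> t))
           + (\<theta> t * (Im (herm (X t) P) + Im (herm (K t) Y))
             + 2 * Im (herm (K t) (\<zeta> t)) * (1 + d * \<kappa>) * Im (herm (X t) P)
             + Re (herm (\<zeta> t) P * herm (X t) (K t)) - Re (herm (X t) (\<zeta> t) * herm (K t) P)
             + 2 * d * Im (herm (K t) (\<zeta> t)) * (Im (herm (\<zeta> t) P * herm (X t) (\<zeta> t)) - Im (herm (K t) Y)))
           = 0)))"

text \<open>By the dimension of \<open>H\<close>, the image of \<open>\<phi>'\<close> is the whole tangent space of the sphere bundle.\<close>

lemma tangent_vectors_unit_tangent_coords:
  fixes \<phi> :: "'a::euclidean_space \<Rightarrow> (complex ^ 'k::finite) \<times> (complex ^ 'k)"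
  assumes m: "m > 0" and H: "subspace H" and W: "open W" and \<phi>: "(\<phi> has_derivative \<phi>') (at y)"
    and dim: "dim H = 4 * (CARD('k) - 1) - 1"
    and inj: "\<forall>a\<in>H. \<phi>' a = 0 \<longrightarrow> a = 0"
    and im: "\<phi> ` (W \<inter> H) \<subseteq> unit_tangent_coords m i"
    and y: "y \<in> W \<inter> H" and q: "sphere_lift i (\<phi> y) = (p, \<zeta>)"
  shows "herm p p = 1" "herm \<zeta> p = 0" "Re (herm \<zeta> \<zeta>) = m / 4"
    and "a \<in> H \<Longrightarrow> fst (\<phi>' a) \<in> affine_space i \<and> snd (\<phi>' a) \<in> affine_space i"
    and "a \<in> H \<Longrightarrow> \<exists>P Y \<tau>. herm P p = 0 \<and> herm Y p = 0 \<and> Re (herm Y \<zeta>) = 0 \<and>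
      D_sphere_lift i (\<phi> y) (\<phi>' a) = (P + \<tau> *\<^sub>R (\<i> *s p), Y + \<tau> *\<^sub>R (\<i> *s \<zeta>) - herm \<zeta> P *s p)"
    and "herm P p = 0 \<Longrightarrow> herm Y p = 0 \<Longrightarrow> Re (herm Y \<zeta>) = 0 \<Longrightarrow> \<exists>a\<in>H. \<exists>\<tau>.
      D_sphere_lift i (\<phi> y) (\<phi>' a) = (P + \<tau> *\<^sub>R (\<i> *s p), Y + \<tau> *\<^sub>R (\<i> *s \<zeta>) - herm \<zeta> P *s p)"
proof -
  obtain z \<xi> where z\<xi>: "\<phi> y = (z, \<xi>)" by fastforce
  have aff: "z \<in> affine_space i" "\<xi> \<in> affine_space i" and unit: "fubini_study m z \<xi> \<xi> = 1"
    using subsetD[OF im imageI[OF y]] by (auto simp: z\<xi> unit_tangent_coords_def)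
  have p\<zeta>: "p = lift_point i z" "\<zeta> = lift_vec i z \<xi>"
    using q by (auto simp: z\<xi> sphere_lift_def)
  have aff': "fst (\<phi>' a) \<in> affine_space i" "snd (\<phi>' a) \<in> affine_space i" if "a \<in> H" for a
  proof -
    have "\<phi>' a \<in> affine_space i \<times> affine_space i"
      by (rule derivative_in_subspace[OF \<phi> W H y that])
        (use im in \<open>force intro: subspace_Times subspace_affine_space simp: unit_tangent_coords_def\<close>)+
    then show "fst (\<phi>' a) \<in> affine_space i" "snd (\<phi>' a) \<in> affine_space i" by auto
  qed
  show pp: "herm p p = 1" and \<zeta>p: "herm \<zeta> p = 0"
    using herm_lift_point[OF aff(1)] herm_lift_vec_point[OF aff] by (simp_all add: p\<zeta>)
  have const: "Re (herm (snd (sphere_lift i (\<phi> y))) (snd (sphere_lift i (\<phi> y)))) = m / 4" if "y \<in> W \<inter> H" for y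
  proof -
    obtain z \<xi> where z\<xi>: "\<phi> y = (z, \<xi>)" by fastforce
    have aff: "z \<in> affine_space i" "\<xi> \<in> affine_space i" and unit: "fubini_study m z \<xi> \<xi> = 1"
      using subsetD[OF im imageI[OF that]] by (auto simp: z\<xi> unit_tangent_coords_def)
    then show ?thesis using m fubini_study_lift_vec[OF aff(1,2,2), of m]
      by (simp add: z\<xi> sphere_lift_def inner_conv_herm)
  qed
  show \<kappa>: "Re (herm \<zeta> \<zeta>) = m / 4" using const[OF y] by (simp add: q)
  have tang: "Re (herm (snd (D_sphere_lift i (\<phi> y) (\<phi>' a))) \<zeta>) = 0" if "a \<in> H" for a
  proof -
    have "((\<lambda>y. sphere_lift i (\<phi> y)) has_derivative (\<lambda>a. D_sphere_lift i (\<phi> y) (\<phi>' a))) (at y)"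
      by (rule has_derivative_compose[OF \<phi> sphere_lift_has_derivative])
    note d = has_derivative_snd[OF this]
    from Re_has_derivative[OF herm_has_derivative[OF d d]]
    have "((\<lambda>y. Re (herm (snd (sphere_lift i (\<phi> y))) (snd (sphere_lift i (\<phi> y))))) has_derivative
        (\<lambda>a. Re (herm \<zeta> (snd (D_sphere_lift i (\<phi> y) (\<phi>' a))) + herm (snd (D_sphere_lift i (\<phi> y) (\<phi>' a))) \<zeta>))) (at y)"
      by (simp add: q)
    from dir_deriv_eq_on_subspace[OF this W y H that, of "\<lambda>y. m / 4"] const
    have "Re (herm \<zeta> (snd (D_sphere_lift i (\<phi> y) (\<phi>' a))) + herm (snd (D_sphere_lift i (\<phi> y) (\<phi>' a))) \<zeta>) = 0"
      by (simp add: dir_deriv_def)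
    then show ?thesis
      using Re_herm_commute[of \<zeta> "snd (D_sphere_lift i (\<phi> y) (\<phi>' a))"] by simp
  qed
  have hor: "herm (lift_vec i z v) p = 0" if "v \<in> affine_space i" for v
    using herm_lift_vec_point[OF aff(1) that] by (simp add: p\<zeta>)
  have fs: "fs_christoffel z \<xi> v \<in> affine_space i" if "v \<in> affine_space i" for v
    using aff that by (simp add: fs_christoffel_def affine_space_def)
  define K where "K A = lift_vec i z (snd A + fs_christoffel z \<xi> (fst A))" for A :: "(complex ^ 'k) \<times> (complex ^ 'k)"
  have D: "\<exists>\<tau>. D_sphere_lift i (\<phi> y) A =
      (lift_vec i z (fst A) + \<tau> *\<^sub>R (\<i> *s p), K A + \<tau> *\<^sub>R (\<i> *s \<zeta>) - herm \<zeta> (lift_vec i z (fst A)) *s p)"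
    if "fst A \<in> affine_space i" "snd A \<in> affine_space i" for A
    using D_sphere_lift_eq[OF aff that] by (auto simp: z\<xi> p\<zeta> K_def)
  have Kp: "herm (K A) p = 0" if "fst A \<in> affine_space i" "snd A \<in> affine_space i" for A
    using hor[of "snd A + fs_christoffel z \<xi> (fst A)"] fs that
    by (simp add: K_def subspace_add[OF subspace_affine_space])
  have p\<zeta>0: "herm p \<zeta> = 0" using \<zeta>p by (metis cnj_herm complex_cnj_zero)
  have K\<zeta>: "Re (herm (K A) \<zeta>) = Re (herm (snd (D_sphere_lift i (\<phi> y) A)) \<zeta>)"
    if A: "fst A \<in> affine_space i" "snd A \<in> affine_space i" for A
  proof -
    obtain \<tau> where \<tau>: "D_sphere_lift i (\<phi> y) A =
      (lift_vec i z (fst A) + \<tau> *\<^sub>R (\<i> *s p), K A + \<tau> *\<^sub>R (\<i> *s \<zeta>) - herm \<zeta> (lift_vec i z (fst A)) *s p)"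
      using D[OF A] by blast
    have "Im (herm \<zeta> \<zeta>) = 0" unfolding herm_self by simp
    then show ?thesis by (simp add: \<tau> herm_simps p\<zeta>0)
  qed
  show "fst (\<phi>' a) \<in> affine_space i \<and> snd (\<phi>' a) \<in> affine_space i" if "a \<in> H"
    using aff'[OF that] by blast
  show "\<exists>P Y \<tau>. herm P p = 0 \<and> herm Y p = 0 \<and> Re (herm Y \<zeta>) = 0 \<and>
      D_sphere_lift i (\<phi> y) (\<phi>' a) = (P + \<tau> *\<^sub>R (\<i> *s p), Y + \<tau> *\<^sub>R (\<i> *s \<zeta>) - herm \<zeta> P *s p)" if "a \<in> H"
    using D[OF aff'[OF that]] hor[OF aff'(1)[OF that]] Kp[OF aff'[OF that]] K\<zeta>[OF aff'[OF that]] tang[OF that]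
    by auto
  define S where "S = {A \<in> affine_space i \<times> affine_space i. Re (herm (K A) \<zeta>) = 0}"
  have linK: "linear K"
    by (rule linearI) (auto simp: K_def lift_vec_def fs_christoffel_def herm_simps vec_eq_iff scaleR_complex algebra_simps)
  have "linear (\<lambda>A. Re (herm (K A) \<zeta>))"
    by (rule linearI) (simp_all add: linear_add[OF linK] linear_scale[OF linK] herm_simps)
  then have "subspace {A. Re (herm (K A) \<zeta>) = 0}" by (rule linear_subspace_kernel)
  from subspace_inter[OF subspace_Times[OF subspace_affine_space subspace_affine_space, of i i] this]
  have S: "subspace S" by (simp add: S_def Int_def)
  have sub: "\<phi>' ` H \<subseteq> S"
  proof (rule image_subsetI)
    fix a assume a: "a \<in> H"
    show "\<phi>' a \<in> S"
      using aff'[OF a] K\<zeta>[OF aff'[OF a]] tang[OF a] by (simp add: S_def mem_Times_iff)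
  qed
  \<comment> \<open>The radial direction of the fibre violates the constraint of \<open>S\<close>.
    Hence \<open>S\<close> is a proper subspace, its dimension is at most that of \<open>H\<close>,
    and the inclusion \<open>sub\<close> becomes an equality.\<close>
  have "(0, \<xi>) \<notin> S" "(0, \<xi>) \<in> affine_space i \<times> affine_space i"
    using \<kappa> m aff by (auto simp: S_def K_def fs_christoffel_def p\<zeta>[symmetric] affine_space_def)
  then have "dim S \<noteq> dim (affine_space i \<times> affine_space i :: ((complex ^ 'k) \<times> (complex ^ 'k)) set)"
    using subspace_dim_equal[OF S subspace_Times[OF subspace_affine_space subspace_affine_space, of i i]]
    by (auto simp: S_def)
  moreover have "dim S \<le> dim (affine_space i \<times> affine_space i :: ((complex ^ 'k) \<times> (complex ^ 'k)) set)"
    by (rule dim_subset) (auto simp: S_def)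
  ultimately have "dim S \<le> dim H" unfolding dim_affine_space_prod dim by simp
  also have "dim H = dim (\<phi>' ` H)"
  proof (rule dim_image_eq[symmetric])
    show "linear \<phi>'" using \<phi> has_derivative_linear by blast
    then show "inj_on \<phi>' (span H)"
      using H inj by (simp add: linear_inj_on_iff_eq_0 span_eq_iff[THEN iffD2])
  qed
  finally have "\<phi>' ` H = S"
    using subspace_dim_equal[OF linear_subspace_image[OF has_derivative_linear[OF \<phi>] H] S sub] by simp
  then have surj: "\<exists>a\<in>H. \<phi>' a = A" if "A \<in> S" for A using that by force
  show "\<exists>a\<in>H. \<exists>\<tau>. D_sphere_lift i (\<phi> y) (\<phi>' a)
      = (P + \<tau> *\<^sub>R (\<i> *s p), Y + \<tau> *\<^sub>R (\<i> *s \<zeta>) - herm \<zeta> P *s p)"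
    if PY: "herm P p = 0" "herm Y p = 0" "Re (herm Y \<zeta>) = 0"
  proof -
    obtain v where v: "v \<in> affine_space i" "lift_vec i z v = P"
      using lift_vec_surj[OF aff(1)] PY p\<zeta> by blast
    obtain w where w: "w \<in> affine_space i" "lift_vec i z w = Y"
      using lift_vec_surj[OF aff(1)] PY p\<zeta> by blast
    \<comment> \<open>Subtracting the Christoffel term makes \<open>w\<close> the vertical part of
      \<open>A\<close>.\<close>
    define A where "A = (v, w - fs_christoffel z \<xi> v)"
    have A: "fst A \<in> affine_space i" "snd A \<in> affine_space i" "K A = Y" "lift_vec i z (fst A) = P"
      using v w fs[OF v(1)] by (auto simp: A_def K_def subspace_diff[OF subspace_affine_space])
    then have "A \<in> S" using PY by (simp add: S_def mem_Times_iff)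
    then obtain a where "a \<in> H" "\<phi>' a = A" using surj by blast
    then show ?thesis using D[OF A(1,2)] A by metis
  qed
qed


lemma has_vector_derivative_fst:
  "(f has_vector_derivative f') F \<Longrightarrow> ((\<lambda>x. fst (f x)) has_vector_derivative fst f') F"
  by (rule bounded_linear.has_vector_derivative[OF bounded_linear_fst])

lemma has_vector_derivative_snd:
  "(f has_vector_derivative f') F \<Longrightarrow> ((\<lambda>x. snd (f x)) has_vector_derivative snd f') F"
  by (rule bounded_linear.has_vector_derivative[OF bounded_linear_snd])

text \<open>The Euler--Lagrange lemma for \<open>F = sphere_lift i \<circ> \<phi>\<close> and
  \<open>\<omega> = coframe d\<close>. Since the tangent vectors from \<open>H\<close> realize all
  admissible pairs \<open>P\<close>, \<open>Y\<close>, the test vectors no longer refer to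
  \<open>\<phi>\<close> or \<open>H\<close>.\<close>

lemma berger_geodesic_lift:
  fixes \<phi> :: "'a::euclidean_space \<Rightarrow> (complex ^ 'k::finite) \<times> (complex ^ 'k)" and m \<delta> :: real
  assumes m: "m > 0" and H: "subspace H" and W: "open W" and \<phi>: "smooth_on W \<phi>"
    and dim: "dim H = 4 * (CARD('k) - 1) - 1"
    and inj: "\<And>y a. y \<in> W \<inter> H \<Longrightarrow> a \<in> H \<Longrightarrow> dir_deriv \<phi> y a = 0 \<Longrightarrow> a = 0"
    and im: "\<phi> ` (W \<inter> H) \<subseteq> unit_tangent_coords m i"
    and T: "open T" "\<And>s. s \<in> T \<Longrightarrow> u s \<in> W \<inter> H"
    and geo: "geodesic_in_coordinates H (pullback_metric \<phi> (berger_metric m \<delta> i)) T u"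
  shows "\<exists>\<zeta> X K \<theta>. lifted_geodesic (4 * \<delta>\<^sup>2 / m) (m / 4) T (\<lambda>t. lift_point i (fst (\<phi> (u t)))) \<zeta> X K \<theta>"
proof -
  define d where "d = 4 * \<delta>\<^sup>2 / m"
  have d: "d \<ge> 0" using m by (simp add: d_def)
  define D\<phi> where "D\<phi> y = frechet_derivative \<phi> (at y)" for y
  have D\<phi>: "(\<phi> has_derivative D\<phi> y) (at y)" "(\<lambda>y. D\<phi> y a) differentiable (at y)" if "y \<in> W" for y a
    using smooth_on_imp_has_derivative[OF \<phi> that] by (simp_all add: D\<phi>_def)
  have dir: "dir_deriv \<phi> y a = D\<phi> y a" if "y \<in> W" for y a
    by (rule dir_deriv_eq[OF D\<phi>(1)[OF that]])
  have inj': "a = 0" if "y \<in> W \<inter> H" "a \<in> H" "D\<phi> y a = 0" for y a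
    using inj[OF that(1,2)] dir that by auto
  define F where "F y = sphere_lift i (\<phi> y)" for y
  define DF where "DF y a = D_sphere_lift i (\<phi> y) (D\<phi> y a)" for y a
  have F: "(F has_derivative DF y) (at y)" if "y \<in> W" for y
    using has_derivative_compose[OF D\<phi>(1)[OF that] sphere_lift_has_derivative, of i]
    by (simp add: F_def[abs_def] DF_def[abs_def])
  have DF: "(\<lambda>y. DF y a) differentiable (at y)" if "y \<in> W" for y a
  proof -
    have "(\<lambda>y. (\<phi> y, D\<phi> y a)) differentiable (at y)"
      by (intro differentiable_Pair differentiableI[OF D\<phi>(1)[OF that]] D\<phi>(2)[OF that])
    from differentiable_chain_at[OF this D_sphere_lift_differentiable[of i]]
    show ?thesis by (simp add: o_def DF_def)
  qed
  have tv: "herm (fst (F y)) (fst (F y)) = 1" "herm (snd (F y)) (fst (F y)) = 0"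
      "Re (herm (snd (F y)) (snd (F y))) = m / 4"
      "\<And>a. a \<in> H \<Longrightarrow> fst (D\<phi> y a) \<in> affine_space i \<and> snd (D\<phi> y a) \<in> affine_space i"
      "\<And>a. a \<in> H \<Longrightarrow> \<exists>P Y \<tau>. herm P (fst (F y)) = 0 \<and> herm Y (fst (F y)) = 0 \<and> Re (herm Y (snd (F y))) = 0 \<and>
        DF y a = (P + \<tau> *\<^sub>R (\<i> *s fst (F y)), Y + \<tau> *\<^sub>R (\<i> *s snd (F y)) - herm (snd (F y)) P *s fst (F y))"
      "\<And>P Y. herm P (fst (F y)) = 0 \<Longrightarrow> herm Y (fst (F y)) = 0 \<Longrightarrow> Re (herm Y (snd (F y))) = 0 \<Longrightarrow> \<exists>a\<in>H. \<exists>\<tau>.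
        DF y a = (P + \<tau> *\<^sub>R (\<i> *s fst (F y)), Y + \<tau> *\<^sub>R (\<i> *s snd (F y)) - herm (snd (F y)) P *s fst (F y))"
    if y: "y \<in> W \<inter> H" for y
  proof -
    have yW: "y \<in> W" using y by blast
    have q: "sphere_lift i (\<phi> y) = (fst (F y), snd (F y))" by (simp add: F_def)
    have "\<forall>a\<in>H. D\<phi> y a = 0 \<longrightarrow> a = 0" using inj'[OF y] by blast
    note t = tangent_vectors_unit_tangent_coords[OF m H W D\<phi>(1)[OF yW] dim this im y q, folded DF_def]
    show "herm (fst (F y)) (fst (F y)) = 1" by (rule t(1))
    show "herm (snd (F y)) (fst (F y)) = 0" by (rule t(2))
    show "Re (herm (snd (F y)) (snd (F y))) = m / 4" by (rule t(3))
    show "fst (D\<phi> y a) \<in> affine_space i \<and> snd (D\<phi> y a) \<in> affine_space i" if "a \<in> H" for a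
      by (rule t(4)[OF that])
    show "\<exists>P Y \<tau>. herm P (fst (F y)) = 0 \<and> herm Y (fst (F y)) = 0 \<and> Re (herm Y (snd (F y))) = 0 \<and>
        DF y a = (P + \<tau> *\<^sub>R (\<i> *s fst (F y)), Y + \<tau> *\<^sub>R (\<i> *s snd (F y)) - herm (snd (F y)) P *s fst (F y))"
      if "a \<in> H" for a by (rule t(5)[OF that])
    show "\<exists>a\<in>H. \<exists>\<tau>.
        DF y a = (P + \<tau> *\<^sub>R (\<i> *s fst (F y)), Y + \<tau> *\<^sub>R (\<i> *s snd (F y)) - herm (snd (F y)) P *s fst (F y))"
      if "herm P (fst (F y)) = 0" "herm Y (fst (F y)) = 0" "Re (herm Y (snd (F y))) = 0" for P Y
      by (rule t(6)[OF that])
  qed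
  have aff: "fst (\<phi> y) \<in> affine_space i" "snd (\<phi> y) \<in> affine_space i" if "y \<in> W \<inter> H" for y
    using subsetD[OF im imageI[OF that]] by (auto simp: unit_tangent_coords_def case_prod_beta)
  have aff': "fst (D\<phi> y a) \<in> affine_space i" "snd (D\<phi> y a) \<in> affine_space i" if "y \<in> W \<inter> H" "a \<in> H" for y a
    using tv(4)[OF that] by blast+
  have G: "pullback_metric \<phi> (berger_metric m \<delta> i) y a b = 4 / m * (coframe d (F y) (DF y a) \<bullet> coframe d (F y) (DF y b))"
    if "y \<in> W \<inter> H" "a \<in> H" "b \<in> H" for y a b
    using berger_metric_coframe[OF m aff[OF that(1)] aff'[OF that(1,2)] aff'[OF that(1,3)], of \<delta>] dir that(1)
    by (simp add: pullback_metric_def F_def DF_def d_def)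
  have cinj: "a = 0" if "y \<in> W \<inter> H" "a \<in> H" "coframe d (F y) (DF y a) = 0" for y a
    using coframe_D_sphere_lift_eq_0[OF aff[OF that(1)] aff'[OF that(1,2)], of d] that inj'[OF that(1,2)]
    by (simp add: F_def DF_def prod_eq_iff)
  define u' where "u' s = vector_derivative u (at s)" for s
  define p where "p s = fst (F (u s))" for s
  define \<zeta> where "\<zeta> s = snd (F (u s))" for s
  define \<alpha> where "\<alpha> s = coframe d (F (u s)) (DF (u s) (u' s))" for s
  define X where "X s = fst (\<alpha> s)" for s
  define K where "K s = fst (snd (\<alpha> s))" for s
  have F_eq: "F (u s) = (p s, \<zeta> s)" for s by (simp add: p_def \<zeta>_def)
  have EL: "\<exists>D. (\<forall>s\<in>T. ((\<lambda>s. F (u s)) has_vector_derivative DF (u s) (u' s)) (at s)) \<and> u' t \<in> H \<and>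
      (\<alpha> has_vector_derivative D) (at t) \<and>
      (\<forall>a\<in>H. D \<bullet> coframe d (F (u t)) (DF (u t) a) + \<alpha> t \<bullet>
        (D_coframe d (F (u t)) (DF (u t) (u' t)) (DF (u t) a) -
         D_coframe d (F (u t)) (DF (u t) a) (DF (u t) (u' t))) = 0)" if "t \<in> T" for t
  proof -
    have pos: "4 / m > 0" using m by simp
    show ?thesis
    proof (rule pullback_geodesic_euler_lagrange[where \<omega> = "coframe d" and \<omega>' = "D_coframe d", OF H W pos G F DF
        coframe_has_derivative cinj linear_coframe linear_D_coframe T(1) that T(2) geo])
      fix D a assume *: "\<And>s. s \<in> T \<Longrightarrow> ((\<lambda>s. F (u s)) has_vector_derivative DF (u s) (vector_derivative u (at s))) (at s)"
      "a = DF (u t) (vector_derivative u (at t))" "vector_derivative u (at t) \<in> H"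
      "((\<lambda>s. coframe d (F (u s)) (DF (u s) (vector_derivative u (at s)))) has_vector_derivative D) (at t)"
      "\<And>z. z \<in> H \<Longrightarrow> D \<bullet> coframe d (F (u t)) (DF (u t) z) +
        coframe d (F (u t)) a \<bullet> (D_coframe d (F (u t)) a (DF (u t) z) - D_coframe d (F (u t)) (DF (u t) z) a) = 0"
      show ?thesis
        by (rule exI[of _ D]) (use * in \<open>simp add: \<alpha>_def[abs_def] u'_def\<close>)
    qed
  qed
  have "\<exists>\<tau>. DF (u s) (u' s) = (X s + \<tau> *\<^sub>R (\<i> *s p s), K s + \<tau> *\<^sub>R (\<i> *s \<zeta> s) - herm (\<zeta> s) (X s) *s p s) \<and>
      herm (X s) (p s) = 0 \<and> herm (K s) (p s) = 0 \<and> Re (herm (K s) (\<zeta> s)) = 0 \<and>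
      \<alpha> s = (X s, K s, sqrt d * Im (herm (K s) (\<zeta> s)))" if s: "s \<in> T" for s
  proof -
    note pr = tv[OF T(2)[OF s], folded p_def \<zeta>_def]
    have "u' s \<in> H" using EL[OF s] by blast
    from pr(5)[OF this]
    obtain P Y \<tau> where PY: "herm P (p s) = 0" "herm Y (p s) = 0" "Re (herm Y (\<zeta> s)) = 0"
      "DF (u s) (u' s) = (P + \<tau> *\<^sub>R (\<i> *s p s), Y + \<tau> *\<^sub>R (\<i> *s \<zeta> s) - herm (\<zeta> s) P *s p s)"
      by blast
    have "\<alpha> s = (P, Y, sqrt d * Im (herm Y (\<zeta> s)))"
      unfolding \<alpha>_def F_eq PY(4) by (rule coframe_eq[OF pr(1,2) PY(1)])
    then show ?thesis using PY by (auto simp: X_def K_def)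
  qed
  \<comment> \<open>A pointwise choice without regularity: later computations at a parameter
    \<open>t\<close> involve only the value \<open>\<theta> t\<close>.\<close>
  then obtain \<theta> where \<theta>: "\<And>s. s \<in> T \<Longrightarrow>
      DF (u s) (u' s) = (X s + \<theta> s *\<^sub>R (\<i> *s p s), K s + \<theta> s *\<^sub>R (\<i> *s \<zeta> s) - herm (\<zeta> s) (X s) *s p s) \<and>
      herm (X s) (p s) = 0 \<and> herm (K s) (p s) = 0 \<and> Re (herm (K s) (\<zeta> s)) = 0 \<and>
      \<alpha> s = (X s, K s, sqrt d * Im (herm (K s) (\<zeta> s)))"
    by metis
  have "lifted_geodesic d (m / 4) T p \<zeta> X K \<theta>"
    unfolding lifted_geodesic_def
  proof (rule ballI, intro conjI)
    fix t assume t: "t \<in> T"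
    note pr = tv[OF T(2)[OF t], folded p_def \<zeta>_def]
    show pp: "herm (p t) (p t) = 1" and \<zeta>p: "herm (\<zeta> t) (p t) = 0" and \<kappa>: "Re (herm (\<zeta> t) (\<zeta> t)) = m / 4"
      and hX: "herm (X t) (p t) = 0" and hK: "herm (K t) (p t) = 0" and K\<zeta>: "Re (herm (K t) (\<zeta> t)) = 0"
      using pr(1-3) \<theta>[OF t] by blast+
    obtain D where D: "\<forall>s\<in>T. ((\<lambda>s. F (u s)) has_vector_derivative DF (u s) (u' s)) (at s)" "u' t \<in> H"
      "(\<alpha> has_vector_derivative D) (at t)"
      "\<And>a. a \<in> H \<Longrightarrow> D \<bullet> coframe d (F (u t)) (DF (u t) a) + \<alpha> t \<bullet>
        (D_coframe d (F (u t)) (DF (u t) (u' t)) (DF (u t) a) -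
         D_coframe d (F (u t)) (DF (u t) a) (DF (u t) (u' t))) = 0"
      using EL[OF t] by blast
    have q': "((\<lambda>s. F (u s)) has_vector_derivative (X t + \<theta> t *\<^sub>R (\<i> *s p t),
        K t + \<theta> t *\<^sub>R (\<i> *s \<zeta> t) - herm (\<zeta> t) (X t) *s p t)) (at t)"
      using D(1) t \<theta>[OF t] by auto
    show p': "(p has_vector_derivative X t + \<theta> t *\<^sub>R (\<i> *s p t)) (at t)"
      using has_vector_derivative_fst[OF q'] by (simp add: p_def[abs_def])
    show \<zeta>': "(\<zeta> has_vector_derivative K t + \<theta> t *\<^sub>R (\<i> *s \<zeta> t) - herm (\<zeta> t) (X t) *s p t) (at t)"
      using has_vector_derivative_snd[OF q'] by (simp add: \<zeta>_def[abs_def])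
    have X': "(X has_vector_derivative fst D) (at t)"
      using has_vector_derivative_fst[OF D(3)] by (simp add: X_def[abs_def])
    have K': "(K has_vector_derivative fst (snd D)) (at t)"
      using has_vector_derivative_fst[OF has_vector_derivative_snd[OF D(3)]] by (simp add: K_def[abs_def])
    \<comment> \<open>The derivative \<open>c'\<close> comes from \<open>K\<close> and
      \<open>\<zeta>\<close> and not from the third component of \<open>\<alpha>\<close>, because
      \<open>sqrt d\<close> vanishes for \<open>\<delta> = 0\<close> and cannot be divided
      out.\<close>
    have "((\<lambda>s. herm (K s) (\<zeta> s)) has_vector_derivative
        herm (K t) (K t + \<theta> t *\<^sub>R (\<i> *s \<zeta> t) - herm (\<zeta> t) (X t) *s p t) + herm (fst (snd D)) (\<zeta> t)) (at t)"
      by (rule herm_has_vector_derivative[OF K' \<zeta>'])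
    from bounded_linear.has_vector_derivative[OF bounded_linear_Im this]
    obtain c' where c': "((\<lambda>s. Im (herm (K s) (\<zeta> s))) has_vector_derivative c') (at t)" by blast
    have "((\<lambda>s. snd (snd (\<alpha> s))) has_vector_derivative snd (snd D)) (at t)"
      by (rule has_vector_derivative_snd[OF has_vector_derivative_snd[OF D(3)]])
    then have "((\<lambda>s. sqrt d * Im (herm (K s) (\<zeta> s))) has_vector_derivative snd (snd D)) (at t)"
      by (rule has_vector_derivative_transform_within_open[OF _ T(1) t]) (use \<theta> in simp)
    moreover have "((\<lambda>s. sqrt d * Im (herm (K s) (\<zeta> s))) has_vector_derivative sqrt d * c') (at t)"
      by (rule bounded_linear.has_vector_derivative[OF bounded_linear_mult_right c'])
    ultimately have D3: "snd (snd D) = sqrt d * c'"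
      using vector_derivative_unique_at by blast
    have dd: "sqrt d * a * (sqrt d * b) = d * a * b" for a b
      using d by (simp add: mult.assoc mult.left_commute[of a] flip: mult.assoc[of "sqrt d" "sqrt d"])
    have "Re (herm (fst D) P) + Re (herm (fst (snd D)) Y) + d * c' * Im (herm Y (\<zeta> t))
           + (\<theta> t * (Im (herm (X t) P) + Im (herm (K t) Y))
             + 2 * Im (herm (K t) (\<zeta> t)) * (1 + d * (m / 4)) * Im (herm (X t) P)
             + Re (herm (\<zeta> t) P * herm (X t) (K t)) - Re (herm (X t) (\<zeta> t) * herm (K t) P)
             + 2 * d * Im (herm (K t) (\<zeta> t)) * (Im (herm (\<zeta> t) P * herm (X t) (\<zeta> t)) - Im (herm (K t) Y)))
           = 0" if PY: "herm P (p t) = 0" "herm Y (p t) = 0" "Re (herm Y (\<zeta> t)) = 0" for P Y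
    proof -
      obtain a \<tau> where a: "a \<in> H" "DF (u t) a = (P + \<tau> *\<^sub>R (\<i> *s p t), Y + \<tau> *\<^sub>R (\<i> *s \<zeta> t) - herm (\<zeta> t) P *s p t)"
        using pr(6)[OF PY] by blast
      have "\<alpha> t = (X t, K t, sqrt d * Im (herm (K t) (\<zeta> t)))"
        "DF (u t) (u' t) = (X t + \<theta> t *\<^sub>R (\<i> *s p t), K t + \<theta> t *\<^sub>R (\<i> *s \<zeta> t) - herm (\<zeta> t) (X t) *s p t)"
        using \<theta>[OF t] by blast+
      note D(4)[OF a(1), unfolded F_eq a(2) this coframe_eq[OF pp \<zeta>p PY(1)]
          coframe_curvature[OF d pp \<zeta>p hX hK PY(1,2) K\<zeta> PY(3)] \<kappa>]
      moreover have "D \<bullet> (P, Y, sqrt d * Im (herm Y (\<zeta> t)))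
          = Re (herm (fst D) P) + Re (herm (fst (snd D)) Y) + d * c' * Im (herm Y (\<zeta> t))"
        by (cases D) (use D3 d in \<open>simp add: inner_conv_herm dd prod_eq_iff inner_prod_def\<close>)
      ultimately show ?thesis by simp
    qed
    with X' K' c' show "\<exists>X' K' c'. (X has_vector_derivative X') (at t) \<and> (K has_vector_derivative K') (at t) \<and>
        ((\<lambda>s. Im (herm (K s) (\<zeta> s))) has_vector_derivative c') (at t) \<and>
        (\<forall>P Y. herm P (p t) = 0 \<longrightarrow> herm Y (p t) = 0 \<longrightarrow> Re (herm Y (\<zeta> t)) = 0 \<longrightarrow>
           Re (herm X' P) + Re (herm K' Y) + d * c' * Im (herm Y (\<zeta> t))
           + (\<theta> t * (Im (herm (X t) P) + Im (herm (K t) Y))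
             + 2 * Im (herm (K t) (\<zeta> t)) * (1 + d * (m / 4)) * Im (herm (X t) P)
             + Re (herm (\<zeta> t) P * herm (X t) (K t)) - Re (herm (X t) (\<zeta> t) * herm (K t) P)
             + 2 * d * Im (herm (K t) (\<zeta> t)) * (Im (herm (\<zeta> t) P * herm (X t) (\<zeta> t)) - Im (herm (K t) Y)))
           = 0)" by blast
  qed
  moreover have "p = (\<lambda>t. lift_point i (fst (\<phi> (u t))))"
    by (simp add: p_def[abs_def] F_def sphere_lift_def case_prod_beta)
  ultimately show ?thesis unfolding d_def by blast
qed

section \<open>The geodesic equations\<close>

text \<open>With \<open>b = 2 \<langle>\<eta>, \<i>\<zeta>\<rangle>\<close> this is the lift of the curvature operator \<open>R(\<eta>, \<zeta>)\<close>.\<close>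

definition curv_op :: "complex ^ 'k::finite \<Rightarrow> complex ^ 'k \<Rightarrow> real \<Rightarrow> complex ^ 'k \<Rightarrow> complex ^ 'k" where
  "curv_op \<zeta> \<eta> b Z = herm Z \<zeta> *s \<eta> - herm Z \<eta> *s \<zeta> + b *\<^sub>R (\<i> *s Z)"

lemma linear_curv_op: "linear (curv_op \<zeta> \<eta> b)"
  by (rule linearI) (simp_all add: curv_op_def herm_simps vec_eq_iff scaleR_complex algebra_simps)

lemma curv_op_skew: "Re (herm (curv_op \<zeta> \<eta> b Z) W) + Re (herm Z (curv_op \<zeta> \<eta> b W)) = 0"
proof -
  have s: "herm W \<zeta> = cnj (herm \<zeta> W)" "herm W \<eta> = cnj (herm \<eta> W)"
    by (simp_all add: cnj_herm)
  show ?thesis by (simp add: curv_op_def herm_simps s)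
qed

text \<open>\<open>V\<close> is a field of vectors orthogonal to the lifted curve \<open>p\<close> and \<open>W\<close> lifts the covariant
  derivative of the vector field on \<open>CP\<close> with lift \<open>V\<close>. The term with \<open>\<theta>\<close> compensates for the
  component of \<open>p'\<close> along the Hopf fibre.\<close>

definition has_lifted_derivative ::
    "(real \<Rightarrow> complex ^ 'k::finite) \<Rightarrow> (real \<Rightarrow> complex ^ 'k) \<Rightarrow> (real \<Rightarrow> real) \<Rightarrow>
     (real \<Rightarrow> complex ^ 'k) \<Rightarrow> complex ^ 'k \<Rightarrow> real \<Rightarrow> bool" where
  "has_lifted_derivative p X \<theta> V W t \<longleftrightarrow> herm (V t) (p t) = 0 \<and> herm W (p t) = 0 \<and>
     (V has_vector_derivative W + \<theta> t *\<^sub>R (\<i> *s V t) - herm (V t) (X t) *s p t) (at t)"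

lemma has_lifted_derivative_sum:
  assumes "\<And>k. k \<in> A \<Longrightarrow> has_lifted_derivative p X \<theta> (V k) (W k) t" "finite A"
  shows "has_lifted_derivative p X \<theta> (\<lambda>s. \<Sum>k\<in>A. c k *\<^sub>R V k s) (\<Sum>k\<in>A. c k *\<^sub>R W k) t"
  using assms(2,1)
proof (induction A rule: finite_induct)
  case empty
  show ?case by (simp add: has_lifted_derivative_def)
next
  case (insert a A)
  then have 1: "has_lifted_derivative p X \<theta> (\<lambda>s. \<Sum>k\<in>A. c k *\<^sub>R V k s) (\<Sum>k\<in>A. c k *\<^sub>R W k) t"
    and 2: "has_lifted_derivative p X \<theta> (V a) (W a) t" by auto
  have "((\<lambda>s. c a *\<^sub>R V a s + (\<Sum>k\<in>A. c k *\<^sub>R V k s)) has_vector_derivative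
      c a *\<^sub>R (W a + \<theta> t *\<^sub>R (\<i> *s V a t) - herm (V a t) (X t) *s p t) +
      ((\<Sum>k\<in>A. c k *\<^sub>R W k) + \<theta> t *\<^sub>R (\<i> *s (\<Sum>k\<in>A. c k *\<^sub>R V k t)) - herm (\<Sum>k\<in>A. c k *\<^sub>R V k t) (X t) *s p t)) (at t)"
    using 1 2 by (intro has_vector_derivative_add bounded_linear.has_vector_derivative[OF bounded_linear_scaleR_right])
      (auto simp: has_lifted_derivative_def)
  also have "c a *\<^sub>R (W a + \<theta> t *\<^sub>R (\<i> *s V a t) - herm (V a t) (X t) *s p t) +
      ((\<Sum>k\<in>A. c k *\<^sub>R W k) + \<theta> t *\<^sub>R (\<i> *s (\<Sum>k\<in>A. c k *\<^sub>R V k t)) - herm (\<Sum>k\<in>A. c k *\<^sub>R V k t) (X t) *s p t)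
    = (c a *\<^sub>R W a + (\<Sum>k\<in>A. c k *\<^sub>R W k)) + \<theta> t *\<^sub>R (\<i> *s (c a *\<^sub>R V a t + (\<Sum>k\<in>A. c k *\<^sub>R V k t)))
      - herm (c a *\<^sub>R V a t + (\<Sum>k\<in>A. c k *\<^sub>R V k t)) (X t) *s p t"
    by (simp add: vec_eq_iff herm_simps scaleR_complex algebra_simps)
  finally show ?case using 1 2 insert.hyps
    by (simp add: has_lifted_derivative_def herm_simps)
qed

lemma has_lifted_derivative_inner:
  assumes "has_lifted_derivative p X \<theta> V W t" "has_lifted_derivative p X \<theta> V' W' t"
  shows "((\<lambda>s. Re (herm (V s) (V' s))) has_real_derivative Re (herm W (V' t)) + Re (herm (V t) W')) (at t)"
proof -
  have 0: "herm (p t) (V' t) = 0" using assms(2) cnj_herm[of "V' t" "p t"] by (simp add: has_lifted_derivative_def)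
  from bounded_linear.has_vector_derivative[OF bounded_linear_Re herm_has_vector_derivative[of V _ t UNIV V']] assms
  have "((\<lambda>s. Re (herm (V s) (V' s))) has_vector_derivative
     Re (herm (V t) (W' + \<theta> t *\<^sub>R (\<i> *s V' t) - herm (V' t) (X t) *s p t) +
      herm (W + \<theta> t *\<^sub>R (\<i> *s V t) - herm (V t) (X t) *s p t) (V' t))) (at t)"
    unfolding has_lifted_derivative_def by blast
  also have "Re (herm (V t) (W' + \<theta> t *\<^sub>R (\<i> *s V' t) - herm (V' t) (X t) *s p t) +
      herm (W + \<theta> t *\<^sub>R (\<i> *s V t) - herm (V t) (X t) *s p t) (V' t)) = Re (herm W (V' t)) + Re (herm (V t) W')"
    using assms 0 by (simp add: has_lifted_derivative_def herm_simps)
  finally show ?thesis by (simp add: has_real_derivative_iff_has_vector_derivative)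
qed

text \<open>The assumption \<open>par\<close> says that the curvature operator is parallel along the curve.\<close>

lemma has_lifted_derivative_curv_op:
  assumes V: "has_lifted_derivative p X \<theta> V W t"
    and \<zeta>: "has_lifted_derivative p X \<theta> \<zeta> K t" and \<eta>: "has_lifted_derivative p X \<theta> \<eta> H t"
    and b: "(b has_real_derivative 0) (at t)"
    and par: "\<And>Z. herm Z K *s \<eta> t + herm Z (\<zeta> t) *s H - herm Z H *s \<zeta> t - herm Z (\<eta> t) *s K = 0"
  shows "has_lifted_derivative p X \<theta> (\<lambda>s. curv_op (\<zeta> s) (\<eta> s) (b s) (V s)) (curv_op (\<zeta> t) (\<eta> t) (b t) W) t"
proof -
  have 0: "herm (p t) (V t) = 0" "herm (p t) (\<zeta> t) = 0" "herm (p t) (\<eta> t) = 0"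
    using assms cnj_herm[of "V t" "p t"] cnj_herm[of "\<zeta> t" "p t"] cnj_herm[of "\<eta> t" "p t"]
    by (simp_all add: has_lifted_derivative_def)
  have o: "herm (V t) (p t) = 0" "herm (\<zeta> t) (p t) = 0" "herm (\<eta> t) (p t) = 0" "herm W (p t) = 0"
    using assms by (simp_all add: has_lifted_derivative_def)
  define V' \<zeta>' \<eta>' where "V' = W + \<theta> t *\<^sub>R (\<i> *s V t) - herm (V t) (X t) *s p t"
    and "\<zeta>' = K + \<theta> t *\<^sub>R (\<i> *s \<zeta> t) - herm (\<zeta> t) (X t) *s p t"
    and "\<eta>' = H + \<theta> t *\<^sub>R (\<i> *s \<eta> t) - herm (\<eta> t) (X t) *s p t"
  have d: "(V has_vector_derivative V') (at t)" "(\<zeta> has_vector_derivative \<zeta>') (at t)" "(\<eta> has_vector_derivative \<eta>') (at t)"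
    using assms by (simp_all add: has_lifted_derivative_def V'_def \<zeta>'_def \<eta>'_def)
  have "((\<lambda>s. herm (V s) (\<zeta> s) *s \<eta> s - herm (V s) (\<eta> s) *s \<zeta> s + b s *\<^sub>R (\<i> *s V s)) has_vector_derivative
     (herm (V t) (\<zeta> t) *s \<eta>' + (herm (V t) \<zeta>' + herm V' (\<zeta> t)) *s \<eta> t)
     - (herm (V t) (\<eta> t) *s \<zeta>' + (herm (V t) \<eta>' + herm V' (\<eta> t)) *s \<zeta> t)
     + (b t *\<^sub>R (\<i> *s V' + 0 *s V t) + 0 *\<^sub>R (\<i> *s V t))) (at t)"
    by (intro has_vector_derivative_add has_vector_derivative_diff has_vector_derivative_scaleR b d
        scale_has_vector_derivative herm_has_vector_derivative has_vector_derivative_const)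
  \<comment> \<open>The Hopf terms and the \<open>p\<close>-components regroup into those of the
    image field. What remains in the last parenthesis is the derivative of the operator itself
    applied to \<open>V\<close>, which \<open>par\<close> annihilates.\<close>
  also have "(herm (V t) (\<zeta> t) *s \<eta>' + (herm (V t) \<zeta>' + herm V' (\<zeta> t)) *s \<eta> t)
     - (herm (V t) (\<eta> t) *s \<zeta>' + (herm (V t) \<eta>' + herm V' (\<eta> t)) *s \<zeta> t)
     + (b t *\<^sub>R (\<i> *s V' + 0 *s V t) + 0 *\<^sub>R (\<i> *s V t))
    = curv_op (\<zeta> t) (\<eta> t) (b t) W + \<theta> t *\<^sub>R (\<i> *s curv_op (\<zeta> t) (\<eta> t) (b t) (V t))
      - herm (curv_op (\<zeta> t) (\<eta> t) (b t) (V t)) (X t) *s p t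
      + (herm (V t) K *s \<eta> t + herm (V t) (\<zeta> t) *s H - herm (V t) H *s \<zeta> t - herm (V t) (\<eta> t) *s K)"
    by (simp add: V'_def \<zeta>'_def \<eta>'_def curv_op_def herm_simps 0 o vec_eq_iff scaleR_complex algebra_simps)
  finally show ?thesis unfolding par
    by (simp add: has_lifted_derivative_def curv_op_def herm_simps o)
qed

text \<open>The variational equation is evaluated on three kinds of test pairs: rotation of
  \<open>\<zeta>\<close> in its complex line gives conservation of \<open>c\<close>, horizontal
  variations determine the derivative of \<open>X\<close>, and vertical variations orthogonal to
  \<open>\<zeta>\<close> determine that of \<open>K\<close> up to a multiple of
  \<open>\<zeta>\<close>. The coefficient \<open>2 * c t * (1 + d * \<kappa>)\<close> is twice the
  inner product of \<open>\<eta>\<close> with \<open>\<i> *s \<zeta>\<close>, as the curvature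
  tensor requires.\<close>

lemma lifted_geodesic_equations:
  assumes geo: "lifted_geodesic d \<kappa> T p \<zeta> X K \<theta>" and T: "open T" "t \<in> T" and d: "d \<ge> 0" and \<kappa>0: "\<kappa> > 0"
  defines "c \<equiv> \<lambda>s. Im (herm (K s) (\<zeta> s))"
  defines "\<eta> \<equiv> \<lambda>s. K s + (d * c s) *\<^sub>R (\<i> *s \<zeta> s)"
  shows "\<exists>H. (c has_real_derivative 0) (at t) \<and> has_lifted_derivative p X \<theta> \<zeta> (K t) t \<and>
     has_lifted_derivative p X \<theta> X (curv_op (\<zeta> t) (\<eta> t) (2 * c t * (1 + d * \<kappa>)) (X t)) t \<and>
     has_lifted_derivative p X \<theta> \<eta> H t \<and>
     (\<forall>Z. herm Z (K t) *s \<eta> t + herm Z (\<zeta> t) *s H - herm Z H *s \<zeta> t - herm Z (\<eta> t) *s K t = 0)"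
proof -
  have pp: "herm (p t) (p t) = 1" and \<zeta>p: "herm (\<zeta> t) (p t) = 0" and \<kappa>: "Re (herm (\<zeta> t) (\<zeta> t)) = \<kappa>"
    and Xp: "herm (X t) (p t) = 0" and Kp: "herm (K t) (p t) = 0" and K\<zeta>: "Re (herm (K t) (\<zeta> t)) = 0"
    and p': "(p has_vector_derivative X t + \<theta> t *\<^sub>R (\<i> *s p t)) (at t)"
    and \<zeta>': "(\<zeta> has_vector_derivative K t + \<theta> t *\<^sub>R (\<i> *s \<zeta> t) - herm (\<zeta> t) (X t) *s p t) (at t)"
    using geo T(2) unfolding lifted_geodesic_def by blast+
  obtain X' K' c' where X': "(X has_vector_derivative X') (at t)" and K': "(K has_vector_derivative K') (at t)"
    and c': "(c has_vector_derivative c') (at t)"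
    and EL: "\<And>P Y. herm P (p t) = 0 \<Longrightarrow> herm Y (p t) = 0 \<Longrightarrow> Re (herm Y (\<zeta> t)) = 0 \<Longrightarrow>
           Re (herm X' P) + Re (herm K' Y) + d * c' * Im (herm Y (\<zeta> t))
           + (\<theta> t * (Im (herm (X t) P) + Im (herm (K t) Y))
             + 2 * Im (herm (K t) (\<zeta> t)) * (1 + d * \<kappa>) * Im (herm (X t) P)
             + Re (herm (\<zeta> t) P * herm (X t) (K t)) - Re (herm (X t) (\<zeta> t) * herm (K t) P)
             + 2 * d * Im (herm (K t) (\<zeta> t)) * (Im (herm (\<zeta> t) P * herm (X t) (\<zeta> t)) - Im (herm (K t) Y)))
           = 0"
    using geo T(2) unfolding lifted_geodesic_def c_def by blast
  have perp: "herm V' (p t) = - herm (V t) (X t)"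
    if V: "(V has_vector_derivative V') (at t)" "\<And>s. s \<in> T \<Longrightarrow> herm (V s) (p s) = 0" for V V'
  proof -
    have "((\<lambda>s. herm (V s) (p s)) has_vector_derivative herm (V t) (X t + \<theta> t *\<^sub>R (\<i> *s p t)) + herm V' (p t)) (at t)"
      by (rule herm_has_vector_derivative[OF V(1) p'])
    moreover have "((\<lambda>s. herm (V s) (p s)) has_vector_derivative 0) (at t)"
      by (rule has_vector_derivative_transform_within_open[of "\<lambda>s. 0", OF has_vector_derivative_const T]) (simp add: V(2))
    ultimately have "herm (V t) (X t + \<theta> t *\<^sub>R (\<i> *s p t)) + herm V' (p t) = 0"
      using vector_derivative_unique_at by blast
    then show ?thesis using V(2)[OF T(2)] by (simp add: herm_simps eq_neg_iff_add_eq_0 add.commute)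
  qed
  have all: "herm (X s) (p s) = 0" "herm (K s) (p s) = 0" if "s \<in> T" for s
    using geo that unfolding lifted_geodesic_def by blast+
  have X'p: "herm X' (p t) = - herm (X t) (X t)" and K'p: "herm K' (p t) = - herm (K t) (X t)"
    using perp[OF X'] perp[OF K'] all by blast+
  have p\<zeta>: "herm (p t) (\<zeta> t) = 0" "herm (p t) (X t) = 0" "herm (p t) (K t) = 0"
    using \<zeta>p Xp Kp by (metis cnj_herm complex_cnj_zero)+
  have im: "Im (herm (\<zeta> t) (\<zeta> t)) = 0" "Im (herm (K t) (K t)) = 0"
    unfolding herm_self by simp_all
  have c'_eq: "c' = Im (herm K' (\<zeta> t))"
  proof -
    have "(c has_vector_derivative Im (herm (K t) (K t + \<theta> t *\<^sub>R (\<i> *s \<zeta> t) - herm (\<zeta> t) (X t) *s p t)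
        + herm K' (\<zeta> t))) (at t)"
      unfolding c_def by (rule bounded_linear.has_vector_derivative[OF bounded_linear_Im herm_has_vector_derivative[OF K' \<zeta>']])
    then have "c' = Im (herm (K t) (K t + \<theta> t *\<^sub>R (\<i> *s \<zeta> t) - herm (\<zeta> t) (X t) *s p t) + herm K' (\<zeta> t))"
      using c' vector_derivative_unique_at by blast
    then show ?thesis using Kp K\<zeta> by (simp add: herm_simps im)
  qed
  \<comment> \<open>The test pair is the rotation of \<open>\<zeta>\<close> in its complex line. The
    covariant term contributes \<open>c'\<close> and the Berger term
    \<open>d * \<kappa> * c'\<close>; all others vanish.\<close>
  have "c' * (1 + d * \<kappa>) = 0"
    using EL[of 0 "\<i> *s \<zeta> t"] K\<zeta> \<kappa> by (simp add: herm_simps \<zeta>p im c'_eq algebra_simps)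
  moreover have "1 + d * \<kappa> > 0" using d \<kappa>0 by (simp add: add_pos_nonneg)
  ultimately have c'0: "c' = 0" by simp
  define DX where "DX = curv_op (\<zeta> t) (\<eta> t) (2 * c t * (1 + d * \<kappa>)) (X t)"
  \<comment> \<open>The residual of the claimed equation for \<open>X'\<close>. It is orthogonal to
    \<open>p t\<close>, hence itself an admissible test vector, which forces it to vanish.\<close>
  define E where "E = X' - \<theta> t *\<^sub>R (\<i> *s X t) + herm (X t) (X t) *s p t - DX"
  have Ep: "herm E (p t) = 0"
    by (simp add: E_def DX_def curv_op_def \<eta>_def herm_simps X'p Xp \<zeta>p Kp pp)
  have "Re (herm E P) = 0" if P: "herm P (p t) = 0" for P
  proof -
    have pP: "herm (p t) P = 0" using P by (metis cnj_herm complex_cnj_zero)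
    have s: "herm (K t) (X t) = cnj (herm (X t) (K t))" "herm (X t) (\<zeta> t) = cnj (herm (\<zeta> t) (X t))"
      by (simp_all add: cnj_herm)
    show ?thesis
      using EL[OF P, of 0]
      by (simp add: E_def DX_def curv_op_def \<eta>_def c_def herm_simps pP s algebra_simps)
  qed
  from this[OF Ep] have "E = 0" by (simp add: inner_conv_herm[symmetric])
  then have X'_eq: "X' = DX + \<theta> t *\<^sub>R (\<i> *s X t) - herm (X t) (X t) *s p t"
    by (simp add: E_def algebra_simps)
  have DXp: "herm DX (p t) = 0"
    by (simp add: DX_def curv_op_def \<eta>_def herm_simps Xp \<zeta>p Kp)
  define E0 where "E0 = K' - \<theta> t *\<^sub>R (\<i> *s K t) + herm (K t) (X t) *s p t + (2 * d * c t) *\<^sub>R (\<i> *s K t)"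
  \<comment> \<open>The Lagrange multiplier of the constraint on the length of
    \<open>\<zeta>\<close>: since only variations orthogonal to \<open>\<zeta>\<close> are
    admissible, the residual \<open>E0\<close> vanishes modulo \<open>\<zeta> t\<close>
    only.\<close>
  define \<mu> where "\<mu> = Re (herm E0 (\<zeta> t)) / \<kappa>"
  define Y where "Y = E0 - \<mu> *\<^sub>R \<zeta> t"
  have Yp: "herm Y (p t) = 0"
    by (simp add: Y_def E0_def herm_simps K'p Kp \<zeta>p pp)
  have Y\<zeta>: "Re (herm Y (\<zeta> t)) = 0"
    using \<kappa>0 by (simp add: Y_def herm_simps \<kappa> \<mu>_def)
  have pY: "herm (p t) Y = 0" using Yp by (metis cnj_herm complex_cnj_zero)
  have "Re (herm E0 Y) = 0"
    using EL[OF _ Yp Y\<zeta>, of 0] by (simp add: E0_def c'0 c_def herm_simps pY algebra_simps)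
  then have "Re (herm Y Y) = 0"
    using Y\<zeta> Re_herm_commute[of "\<zeta> t" Y] arg_cong[OF Y_def, of "\<lambda>v. Re (herm v Y)"]
    by (simp add: herm_diff_left herm_scaleR_left)
  then have "Y = 0" by (simp add: inner_conv_herm[symmetric])
  then have K'_eq: "K' = \<mu> *\<^sub>R \<zeta> t - (2 * d * c t) *\<^sub>R (\<i> *s K t) + \<theta> t *\<^sub>R (\<i> *s K t) - herm (K t) (X t) *s p t"
    by (simp add: Y_def E0_def algebra_simps)
  \<comment> \<open>The covariant derivative of \<open>\<eta>\<close>: \<open>K\<close> contributes
    the coefficient \<open>- 2 * d * c t\<close> of \<open>\<i> *s K t\<close>, and the summand with
    \<open>\<i> *s \<zeta>\<close> contributes \<open>+ d * c t\<close>.\<close>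
  define H where "H = \<mu> *\<^sub>R \<zeta> t - (d * c t) *\<^sub>R (\<i> *s K t)"
  have c0: "(c has_real_derivative 0) (at t)"
    using c' c'0 by (simp add: has_real_derivative_iff_has_vector_derivative)
  have "(\<eta> has_vector_derivative K' + ((d * c t) *\<^sub>R (\<i> *s (K t + \<theta> t *\<^sub>R (\<i> *s \<zeta> t) - herm (\<zeta> t) (X t) *s p t) + 0 *s \<zeta> t)
      + (d * 0) *\<^sub>R (\<i> *s \<zeta> t))) (at t)"
    unfolding \<eta>_def
    by (intro has_vector_derivative_add K' has_vector_derivative_scaleR DERIV_cmult c0 scale_has_vector_derivative
        has_vector_derivative_const \<zeta>')
  also have "K' + ((d * c t) *\<^sub>R (\<i> *s (K t + \<theta> t *\<^sub>R (\<i> *s \<zeta> t) - herm (\<zeta> t) (X t) *s p t) + 0 *s \<zeta> t)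
      + (d * 0) *\<^sub>R (\<i> *s \<zeta> t)) = H + \<theta> t *\<^sub>R (\<i> *s \<eta> t) - herm (\<eta> t) (X t) *s p t"
    by (simp add: K'_eq H_def \<eta>_def vec_eq_iff herm_simps scaleR_complex algebra_simps)
  finally have "has_lifted_derivative p X \<theta> \<eta> H t"
    by (simp add: has_lifted_derivative_def H_def \<eta>_def herm_simps \<zeta>p Kp)
  moreover have "has_lifted_derivative p X \<theta> X DX t"
    using X' Xp DXp by (simp add: has_lifted_derivative_def X'_eq)
  moreover have "has_lifted_derivative p X \<theta> \<zeta> (K t) t"
    using \<zeta>' \<zeta>p Kp by (simp add: has_lifted_derivative_def)
  \<comment> \<open>The terms without \<open>\<i>\<close> cancel by antisymmetry; those with
    \<open>\<i>\<close> cancel because \<open>herm\<close> is conjugate linear on the right, the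
    algebraic form of the J-invariance of R.\<close>
  moreover have "herm Z (K t) *s \<eta> t + herm Z (\<zeta> t) *s H - herm Z H *s \<zeta> t - herm Z (\<eta> t) *s K t = 0" for Z
    by (simp add: H_def \<eta>_def vec_eq_iff herm_simps scaleR_complex algebra_simps)
  ultimately show ?thesis using c0 unfolding DX_def by blast
qed

section \<open>Frenet frames of orbits\<close>

text \<open>The nonzero vectors \<open>V\<close> arise from the orbit of \<open>V 1\<close> under the skew operator \<open>A\<close> by
  orthonormalization, hence there are at most \<open>dim S\<close> of them. Because of \<open>inverse 0 = 0\<close> a
  vanishing \<open>k\<close> makes all later ones vanish.\<close>

lemma frenet_span_dim:
  fixes A :: "'a::euclidean_space \<Rightarrow> 'a" and V w :: "nat \<Rightarrow> 'a" and k :: "nat \<Rightarrow> real"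
  assumes A: "linear A" "\<And>x y. A x \<bullet> y + x \<bullet> A y = 0"
    and S: "subspace S" "\<And>x. x \<in> S \<Longrightarrow> A x \<in> S" "V 1 \<in> S" "dim S < j + 1"
    and V: "V 0 = 0" "V 1 = 0 \<or> norm (V 1) = 1" "k 0 = 0"
    and w: "\<And>j. w (Suc j) = A (V (Suc j)) + k j *\<^sub>R V j"
    and k: "\<And>j. k (Suc j) = norm (w (Suc j))"
    and V': "\<And>j. V (Suc (Suc j)) = w (Suc j) /\<^sub>R k (Suc j)"
  shows "k j = 0"
proof (rule ccontr)
  assume kj: "k j \<noteq> 0"
  have kV: "k j *\<^sub>R V (Suc j) = w j" if "j > 0" for j
    using that k[of "j - 1"] V'[of "j - 1"] by (cases j; cases "w j = 0") auto
  have k1: "norm (V (Suc j)) = 1" if "k j \<noteq> 0" for j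
    using that k[of "j - 1"] V'[of "j - 1"] V(3) by (cases j) auto
  \<comment> \<open>A vector \<open>V j = 0\<close> would force \<open>k l *\<^sub>R V l = 0\<close>
    for its predecessor \<open>l\<close>, hence \<open>w j = 0\<close> and \<open>k j = 0\<close>.
    So nonzero curvatures cannot reappear after a zero one.\<close>
  have k2: "norm (V j) = 1" if that': "k j \<noteq> 0" "j > 0" for j
  proof (cases "V j = 0")
    case True
    obtain l where j: "j = Suc l" using that'(2) by (cases j) auto
    have "k l *\<^sub>R V l = 0"
    proof (cases "k l = 0")
      case False
      then show ?thesis using k1[of l] True j by simp
    qed simp
    then have "w j = 0" using w[of l] True j linear_0[OF A(1)] by simp
    then show ?thesis using k[of l] j that' by simp
  next
    case False
    obtain l where j: "j = Suc l" using that'(2) by (cases j) auto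
    show ?thesis
    proof (cases l)
      case 0
      then show ?thesis using False V(2) j by simp
    next
      case (Suc l')
      then have "k l \<noteq> 0" using False V'[of l'] j by auto
      then show ?thesis using k1[of l] j by simp
    qed
  qed
  have AV: "A (V j) = k j *\<^sub>R V (Suc j) - k (j - 1) *\<^sub>R V (j - 1)" if "j > 0" for j
    using that kV[OF that] w[of "j - 1"] by (cases j) auto
  have skew0: "x \<bullet> A x = 0" for x using A(2)[of x x] by (simp add: inner_commute)
  have orth: "\<forall>i<n. V i \<bullet> V n = 0" for n
  proof (induction n rule: less_induct)
    case (less n)
    show ?case
    proof (cases "n \<le> 1")
      case True
      then show ?thesis using V(1) by (cases n) auto
    next
      case False
      then obtain l where n: "n = Suc (Suc l)" by (metis Suc_leI le_Suc_ex not_less_eq_eq plus_1_eq_Suc One_nat_def add_Suc)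
      define r where "r = Suc l"
      have IH: "V i \<bullet> V j = 0" if "i < n" "j < n" "i \<noteq> j" for i j
        using less.IH that by (metis inner_commute linorder_neqE_nat)
      have "w r \<bullet> V i = 0" if i: "i < n" for i
      proof (cases "i = 0")
        case True
        then show ?thesis using V(1) by simp
      next
        case False
        \<comment> \<open>Skewness moves \<open>A\<close> to \<open>V i\<close>, where
          \<open>A (V i)\<close> only involves the neighbours of \<open>V i\<close>. This gives zero
          for \<open>i < l\<close>; for \<open>i = l\<close> the two terms with \<open>k l\<close>
          cancel, and for \<open>i = r\<close> skewness alone suffices.\<close>
        have wr: "w r \<bullet> V i = - (V r \<bullet> A (V i)) + k l * (V l \<bullet> V i)"
          using A(2)[of "V r" "V i"] w[of l] by (simp add: r_def inner_add_left)
        consider "i = r" | "i = l" | "i < l" using i by (fastforce simp: n r_def)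
        then show ?thesis
        proof cases
          case 1
          then show ?thesis unfolding wr using skew0[of "V r"] IH[of l r] by (simp add: n r_def)
        next
          case 2
          have "V r \<bullet> A (V i) = k l * (V r \<bullet> V r) - k (i - 1) * (V r \<bullet> V (i - 1))"
            using AV[of i] False by (simp add: 2 r_def inner_diff_right)
          moreover have "V r \<bullet> V (i - 1) = 0" using 2 IH[of r "i - 1"] by (simp add: n r_def)
          moreover have "k l * (V r \<bullet> V r) = k l * (V l \<bullet> V l)"
            using k1[of l] k2[of l] 2 False by (cases "k l = 0") (auto simp: r_def dot_square_norm)
          ultimately show ?thesis unfolding wr by (simp add: 2)
        next
          case 3
          have "V r \<bullet> A (V i) = k i * (V r \<bullet> V (Suc i)) - k (i - 1) * (V r \<bullet> V (i - 1))"
            using AV[of i] False by (simp add: inner_diff_right)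
          moreover have "V r \<bullet> V (i - 1) = 0" "V r \<bullet> V (Suc i) = 0" "V l \<bullet> V i = 0"
            using 3 IH[of r "i - 1"] IH[of r "Suc i"] IH[of l i] by (auto simp: n r_def)
          ultimately show ?thesis unfolding wr by simp
        qed
      qed
      then show ?thesis by (simp add: n V' r_def inner_commute)
    qed
  qed
  have VS: "V i \<in> S \<and> V (Suc i) \<in> S" for i
  proof (induction i)
    case 0
    then show ?case using S V(1) by (simp add: subspace_0)
  next
    case (Suc i)
    then show ?case using S w[of i] by (simp add: V' subspace_scale subspace_add)
  qed
  have kdown: "k i \<noteq> 0" if "k (Suc i) \<noteq> 0" "i > 0" for i
  proof -
    have "V (Suc i) \<noteq> 0" using k2[OF that(1)] by auto
    then show ?thesis using V'[of "i - 1"] that(2) by (cases i) auto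
  qed
  have kpos: "k i \<noteq> 0" if "0 < i" "i \<le> j" for i
    using that(2,1) kj by (induction rule: inc_induct) (use kdown in auto)
  have nz: "norm (V i) = 1" if "i \<in> {1..j + 1}" for i
  proof (cases "i \<le> j")
    case True
    then show ?thesis using that k2[OF kpos] by simp
  next
    case False
    then show ?thesis using that k1[OF kj] by (simp add: le_Suc_eq)
  qed
  have orth': "V a \<bullet> V b = 0" if "a \<noteq> b" for a b
    using orth that by (metis inner_commute linorder_neqE_nat)
  have inj: "inj_on V {1..j + 1}"
  proof (rule inj_onI, rule ccontr)
    fix a b assume ab: "a \<in> {1..j + 1}" "b \<in> {1..j + 1}" "V a = V b" "a \<noteq> b"
    then show False using orth'[OF ab(4)] nz[OF ab(2)] by auto
  qed
  have "independent (V ` {1..j + 1})"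
  proof (rule pairwise_orthogonal_independent)
    show "pairwise orthogonal (V ` {1..j + 1})"
      by (auto simp: pairwise_def orthogonal_def intro!: orth')
    show "0 \<notin> V ` {1..j + 1}" using nz by force
  qed
  then have "card (V ` {1..j + 1}) \<le> dim S"
    by (rule independent_card_le_dim[rotated]) (use VS in blast)
  then show False using S(4) card_image[OF inj] by simp
qed

section \<open>Curves in projective space and their lifts\<close>

definition chart_map :: "'k::finite \<Rightarrow> complex ^ 'k \<Rightarrow> complex ^ 'k" where
  "chart_map i w = inverse (w $ i) *s w - axis i 1"

definition D_chart_map :: "'k::finite \<Rightarrow> complex ^ 'k \<Rightarrow> complex ^ 'k \<Rightarrow> complex ^ 'k" where
  "D_chart_map i w V = inverse (w $ i) *s V - (V $ i * (inverse (w $ i))\<^sup>2) *s w"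

lemma complex_line_scale: "c \<noteq> 0 \<Longrightarrow> complex_line (c *s w) = complex_line w"
  unfolding complex_line_def
proof (rule set_eqI, rule iffI)
  fix x assume "c \<noteq> 0" "x \<in> range (\<lambda>d. d *s w)"
  then obtain d where "x = d *s w" by blast
  with \<open>c \<noteq> 0\<close> have "x = (d / c) *s (c *s w)" by simp
  then show "x \<in> range (\<lambda>d. d *s (c *s w))" by blast
qed auto

lemma complex_line_in_chart_domain:
  assumes "w \<noteq> 0"
  shows "complex_line w \<in> chart_domain i \<longleftrightarrow> w $ i \<noteq> 0"
proof
  assume "complex_line w \<in> chart_domain i"
  then show "w $ i \<noteq> 0" by (auto simp: chart_domain_def complex_line_def)
next
  assume "w $ i \<noteq> 0"
  moreover have "w \<in> complex_line w" by (auto simp: complex_line_def intro!: range_eqI[of _ _ 1])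
  ultimately show "complex_line w \<in> chart_domain i"
    using assms by (auto simp: chart_domain_def CP_def)
qed

lemma affine_coord_complex_line:
  assumes "w $ i \<noteq> 0"
  shows "affine_coord i (complex_line w) = chart_map i w"
proof -
  have z: "chart_map i w \<in> affine_space i"
    using assms by (simp add: chart_map_def affine_space_def)
  have "complex_line w = affine_point i (chart_map i w)"
    using complex_line_scale[of "inverse (w $ i)" w] assms by (simp add: affine_point_def chart_map_def)
  then show ?thesis using affine_coord_affine_point[OF z] by simp
qed

lemma chart_map_affine: "w $ i \<noteq> 0 \<Longrightarrow> chart_map i w \<in> affine_space i"
  by (simp add: chart_map_def affine_space_def)

lemma D_chart_map_affine: "w $ i \<noteq> 0 \<Longrightarrow> D_chart_map i w V \<in> affine_space i"
  by (simp add: D_chart_map_def affine_space_def power2_eq_square)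

lemma D_chart_map_point: "w $ i \<noteq> 0 \<Longrightarrow> D_chart_map i w (c *s w) = 0"
  by (simp add: D_chart_map_def vec_eq_iff power2_eq_square)

lemma linear_D_chart_map: "linear (D_chart_map i w)"
  by (rule linearI) (simp_all add: D_chart_map_def vec_eq_iff scaleR_complex algebra_simps)

text \<open>The right-hand side is expressed in homogeneous coordinates and does not mention
  \<open>i\<close>, so the metric is the same in all charts. Numerator and squared denominator both
  acquire the factor \<open>N\<^sup>2\<close> from the rescaling by \<open>r\<close>.\<close>

lemma fubini_study_chart_map:
  assumes w: "w $ i \<noteq> 0"
  shows "fubini_study m (chart_map i w) (D_chart_map i w V) (D_chart_map i w W) =
    4 / m * (Re (herm w w * herm V W - herm V w * herm w W) / (Re (herm w w))\<^sup>2)"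
proof -
  define r where "r = inverse (w $ i)"
  define N n where "N = (cmod r)\<^sup>2" and "n = Re (herm w w)"
  define z where "z = chart_map i w"
  define a b where "a = D_chart_map i w V" and "b = D_chart_map i w W"
  have r0: "r \<noteq> 0" "r * w $ i = 1" using w by (auto simp: r_def)
  have N: "complex_of_real N = r * cnj r" "N > 0"
    using r0(1) by (simp_all only: N_def complex_norm_square) simp
  have n: "herm w w = complex_of_real n" using herm_self_Re[of w] by (simp add: n_def)
  have ab0: "a $ i = 0" "b $ i = 0"
    using D_chart_map_affine[OF w] by (simp_all add: a_def b_def affine_space_def)
  have "herm z z = complex_of_real (N * n) - 1"
  proof -
    have "cnj r * cnj (w $ i) = 1" using arg_cong[OF r0(2), of cnj] by simp
    then show ?thesis using r0
      by (simp add: z_def chart_map_def r_def[symmetric] herm_simps herm_axis herm_axis_left n N algebra_simps)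
  qed
  then have zz: "1 + Re (herm z z) = N * n" by simp
  have az: "herm a z = cnj r * herm a w" and zb: "herm z b = r * herm w b"
    by (simp_all add: z_def chart_map_def r_def[symmetric] herm_simps herm_axis herm_axis_left ab0)
  have "herm a b * complex_of_real (N * n) - herm a z * herm z b
      = (complex_of_real N)\<^sup>2 * (complex_of_real n * herm V W - herm V w * herm w W)"
    unfolding az zb of_real_mult N(1)
    by (simp add: a_def b_def D_chart_map_def r_def[symmetric] herm_simps n power2_eq_square algebra_simps)
  then have "Re (herm a b * complex_of_real (N * n) - herm a z * herm z b)
      = Re (complex_of_real (N\<^sup>2) * (complex_of_real n * herm V W - herm V w * herm w W))"
    by simp
  then have key: "Re (herm a b) * (N * n) - Re (herm a z * herm z b)
      = N\<^sup>2 * Re (complex_of_real n * herm V W - herm V w * herm w W)"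
  proof -
    have "Re (x * complex_of_real y) = Re x * y" "Re (complex_of_real y * x) = y * Re x" for x y
      by simp_all
    with \<open>Re (herm a b * complex_of_real (N * n) - herm a z * herm z b) = _\<close> show ?thesis
      by (simp only: minus_complex.simps)
  qed
  have n0: "n > 0"
  proof -
    have "w \<noteq> 0" using w by auto
    then show ?thesis by (simp add: n_def inner_conv_herm[symmetric])
  qed
  have "Re (herm a b) * inverse (N * n) - Re (herm a z * herm z b) * (inverse (N * n))\<^sup>2
      = (Re (herm a b) * (N * n) - Re (herm a z * herm z b)) / (N * n)\<^sup>2"
    using N(2) n0 by (simp add: field_simps power2_eq_square)
  also have "\<dots> = Re (complex_of_real n * herm V W - herm V w * herm w W) / n\<^sup>2"
    unfolding key using N(2) by (simp add: power_mult_distrib)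
  finally show ?thesis
    unfolding fubini_study_alt z_def[symmetric] a_def[symmetric] b_def[symmetric] zz n
    by (simp add: n_def)
qed

lemma vec_nth_has_vector_derivative:
  "(w has_vector_derivative w') F \<Longrightarrow> ((\<lambda>s. w s $ i) has_vector_derivative w' $ i) F"
  by (rule bounded_linear.has_vector_derivative[OF bounded_linear_vec_nth])

lemma inverse_has_vector_derivative:
  assumes "(f has_vector_derivative f') (at t)" "f t \<noteq> (0 :: complex)"
  shows "((\<lambda>s. inverse (f s)) has_vector_derivative - f' * (inverse (f t))\<^sup>2) (at t)"
  using Deriv.has_derivative_inverse[OF assms(2) assms(1)[unfolded has_vector_derivative_def]]
  by (simp add: has_vector_derivative_def scaleR_complex power2_eq_square mult_ac)

lemma chart_map_has_vector_derivative:
  assumes "(w has_vector_derivative w') (at t)" "w t $ i \<noteq> 0"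
  shows "((\<lambda>s. chart_map i (w s)) has_vector_derivative D_chart_map i (w t) w') (at t)"
proof -
  have "((\<lambda>s. inverse (w s $ i) *s w s - axis i 1) has_vector_derivative
     inverse (w t $ i) *s w' + (- (w' $ i) * (inverse (w t $ i))\<^sup>2) *s w t - 0) (at t)"
    by (intro has_vector_derivative_diff scale_has_vector_derivative has_vector_derivative_const
        inverse_has_vector_derivative vec_nth_has_vector_derivative assms)
  then show ?thesis by (simp add: chart_map_def D_chart_map_def vector_smult_lneg)
qed

text \<open>This justifies \<open>has_lifted_derivative\<close>. With
  \<open>r = inverse (p t $ i)\<close> the Christoffel term becomes
  \<open>(r * X t $ i) *s DV + (r * V t $ i) *s DX\<close>, where \<open>DV\<close> and
  \<open>DX\<close> are the images under the differential of the chart; it cancels the extra terms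
  of the quotient rule. The Hopf term of \<open>V'\<close> cancels against the phase change of
  \<open>r\<close>.\<close>

lemma D_chart_map_covariant_derivative:
  assumes p: "herm (p t) (p t) = 1" "(p has_vector_derivative X t + \<theta> t *\<^sub>R (\<i> *s p t)) (at t)"
    and Xp: "herm (X t) (p t) = 0" and V: "has_lifted_derivative p X \<theta> V W t" and i: "p t $ i \<noteq> 0"
  shows "\<exists>d. ((\<lambda>s. D_chart_map i (p s) (V s)) has_vector_derivative d) (at t) \<and>
    d + fs_christoffel (chart_map i (p t)) (D_chart_map i (p t) (X t + \<theta> t *\<^sub>R (\<i> *s p t))) (D_chart_map i (p t) (V t))
    = D_chart_map i (p t) W"
proof -
  define r where "r = inverse (p t $ i)"
  have r: "r \<noteq> 0" "r * p t $ i = 1" using i by (auto simp: r_def)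
  have Vp: "herm (V t) (p t) = 0" and V': "(V has_vector_derivative W + \<theta> t *\<^sub>R (\<i> *s V t) - herm (V t) (X t) *s p t) (at t)"
    using V by (auto simp: has_lifted_derivative_def)
  define V' where "V' = W + \<theta> t *\<^sub>R (\<i> *s V t) - herm (V t) (X t) *s p t"
  define p' where "p' = X t + \<theta> t *\<^sub>R (\<i> *s p t)"
  define r' where "r' = - (p' $ i) * r\<^sup>2"
  have r'_eq: "r' = - (X t $ i * r\<^sup>2 + \<i> * complex_of_real (\<theta> t) * r)"
    using r by (simp add: r'_def p'_def scaleR_complex power2_eq_square algebra_simps)
  have dr: "((\<lambda>s. inverse (p s $ i)) has_vector_derivative r') (at t)"
    unfolding r'_def r_def p'_def
    by (intro inverse_has_vector_derivative vec_nth_has_vector_derivative p i)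
  have "((\<lambda>s. inverse (p s $ i) *s V s - (V s $ i * (inverse (p s $ i) * inverse (p s $ i))) *s p s) has_vector_derivative
     (r *s V' + r' *s V t) - ((V t $ i * (r * r)) *s p' + (V t $ i * (r * r' + r' * r) + V' $ i * (r * r)) *s p t)) (at t)"
    unfolding r_def V'_def p'_def
    by (intro has_vector_derivative_diff scale_has_vector_derivative has_vector_derivative_mult
        vec_nth_has_vector_derivative V' p dr[unfolded r_def])
  moreover define d where "d = (r *s V' + r' *s V t) - ((V t $ i * (r * r)) *s p' + (V t $ i * (r * r' + r' * r) + V' $ i * (r * r)) *s p t)"
  ultimately have D: "((\<lambda>s. D_chart_map i (p s) (V s)) has_vector_derivative d) (at t)"
    by (simp add: D_chart_map_def power2_eq_square)
  have lin: "D_chart_map i (p t) V' = D_chart_map i (p t) W + \<theta> t *\<^sub>R (\<i> *s D_chart_map i (p t) (V t))"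
  proof -
    have "D_chart_map i (p t) (\<i> *s V t) = \<i> *s D_chart_map i (p t) (V t)"
      by (simp add: D_chart_map_def vec_eq_iff algebra_simps)
    then show ?thesis
      unfolding V'_def linear_diff[OF linear_D_chart_map] linear_add[OF linear_D_chart_map]
        linear_scale[OF linear_D_chart_map] D_chart_map_point[OF i] by simp
  qed
  have d_eq: "d = D_chart_map i (p t) V' + r' *s V t - (V t $ i * (r * r)) *s p' - (V t $ i * (2 * r * r')) *s p t"
    by (simp add: d_def D_chart_map_def r_def[symmetric] vec_eq_iff power2_eq_square algebra_simps)
  have a: "D_chart_map i (p t) p' = D_chart_map i (p t) (X t)"
    using D_chart_map_point[OF i, of "complex_of_real (\<theta> t) * \<i>"]
    by (simp add: p'_def linear_add[OF linear_D_chart_map] scaleR_conv_scale)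
  define z where "z = chart_map i (p t)"
  have nz: "(1 + (norm z)\<^sup>2) = (cmod r)\<^sup>2"
  proof -
    have "cnj r * cnj (p t $ i) = 1" using arg_cong[OF r(2), of cnj] by simp
    then have "herm z z = r * cnj r - 1"
      using r by (simp add: z_def chart_map_def r_def[symmetric] herm_simps herm_axis herm_axis_left p algebra_simps)
    then have "complex_of_real (1 + (norm z)\<^sup>2) = complex_of_real ((cmod r)\<^sup>2)"
      by (simp add: herm_self dot_square_norm complex_mult_cnj cmod_power2 eq_diff_eq add.commute)
    then show ?thesis using of_real_eq_iff by blast
  qed
  have hz: "herm (D_chart_map i (p t) U) z = - (cnj r * r * (r * U $ i))" if "herm U (p t) = 0" for U
  proof -
    have "D_chart_map i (p t) U $ i = 0"
      using D_chart_map_affine[OF i] by (simp add: affine_space_def)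
    then have "herm (D_chart_map i (p t) U) z = cnj r * herm (D_chart_map i (p t) U) (p t)"
      by (simp add: z_def chart_map_def r_def[symmetric] herm_simps herm_axis)
    also have "herm (D_chart_map i (p t) U) (p t) = - (r * (r * U $ i))"
      by (simp add: D_chart_map_def r_def[symmetric] herm_simps that p power2_eq_square)
    finally show ?thesis by simp
  qed
  have rr: "complex_of_real (inverse ((cmod r)\<^sup>2)) * (cnj r * r) = 1"
  proof -
    have "complex_of_real (inverse ((cmod r)\<^sup>2)) * complex_of_real ((cmod r)\<^sup>2) = 1"
      using r(1) by (simp flip: of_real_mult)
    then show ?thesis unfolding complex_norm_square by (simp only: mult.commute[of r])
  qed
  have fs: "fs_christoffel z (D_chart_map i (p t) (X t)) (D_chart_map i (p t) (V t))
    = (r * X t $ i) *s D_chart_map i (p t) (V t) + (r * V t $ i) *s D_chart_map i (p t) (X t)"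
  proof -
    have "fs_christoffel z (D_chart_map i (p t) (X t)) (D_chart_map i (p t) (V t))
      = (complex_of_real (inverse ((cmod r)\<^sup>2)) * (cnj r * r)) *s
        ((r * X t $ i) *s D_chart_map i (p t) (V t) + (r * V t $ i) *s D_chart_map i (p t) (X t))"
      unfolding fs_christoffel_def nz hz[OF Xp] hz[OF Vp]
      by (simp add: vec_eq_iff scaleR_complex algebra_simps)
    then show ?thesis unfolding rr by simp
  qed
  have "d + fs_christoffel z (D_chart_map i (p t) p') (D_chart_map i (p t) (V t)) = D_chart_map i (p t) W"
    unfolding a fs d_eq lin
    unfolding r'_eq p'_def
    unfolding D_chart_map_def[of i "p t" "V t"] D_chart_map_def[of i "p t" "X t"] r_def[symmetric]
    by (simp add: vec_eq_iff scaleR_complex power2_eq_square algebra_simps)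
  with D show ?thesis unfolding p'_def z_def by blast
qed

lemma CP_norm_lift:
  assumes m: "m > 0" and p: "herm p p = 1" "herm V p = 0"
    and Y: "\<And>i. p $ i \<noteq> 0 \<Longrightarrow> Y i = D_chart_map i p V"
  shows "CP_norm m (complex_line p) Y = norm ((2 / sqrt m) *\<^sub>R V)"
proof -
  have p0: "p \<noteq> 0" using p by auto
  then obtain i where "p $ i \<noteq> 0" by (metis vec_eq_iff zero_index)
  then have "complex_line p \<in> chart_domain i" using complex_line_in_chart_domain[OF p0] by blast
  then have "complex_line p \<in> chart_domain (SOME i. complex_line p \<in> chart_domain i)" by (rule someI)
  then obtain j where j: "(SOME i. complex_line p \<in> chart_domain i) = j" "p $ j \<noteq> 0"
    using complex_line_in_chart_domain[OF p0] by blast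
  have "CP_metric m (complex_line p) Y Y = 4 / m * (V \<bullet> V)"
    unfolding CP_metric_def Let_def j(1) affine_coord_complex_line[OF j(2)] Y[OF j(2)]
      fubini_study_chart_map[OF j(2)] by (simp add: p inner_conv_herm)
  then show ?thesis
    using m by (simp add: CP_norm_def real_sqrt_mult real_sqrt_divide norm_eq_sqrt_inner)
qed


section \<open>The Frenet recursion on lifts\<close>

text \<open>Mirrors \<open>frenet_vector\<close>, with the covariant derivative replaced by the
  pointwise operator \<open>A t\<close>. Speed and curvatures are parameters, so that the actual
  functions can be inserted before they are known to be constant.\<close>

fun frenet_lift :: "(real \<Rightarrow> 'a::real_vector \<Rightarrow> 'a) \<Rightarrow> (real \<Rightarrow> 'a) \<Rightarrow> (real \<Rightarrow> real) \<Rightarrow>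
    (nat \<Rightarrow> real \<Rightarrow> real) \<Rightarrow> nat \<Rightarrow> real \<Rightarrow> 'a" where
  "frenet_lift A X v k 0 t = 0"
| "frenet_lift A X v k (Suc 0) t = X t /\<^sub>R v t"
| "frenet_lift A X v k (Suc (Suc j)) t =
     (A t (frenet_lift A X v k (Suc j) t) /\<^sub>R v t + k j t *\<^sub>R frenet_lift A X v k j t) /\<^sub>R k (Suc j) t"

text \<open>\<open>V\<close> represents the tangent vector \<open>Y\<close> simultaneously in all charts, which makes the choice
  of a chart in \<open>CP_norm\<close> harmless.\<close>

definition lifts_to :: "complex ^ 'k::finite \<Rightarrow> ('k \<Rightarrow> complex ^ 'k) \<Rightarrow> complex ^ 'k \<Rightarrow> bool" where
  "lifts_to p Y V \<longleftrightarrow> herm V p = 0 \<and> Y = (\<lambda>i. if p $ i \<noteq> 0 then D_chart_map i p V else 0)"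

lemma lifts_to_scale: "lifts_to p Y V \<Longrightarrow> lifts_to p (\<lambda>i. a *\<^sub>R Y i) (a *\<^sub>R V)"
  by (auto simp: lifts_to_def herm_simps linear_scale[OF linear_D_chart_map])

lemma lifts_to_add: "lifts_to p Y V \<Longrightarrow> lifts_to p Z W \<Longrightarrow> lifts_to p (\<lambda>i. Y i + Z i) (V + W)"
  by (auto simp: lifts_to_def herm_simps linear_add[OF linear_D_chart_map])

lemma CP_norm_lifts_to:
  assumes "m > 0" "herm p p = 1" "lifts_to p Y V"
  shows "CP_norm m (complex_line p) Y = norm ((2 / sqrt m) *\<^sub>R V)"
  using assms by (intro CP_norm_lift) (auto simp: lifts_to_def)

locale lifted_curve =
  fixes m :: real and \<gamma> :: "real \<Rightarrow> (complex ^ 'k::finite) set"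
    and p X :: "real \<Rightarrow> complex ^ 'k" and \<theta> :: "real \<Rightarrow> real" and T :: "real set"
  assumes m: "m > 0" and T: "open T"
    and \<gamma>: "\<And>t. t \<in> T \<Longrightarrow> \<gamma> t = complex_line (p t)"
    and pp: "\<And>t. t \<in> T \<Longrightarrow> herm (p t) (p t) = 1"
    and Xp: "\<And>t. t \<in> T \<Longrightarrow> herm (X t) (p t) = 0"
    and p': "\<And>t. t \<in> T \<Longrightarrow> (p has_vector_derivative X t + \<theta> t *\<^sub>R (\<i> *s p t)) (at t)"
begin

lemma p0: "t \<in> T \<Longrightarrow> p t \<noteq> 0"
  using pp by force

lemma in_chart: "t \<in> T \<Longrightarrow> \<gamma> t \<in> chart_domain i \<longleftrightarrow> p t $ i \<noteq> 0"
  using complex_line_in_chart_domain[OF p0] \<gamma> by metis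

lemma chart_nbhd: "open {s \<in> T. p s $ i \<noteq> 0}"
proof -
  have "continuous_on T (\<lambda>s. p s $ i)"
    using p' by (intro continuous_intros continuous_at_imp_continuous_on ballI has_vector_derivative_continuous) blast
  from continuous_open_preimage[OF this T, of "- {0}"]
  have "open (T \<inter> (\<lambda>s. p s $ i) -` (- {0}))" by (simp add: open_Compl)
  also have "T \<inter> (\<lambda>s. p s $ i) -` (- {0}) = {s \<in> T. p s $ i \<noteq> 0}" by auto
  finally show ?thesis .
qed

lemma velocity_in_chart:
  assumes t: "t \<in> T" "p t $ i \<noteq> 0"
  shows "velocity \<gamma> t i = D_chart_map i (p t) (X t + \<theta> t *\<^sub>R (\<i> *s p t))"
proof -
  have "((\<lambda>s. affine_coord i (\<gamma> s)) has_vector_derivative D_chart_map i (p t) (X t + \<theta> t *\<^sub>R (\<i> *s p t))) (at t)"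
    by (rule has_vector_derivative_transform_within_open[OF chart_map_has_vector_derivative[where i = i, OF p'[OF t(1)] t(2)] chart_nbhd[of i]])
      (use t in \<open>auto simp: \<gamma> affine_coord_complex_line\<close>)
  then show ?thesis
    using in_chart[OF t(1)] t(2) by (simp add: velocity_def vector_derivative_at)
qed

lemma D_chart_map_velocity:
  assumes "w $ i \<noteq> 0"
  shows "D_chart_map i w (V + a *\<^sub>R (\<i> *s w)) = D_chart_map i w V"
  using D_chart_map_point[OF assms, of "complex_of_real a * \<i>"]
  by (simp add: linear_add[OF linear_D_chart_map] scaleR_conv_scale)

lemma velocity_lifts_to:
  assumes t: "t \<in> T" shows "lifts_to (p t) (velocity \<gamma> t) (X t)"
proof -
  have "velocity \<gamma> t i = (if p t $ i \<noteq> 0 then D_chart_map i (p t) (X t) else 0)" for i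
    using velocity_in_chart[OF t] in_chart[OF t] by (simp add: D_chart_map_velocity) (simp add: velocity_def)
  then show ?thesis using Xp[OF t] by (auto simp: lifts_to_def)
qed

lemma cov_deriv_lifts_to:
  assumes t: "t \<in> T" and Y: "\<And>s. s \<in> T \<Longrightarrow> lifts_to (p s) (Y s) (V s)"
    and V: "has_lifted_derivative p X \<theta> V W t"
  shows "lifts_to (p t) (cov_deriv m \<gamma> Y t) W"
proof -
  have "cov_deriv m \<gamma> Y t i = D_chart_map i (p t) W" if i: "p t $ i \<noteq> 0" for i
  proof -
    obtain d where d: "((\<lambda>s. D_chart_map i (p s) (V s)) has_vector_derivative d) (at t)"
      "d + fs_christoffel (chart_map i (p t)) (D_chart_map i (p t) (X t + \<theta> t *\<^sub>R (\<i> *s p t))) (D_chart_map i (p t) (V t))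
       = D_chart_map i (p t) W"
      using D_chart_map_covariant_derivative[OF pp[OF t] p'[OF t] Xp[OF t] V i] by blast
    have "((\<lambda>s. Y s i) has_vector_derivative d) (at t)"
      by (rule has_vector_derivative_transform_within_open[OF d(1) chart_nbhd[of i]])
        (use t i Y in \<open>auto simp: lifts_to_def\<close>)
    moreover have "Y t i = D_chart_map i (p t) (V t)"
      using Y[OF t] i by (simp add: lifts_to_def)
    ultimately show ?thesis
      using in_chart[OF t] i d(2) \<gamma>[OF t]
      by (simp add: cov_deriv_def vector_derivative_at affine_coord_complex_line velocity_in_chart[OF t i]
          CP_christoffel_eq[OF m] D_chart_map_affine)
  qed
  moreover have "cov_deriv m \<gamma> Y t i = 0" if "p t $ i = 0" for i
    using that in_chart[OF t] by (simp add: cov_deriv_def)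
  ultimately show ?thesis using V by (auto simp: lifts_to_def has_lifted_derivative_def)
qed

end

text \<open>Isolates what the Frenet argument uses of the curvature operator. Convexity of
  \<open>T\<close> serves to pass from vanishing derivatives to constants.\<close>

locale parallel_curvature = lifted_curve m \<gamma> p X \<theta> T
  for m :: real and \<gamma> :: "real \<Rightarrow> (complex ^ 'k::finite) set" and p X \<theta> T +
  fixes A :: "real \<Rightarrow> complex ^ 'k \<Rightarrow> complex ^ 'k"
  assumes convex: "convex T"
    and linear_A: "\<And>t. linear (A t)"
    and skew_A: "\<And>t Z W. Re (herm (A t Z) W) + Re (herm Z (A t W)) = 0"
    and parallel_A: "\<And>t V W. t \<in> T \<Longrightarrow> has_lifted_derivative p X \<theta> V W t \<Longrightarrow>
      has_lifted_derivative p X \<theta> (\<lambda>s. A s (V s)) (A t W) t"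
    and X_A: "\<And>t. t \<in> T \<Longrightarrow> has_lifted_derivative p X \<theta> X (A t (X t)) t"
begin

text \<open>Fields whose covariant derivative is given by the parallel skew operator \<open>A\<close> have constant
  length, and this class is closed under \<open>A\<close> and constant linear combinations.\<close>

definition rotating :: "(real \<Rightarrow> complex ^ 'k) \<Rightarrow> bool" where
  "rotating V \<longleftrightarrow> (\<forall>t\<in>T. has_lifted_derivative p X \<theta> V (A t (V t)) t)"

lemma rotating_A: "rotating V \<Longrightarrow> rotating (\<lambda>t. A t (V t))"
  using parallel_A by (auto simp: rotating_def)

lemma rotating_cong:
  assumes V: "rotating V" and eq: "\<And>t. t \<in> T \<Longrightarrow> V' t = V t"
  shows "rotating V'"
  unfolding rotating_def
proof
  fix t assume t: "t \<in> T"
  have *: "has_lifted_derivative p X \<theta> V (A t (V t)) t" using V t by (simp add: rotating_def)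
  then have "(V' has_vector_derivative A t (V t) + \<theta> t *\<^sub>R (\<i> *s V t) - herm (V t) (X t) *s p t) (at t)"
    unfolding has_lifted_derivative_def using has_vector_derivative_transform_within_open[OF _ T t, of V _ V'] eq by auto
  with * show "has_lifted_derivative p X \<theta> V' (A t (V' t)) t"
    by (simp add: has_lifted_derivative_def eq[OF t])
qed

lemma rotating_combination:
  assumes V: "rotating V" "rotating W"
    and a: "\<And>t. t \<in> T \<Longrightarrow> a t = a'" and b: "\<And>t. t \<in> T \<Longrightarrow> b t = b'"
  shows "rotating (\<lambda>t. a t *\<^sub>R V t + b t *\<^sub>R W t)"
proof (rule rotating_cong)
  show "rotating (\<lambda>t. a' *\<^sub>R V t + b' *\<^sub>R W t)"
    unfolding rotating_def
  proof
    fix t assume t: "t \<in> T"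
    have 1: "has_lifted_derivative p X \<theta> V (A t (V t)) t" "has_lifted_derivative p X \<theta> W (A t (W t)) t"
      using V t by (simp_all add: rotating_def)
    have "has_lifted_derivative p X \<theta> (\<lambda>s. \<Sum>k\<in>{True, False}. (if k then a' else b') *\<^sub>R (if k then V else W) s)
      (\<Sum>k\<in>{True, False}. (if k then a' else b') *\<^sub>R A t ((if k then V else W) t)) t"
      by (rule has_lifted_derivative_sum) (use 1 in auto)
    then show "has_lifted_derivative p X \<theta> (\<lambda>t. a' *\<^sub>R V t + b' *\<^sub>R W t) (A t (a' *\<^sub>R V t + b' *\<^sub>R W t)) t"
      by (simp add: linear_add[OF linear_A] linear_scale[OF linear_A])
  qed
qed (use a b in simp)

lemma rotating_norm_const:
  assumes "rotating V" obtains r where "\<And>t. t \<in> T \<Longrightarrow> norm (V t) = r"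
proof -
  have "((\<lambda>s. Re (herm (V s) (V s))) has_real_derivative 0) (at t within T)" if "t \<in> T" for t
    using has_lifted_derivative_inner[of p X \<theta> V "A t (V t)" t V "A t (V t)"] assms that skew_A[of t "V t" "V t"]
    by (auto simp: rotating_def intro: has_field_derivative_at_within)
  then obtain c where c: "\<And>t. t \<in> T \<Longrightarrow> Re (herm (V t) (V t)) = c"
    using has_field_derivative_zero_constant[OF convex] by blast
  have "norm (V t) = sqrt c" if "t \<in> T" for t
    using c[OF that] by (simp add: norm_eq_sqrt_inner inner_conv_herm)
  then show thesis using that by blast
qed

lemma rotating_X: "rotating X"
  using X_A by (simp add: rotating_def)

lemma rotating_0: "rotating (\<lambda>t. 0)"
  by (simp add: rotating_def has_lifted_derivative_def linear_0[OF linear_A])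

lemma speed_eq: "t \<in> T \<Longrightarrow> speed m \<gamma> t = norm ((2 / sqrt m) *\<^sub>R X t)"
  by (simp only: speed_def \<gamma> CP_norm_lifts_to[OF m pp velocity_lifts_to])

lemma speed_const: obtains r where "\<And>t. t \<in> T \<Longrightarrow> speed m \<gamma> t = r"
proof -
  obtain r where "\<And>t. t \<in> T \<Longrightarrow> norm (X t) = r" using rotating_norm_const[OF rotating_X] by blast
  then show thesis using that[of "\<bar>2 / sqrt m\<bar> * r"] by (simp add: speed_eq)
qed

abbreviation "lift j \<equiv> frenet_lift A X (speed m \<gamma>) (geodesic_curvature m \<gamma>) j"

text \<open>The unnormalized next vector \<open>w\<close> is a constant combination of rotating
  fields, hence rotating and of constant length. So the next curvature is constant, and dividing by
  it keeps the field rotating, also when it is 0 because \<open>inverse 0 = 0\<close>.\<close>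

lemma frenet_step:
  assumes l: "\<And>t. t \<in> T \<Longrightarrow> lifts_to (p t) (frenet_vector m \<gamma> j t) (lift j t)"
      "\<And>t. t \<in> T \<Longrightarrow> lifts_to (p t) (frenet_vector m \<gamma> (Suc j) t) (lift (Suc j) t)"
    and r: "rotating (lift j)" "rotating (lift (Suc j))"
    and k: "\<And>t. t \<in> T \<Longrightarrow> geodesic_curvature m \<gamma> j t = c"
  defines "w \<equiv> \<lambda>t. A t (lift (Suc j) t) /\<^sub>R speed m \<gamma> t + geodesic_curvature m \<gamma> j t *\<^sub>R lift j t"
  shows "rotating w" "\<And>t. t \<in> T \<Longrightarrow> geodesic_curvature m \<gamma> (Suc j) t = norm ((2 / sqrt m) *\<^sub>R w t)"
    "\<And>t. t \<in> T \<Longrightarrow> lifts_to (p t) (frenet_vector m \<gamma> (Suc (Suc j)) t) (lift (Suc (Suc j)) t)"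
    "rotating (lift (Suc (Suc j)))"
proof -
  obtain v where v: "\<And>t. t \<in> T \<Longrightarrow> speed m \<gamma> t = v" using speed_const by blast
  show w: "rotating w"
    unfolding w_def using rotating_combination[OF rotating_A[OF r(2)] r(1) _ k, of "\<lambda>t. inverse (speed m \<gamma> t)" "inverse v"] v
    by simp
  have lw: "lifts_to (p t) (\<lambda>i. arc_cov_deriv m \<gamma> (frenet_vector m \<gamma> (Suc j)) t i
      + geodesic_curvature m \<gamma> j t *\<^sub>R frenet_vector m \<gamma> j t i) (w t)" if t: "t \<in> T" for t
    unfolding w_def arc_cov_deriv_def
    by (intro lifts_to_add lifts_to_scale cov_deriv_lifts_to[OF t l(2)] l(1)[OF t])
      (use r(2) t in \<open>auto simp: rotating_def\<close>)
  show kw: "geodesic_curvature m \<gamma> (Suc j) t = norm ((2 / sqrt m) *\<^sub>R w t)" if t: "t \<in> T" for t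
    using CP_norm_lifts_to[OF m pp[OF t] lw[OF t]] by (simp add: \<gamma>[OF t])
  have lift_eq: "lift (Suc (Suc j)) t = w t /\<^sub>R geodesic_curvature m \<gamma> (Suc j) t" for t
    by (simp add: w_def del: geodesic_curvature.simps)
  show "lifts_to (p t) (frenet_vector m \<gamma> (Suc (Suc j)) t) (lift (Suc (Suc j)) t)" if t: "t \<in> T" for t
    using lifts_to_scale[OF lw[OF t], of "inverse (geodesic_curvature m \<gamma> (Suc j) t)"]
    unfolding lift_eq frenet_vector.simps(3) by blast
  obtain r where "\<And>t. t \<in> T \<Longrightarrow> norm (w t) = r" using rotating_norm_const[OF w] by blast
  then have "geodesic_curvature m \<gamma> (Suc j) t = \<bar>2 / sqrt m\<bar> * r" if "t \<in> T" for t
    using kw[OF that] that by simp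
  then show "rotating (lift (Suc (Suc j)))"
    unfolding lift_eq[abs_def]
    using rotating_combination[OF w rotating_0, of "\<lambda>t. inverse (geodesic_curvature m \<gamma> (Suc j) t)" "inverse (\<bar>2 / sqrt m\<bar> * r)" "\<lambda>t. 0" 0]
    by simp
qed

text \<open>The recursion reaches back two steps, so the induction carries two consecutive vectors
  together with the earlier curvature.\<close>

lemma frenet_all:
  "(\<forall>t\<in>T. lifts_to (p t) (frenet_vector m \<gamma> j t) (lift j t)) \<and> rotating (lift j) \<and>
   (\<forall>t\<in>T. lifts_to (p t) (frenet_vector m \<gamma> (Suc j) t) (lift (Suc j) t)) \<and> rotating (lift (Suc j)) \<and>
   (\<exists>c. \<forall>t\<in>T. geodesic_curvature m \<gamma> j t = c)"
proof (induction j)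
  case 0
  obtain v where v: "\<And>t. t \<in> T \<Longrightarrow> speed m \<gamma> t = v" using speed_const by blast
  have "lifts_to (p t) (frenet_vector m \<gamma> 0 t) (lift 0 t)" for t
    by (simp add: lifts_to_def linear_0[OF linear_D_chart_map] fun_eq_iff)
  moreover have "lifts_to (p t) (frenet_vector m \<gamma> (Suc 0) t) (lift (Suc 0) t)" if "t \<in> T" for t
    using lifts_to_scale[OF velocity_lifts_to[OF that]] by simp
  moreover have "rotating (lift 0)" using rotating_0 by (rule rotating_cong) simp
  moreover have "rotating (lift (Suc 0))"
    using rotating_combination[OF rotating_X rotating_0, of "\<lambda>t. inverse (speed m \<gamma> t)" "inverse v" "\<lambda>t. 0" 0] v
    by (auto intro: rotating_cong)
  moreover have "\<exists>c. \<forall>t\<in>T. geodesic_curvature m \<gamma> 0 t = c" by simp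
  ultimately show ?case by blast
next
  case (Suc j)
  then obtain c where c: "\<And>t. t \<in> T \<Longrightarrow> geodesic_curvature m \<gamma> j t = c" by blast
  let ?w = "\<lambda>t. A t (lift (Suc j) t) /\<^sub>R speed m \<gamma> t + geodesic_curvature m \<gamma> j t *\<^sub>R lift j t"
  have w: "rotating ?w" "\<And>t. t \<in> T \<Longrightarrow> geodesic_curvature m \<gamma> (Suc j) t = norm ((2 / sqrt m) *\<^sub>R ?w t)"
    "\<And>t. t \<in> T \<Longrightarrow> lifts_to (p t) (frenet_vector m \<gamma> (Suc (Suc j)) t) (lift (Suc (Suc j)) t)"
    "rotating (lift (Suc (Suc j)))"
    using frenet_step[where j = j and c = c] Suc c by blast+
  obtain r where "\<And>t. t \<in> T \<Longrightarrow> norm (?w t) = r" using rotating_norm_const[OF w(1)] by blast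
  then have "\<forall>t\<in>T. geodesic_curvature m \<gamma> (Suc j) t = \<bar>2 / sqrt m\<bar> * r"
    using w(2) by (simp del: geodesic_curvature.simps)
  then show ?case using Suc w(3,4) by blast
qed

text \<open>At a fixed \<open>t\<close> the recursion is pure linear algebra for the skew operator
  \<open>A t\<close> divided by the speed. The factor \<open>2 / sqrt m\<close>, the square root of
  \<open>4 / m\<close>, turns lifts of unit vectors into Euclidean unit vectors.\<close>

lemma curvature_zero:
  assumes t: "t \<in> T" and S: "subspace S" "X t \<in> S" "\<And>x. x \<in> S \<Longrightarrow> A t x \<in> S" "dim S < j + 1"
  shows "geodesic_curvature m \<gamma> j t = 0"
proof (rule frenet_span_dim[where A = "\<lambda>x. A t x /\<^sub>R speed m \<gamma> t" and S = S
      and V = "\<lambda>j. (2 / sqrt m) *\<^sub>R lift j t" and k = "\<lambda>j. geodesic_curvature m \<gamma> j t"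
      and w = "\<lambda>j. (2 / sqrt m) *\<^sub>R (A t (lift j t) /\<^sub>R speed m \<gamma> t + geodesic_curvature m \<gamma> (j - 1) t *\<^sub>R lift (j - 1) t)"])
  show "linear (\<lambda>x. A t x /\<^sub>R speed m \<gamma> t)"
    using linear_A by (rule linear_compose_scale_right)
  show "(A t x /\<^sub>R speed m \<gamma> t) \<bullet> y + x \<bullet> (A t y /\<^sub>R speed m \<gamma> t) = 0" for x y
  proof -
    have "(A t x /\<^sub>R speed m \<gamma> t) \<bullet> y + x \<bullet> (A t y /\<^sub>R speed m \<gamma> t)
        = inverse (speed m \<gamma> t) * (A t x \<bullet> y + x \<bullet> A t y)"
      by (simp add: distrib_left)
    also have "A t x \<bullet> y + x \<bullet> A t y = 0"
      using skew_A[of t x y] by (simp add: inner_conv_herm)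
    finally show ?thesis by simp
  qed
  show "A t x /\<^sub>R speed m \<gamma> t \<in> S" if "x \<in> S" for x
    using S that by (simp add: subspace_scale)
  show "(2 / sqrt m) *\<^sub>R lift 1 t \<in> S" using S by (simp add: subspace_scale)
  show "(2 / sqrt m) *\<^sub>R lift 1 t = 0 \<or> norm ((2 / sqrt m) *\<^sub>R lift 1 t) = 1"
    using m by (cases "X t = 0") (simp_all add: speed_eq[OF t])
  show "geodesic_curvature m \<gamma> (Suc j) t = norm ((2 / sqrt m) *\<^sub>R (A t (lift (Suc j) t) /\<^sub>R speed m \<gamma> t
      + geodesic_curvature m \<gamma> (Suc j - 1) t *\<^sub>R lift (Suc j - 1) t))" for j
  proof -
    obtain c where c: "\<And>t. t \<in> T \<Longrightarrow> geodesic_curvature m \<gamma> j t = c"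
      using frenet_all[of j] by blast
    have l: "\<And>t. t \<in> T \<Longrightarrow> lifts_to (p t) (frenet_vector m \<gamma> j t) (lift j t)"
      "\<And>t. t \<in> T \<Longrightarrow> lifts_to (p t) (frenet_vector m \<gamma> (Suc j) t) (lift (Suc j) t)"
      and r: "rotating (lift j)" "rotating (lift (Suc j))"
      using frenet_all[of j] by blast+
    show ?thesis using frenet_step(2)[OF l r c t] by (simp only: diff_Suc_1)
  qed
qed (use S in \<open>simp_all add: linear_scale[OF linear_A] scaleR_add_right mult_ac del: geodesic_curvature.simps(2)\<close>)

end

section \<open>Return to the charts and passage from local to global\<close>

lemma chart_domain_representative:
  assumes "L \<in> chart_domain i"
  shows "complex_line (affine_coord i L + axis i 1) = L" "affine_coord i L \<in> affine_space i"
proof -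
  obtain w where w: "L = complex_line w" "w \<noteq> 0"
    using assms by (auto simp: chart_domain_def CP_def)
  have i: "w $ i \<noteq> 0" using assms complex_line_in_chart_domain[OF w(2)] w(1) by simp
  have c: "affine_coord i L = chart_map i w"
    unfolding w(1) by (rule affine_coord_complex_line[OF i])
  show "affine_coord i L \<in> affine_space i" unfolding c by (rule chart_map_affine[OF i])
  show "complex_line (affine_coord i L + axis i 1) = L"
    using complex_line_scale[of "inverse (w $ i)" w] i by (simp add: c chart_map_def flip: w(1))
qed

text \<open>\<open>CP_norm\<close> evaluates the metric in an arbitrarily chosen chart
  \<open>j\<close>. The compatibility built into \<open>tangent_space\<close> expresses
  \<open>v j\<close> through \<open>v i\<close>, and both charts give the same homogeneous
  expression.\<close>

lemma TM_coord_unit_tangent: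
  "TM_coord i ` {Q \<in> CP_unit_tangent_bundle m. fst Q \<in> chart_domain i} \<subseteq> unit_tangent_coords m i"
proof (rule image_subsetI)
  fix Q :: "(complex ^ 'a) set \<times> ('a \<Rightarrow> complex ^ 'a)"
  assume Q: "Q \<in> {Q \<in> CP_unit_tangent_bundle m. fst Q \<in> chart_domain i}"
  obtain L v where Lv: "Q = (L, v)" by fastforce
  have L: "L \<in> chart_domain i" and v: "v \<in> tangent_space L" and unit: "CP_norm m L v = 1"
    using Q by (auto simp: Lv CP_unit_tangent_bundle_def)
  define w where "w = affine_coord i L + axis i 1"
  have w: "L = complex_line w" "w $ i = 1" "w = affine_coord i L + axis i 1" "affine_coord i L \<in> affine_space i"
    using chart_domain_representative[OF L] by (simp_all add: w_def affine_space_def)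
  have w0: "w \<noteq> 0" using w(2) by auto
  define z where "z = affine_coord i L"
  have vi: "v i \<in> affine_space i" using v L unfolding tangent_space_def by blast
  define j where "j = (SOME j. L \<in> chart_domain j)"
  have jL: "L \<in> chart_domain j" unfolding j_def using L by (rule someI)
  then have j: "w $ j \<noteq> 0" using complex_line_in_chart_domain[OF w0] w(1) by blast
  have wz: "z + axis i 1 = w" using w(3) by (simp add: z_def)
  have vj: "v j = D_chart_map j w (v i)"
  proof -
    have S: "open ((\<lambda>s. (z + s *\<^sub>R v i + axis i 1) $ j) -` (- {0}))"
      by (intro open_vimage continuous_intros)
    have line: "((\<lambda>s. z + s *\<^sub>R v i + axis i 1) has_vector_derivative v i) (at 0)"
      by (auto intro!: derivative_eq_intros)
    have "((\<lambda>s. chart_map j (z + s *\<^sub>R v i + axis i 1)) has_vector_derivative D_chart_map j w (v i)) (at 0)"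
      using chart_map_has_vector_derivative[OF line, of j] j wz by simp
    then have "((\<lambda>s. affine_coord j (affine_point i (z + s *\<^sub>R v i))) has_vector_derivative D_chart_map j w (v i)) (at 0)"
    proof (rule has_vector_derivative_transform_within_open[OF _ S])
      show "0 \<in> (\<lambda>s. (z + s *\<^sub>R v i + axis i 1) $ j) -` (- {0})" using j by (simp flip: wz)
      show "chart_map j (z + s *\<^sub>R v i + axis i 1) = affine_coord j (affine_point i (z + s *\<^sub>R v i))"
        if "s \<in> (\<lambda>s. (z + s *\<^sub>R v i + axis i 1) $ j) -` (- {0})" for s
        using affine_coord_complex_line[of "z + s *\<^sub>R v i + axis i 1" j] that by (simp add: affine_point_def)
    qed
    then have "dir_deriv (\<lambda>z. affine_coord j (affine_point i z)) z (v i) = D_chart_map j w (v i)"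
      unfolding dir_deriv_def by (rule vector_derivative_at)
    moreover have "v j = dir_deriv (\<lambda>z. affine_coord j (affine_point i z)) z (v i)"
      using v L jL unfolding tangent_space_def z_def by blast
    ultimately show ?thesis by simp
  qed
  have i: "w $ i \<noteq> 0" using w(2) by simp
  \<comment> \<open>The representative \<open>w\<close> has entry 1 at \<open>i\<close>, so the
    differential of the chart at \<open>w\<close> fixes vectors of
    \<open>affine_space i\<close>.\<close>
  have vi': "v i = D_chart_map i w (v i)"
    using vi by (simp add: D_chart_map_def w(2) affine_space_def)
  have "fubini_study m z (v i) (v i) = fubini_study m (chart_map i w) (D_chart_map i w (v i)) (D_chart_map i w (v i))"
    using vi' affine_coord_complex_line[OF i] w(1) by (simp add: z_def)
  also have "\<dots> = fubini_study m (chart_map j w) (D_chart_map j w (v i)) (D_chart_map j w (v i))"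
    unfolding fubini_study_chart_map[OF i] fubini_study_chart_map[OF j] ..
  also have "\<dots> = CP_metric m L v v"
    unfolding CP_metric_def Let_def j_def[symmetric] vj using affine_coord_complex_line[OF j] w(1) by simp
  also have "\<dots> = 1"
    using unit by (simp add: CP_norm_def)
  finally show "TM_coord i Q \<in> unit_tangent_coords m i"
    using w(4) vi by (simp add: TM_coord_def Lv unit_tangent_coords_def z_def)
qed

lemma complex_line_lift_point:
  assumes "L \<in> chart_domain i"
  shows "complex_line (lift_point i (affine_coord i L)) = L"
proof -
  have nz: "complex_of_real (rho (affine_coord i L)) \<noteq> 0" using rho_pos[of "affine_coord i L"] by simp
  show ?thesis
    unfolding lift_point_def scaleR_conv_scale complex_line_scale[OF nz]
    by (rule chart_domain_representative(1)[OF assms])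
qed

lemma lifted_geodesic_curvatures:
  assumes m: "m > 0" and d: "d \<ge> 0" and T: "open T" "convex T"
    and \<gamma>: "\<And>t. t \<in> T \<Longrightarrow> \<gamma> t = complex_line (p t)"
    and geo: "lifted_geodesic d (m / 4) T p \<zeta> X K \<theta>"
  shows "\<exists>c. \<forall>t\<in>T. geodesic_curvature m \<gamma> j t = c"
    and "t \<in> T \<Longrightarrow> 6 \<le> j \<Longrightarrow> geodesic_curvature m \<gamma> j t = 0"
proof -
  define c where "c s = Im (herm (K s) (\<zeta> s))" for s
  define \<eta> where "\<eta> s = K s + (d * c s) *\<^sub>R (\<i> *s \<zeta> s)" for s
  define b where "b s = 2 * c s * (1 + d * (m / 4))" for s
  define A where "A s = curv_op (\<zeta> s) (\<eta> s) (b s)" for s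
  have eqs: "\<exists>H. (c has_real_derivative 0) (at t) \<and> has_lifted_derivative p X \<theta> \<zeta> (K t) t \<and>
     has_lifted_derivative p X \<theta> X (A t (X t)) t \<and> has_lifted_derivative p X \<theta> \<eta> H t \<and>
     (\<forall>Z. herm Z (K t) *s \<eta> t + herm Z (\<zeta> t) *s H - herm Z H *s \<zeta> t - herm Z (\<eta> t) *s K t = 0)"
    if "t \<in> T" for t
    using lifted_geodesic_equations[OF geo T(1) that d] m
    unfolding c_def[abs_def] \<eta>_def[abs_def] b_def[abs_def] A_def[abs_def] by simp
  interpret parallel_curvature m \<gamma> p X \<theta> T A
  proof (intro parallel_curvature.intro lifted_curve.intro parallel_curvature_axioms.intro)
    show "herm (p t) (p t) = 1" "herm (X t) (p t) = 0"
      "(p has_vector_derivative X t + \<theta> t *\<^sub>R (\<i> *s p t)) (at t)" if "t \<in> T" for t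
      using geo that unfolding lifted_geodesic_def by blast+
    show "linear (A t)" for t unfolding A_def by (rule linear_curv_op)
    show "Re (herm (A t Z) W) + Re (herm Z (A t W)) = 0" for t Z W
      unfolding A_def by (rule curv_op_skew)
    show "has_lifted_derivative p X \<theta> X (A t (X t)) t" if "t \<in> T" for t
      using eqs[OF that] by blast
    show "has_lifted_derivative p X \<theta> (\<lambda>s. A s (V s)) (A t W) t"
      if t: "t \<in> T" and V: "has_lifted_derivative p X \<theta> V W t" for t V W
    proof -
      obtain H where H: "(c has_real_derivative 0) (at t)" "has_lifted_derivative p X \<theta> \<zeta> (K t) t"
        "has_lifted_derivative p X \<theta> \<eta> H t"
        "\<And>Z. herm Z (K t) *s \<eta> t + herm Z (\<zeta> t) *s H - herm Z H *s \<zeta> t - herm Z (\<eta> t) *s K t = 0"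
        using eqs[OF t] by blast
      have "(b has_real_derivative 0) (at t)"
        unfolding b_def using H(1) by (auto intro!: derivative_eq_intros)
      from has_lifted_derivative_curv_op[OF V H(2,3) this H(4)] show ?thesis
        unfolding A_def .
    qed
  qed (use m T \<gamma> in auto)
  show "\<exists>c. \<forall>t\<in>T. geodesic_curvature m \<gamma> j t = c"
    using frenet_all[of j] by blast
  show "geodesic_curvature m \<gamma> j t = 0" if t: "t \<in> T" and j: "6 \<le> j"
  proof -
    \<comment> \<open>Since \<open>A t\<close> is \<open>\<i>\<close>-linear and equals a multiple of \<open>\<i>\<close> modulo \<open>\<zeta>\<close> and \<open>\<eta>\<close>, the complex span
      of these vectors is invariant.\<close>
    define B where "B = {X t, \<i> *s X t, \<zeta> t, \<i> *s \<zeta> t, \<eta> t, \<i> *s \<eta> t}"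
    have cs: "a *s v = Re a *\<^sub>R v + Im a *\<^sub>R (\<i> *s v)" for a and v :: "complex ^ 'a"
      by (simp add: vec_eq_iff scaleR_complex complex_eq_iff)
    have ii: "\<i> *s (\<i> *s v) = - v" for v :: "complex ^ 'a" by (simp add: vec_eq_iff)
    have J: "\<i> *s x \<in> span B" if "x \<in> span B" for x
      using that
    proof (induction rule: span_induct_alt)
      case base
      show ?case by (simp add: span_0)
    next
      case (step r x y)
      have "\<i> *s x \<in> span B"
        using step(1) by (auto simp: B_def ii span_base intro!: span_neg)
      moreover have "\<i> *s (r *\<^sub>R x + y) = r *\<^sub>R (\<i> *s x) + \<i> *s y"
        by (simp add: vec_eq_iff scaleR_complex algebra_simps)
      ultimately show ?case using step by (simp add: span_add span_scale)
    qed
    have sc: "a *s v \<in> span B" if "v \<in> span B" for a v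
      unfolding cs[of a v] using J[OF that] that by (intro span_add span_scale)
    have in_B: "X t \<in> span B" "\<zeta> t \<in> span B" "\<eta> t \<in> span B"
      by (simp_all add: B_def span_base)
    show ?thesis
    proof (rule curvature_zero[OF t subspace_span in_B(1)])
      show "A t x \<in> span B" if "x \<in> span B" for x
        unfolding A_def curv_op_def using in_B that J by (intro span_add span_diff span_scale sc)
      have "dim (span B) \<le> card B"
        by (simp add: B_def dim_le_card')
      also have "card B \<le> 6"
        using card_length[of "[X t, \<i> *s X t, \<zeta> t, \<i> *s \<zeta> t, \<eta> t, \<i> *s \<eta> t]"] by (simp add: B_def)
      finally show "dim (span B) < j + 1" using j by simp
    qed
  qed
qed

lemma berger_geodesic_locally_lifted:
  fixes \<Gamma> :: "real \<Rightarrow> (complex ^ 'k::finite) set \<times> ('k \<Rightarrow> complex ^ 'k)"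
  assumes m: "m > 0" and geo: "berger_geodesic m \<delta> I \<Gamma>" and t: "t \<in> I"
  obtains T p \<zeta> X K \<theta> where "open T" "convex T" "t \<in> T" "T \<subseteq> I"
    "\<And>s. s \<in> T \<Longrightarrow> fst (\<Gamma> s) = complex_line (p s)"
    "lifted_geodesic (4 * \<delta>\<^sup>2 / m) (m / 4) T p \<zeta> X K \<theta>"
proof -
  obtain i T and H :: "((complex ^ 'k) \<times> (complex ^ 'k)) set" and W \<phi> u where
    T: "open T" "t \<in> T" "T \<subseteq> I" and chart: "\<forall>t\<in>T. fst (\<Gamma> t) \<in> chart_domain i"
    and dim: "dim H = 4 * (CARD('k) - 1) - 1"
    and par: "local_parametrization H W \<phi> (TM_coord i ` {Q \<in> CP_unit_tangent_bundle m. fst Q \<in> chart_domain i})"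
    and u: "\<forall>t\<in>T. u t \<in> W \<inter> H \<and> \<phi> (u t) = TM_coord i (\<Gamma> t)"
    and geo': "geodesic_in_coordinates H (pullback_metric \<phi> (berger_metric m \<delta> i)) T u"
    using geo t unfolding berger_geodesic_def by blast
  have "\<phi> ` (W \<inter> H) \<subseteq> TM_coord i ` {Q \<in> CP_unit_tangent_bundle m. fst Q \<in> chart_domain i}"
    using par openin_imp_subset unfolding local_parametrization_def by blast
  then have im: "\<phi> ` (W \<inter> H) \<subseteq> unit_tangent_coords m i"
    using TM_coord_unit_tangent by blast
  have "\<exists>\<zeta> X K \<theta>. lifted_geodesic (4 * \<delta>\<^sup>2 / m) (m / 4) T (\<lambda>t. lift_point i (fst (\<phi> (u t)))) \<zeta> X K \<theta>"
    by (rule berger_geodesic_lift[OF m _ _ _ dim _ im T(1) _ geo'])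
      (use par u in \<open>auto simp: local_parametrization_def\<close>)
  then obtain \<zeta> X K \<theta> where l: "lifted_geodesic (4 * \<delta>\<^sup>2 / m) (m / 4) T (\<lambda>t. lift_point i (fst (\<phi> (u t)))) \<zeta> X K \<theta>"
    by blast
  \<comment> \<open>The parameter set is shrunk to a ball to make it convex.\<close>
  obtain e where e: "e > 0" "ball t e \<subseteq> T" using openE[OF T(1,2)] by metis
  show thesis
  proof (rule that)
    show "open (ball t e)" "convex (ball t e)" "t \<in> ball t e" "ball t e \<subseteq> I"
      using e T by auto
    show "fst (\<Gamma> s) = complex_line (lift_point i (fst (\<phi> (u s))))" if "s \<in> ball t e" for s
    proof -
      have s: "s \<in> T" using that e(2) by blast
      then have "\<phi> (u s) = TM_coord i (\<Gamma> s)" using u by blast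
      then show ?thesis
        using complex_line_lift_point[OF chart[rule_format, OF s]] by (simp add: TM_coord_def)
    qed
    show "lifted_geodesic (4 * \<delta>\<^sup>2 / m) (m / 4) (ball t e) (\<lambda>t. lift_point i (fst (\<phi> (u t)))) \<zeta> X K \<theta>"
      unfolding lifted_geodesic_def
      by (intro ballI bspec[OF l[unfolded lifted_geodesic_def]] subsetD[OF e(2)])
  qed
qed

theorem theorem2p2:
  fixes m \<delta> :: real and n :: nat and I :: "real set"
    and \<Gamma> :: "real \<Rightarrow> (complex ^ 'k::finite) set \<times> ('k \<Rightarrow> complex ^ 'k)"
    and \<gamma> :: "real \<Rightarrow> (complex ^ 'k) set"
  assumes "CARD('k) = n + 1"
    and "m > 0"
    and "open I" and "connected I"
    and "berger_geodesic m \<delta> I \<Gamma>"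
    and "\<gamma> = fst \<circ> \<Gamma>"
    and "\<not> \<gamma> constant_on I"
  shows "(\<forall>j\<in>{1..2 * n - 1}. geodesic_curvature m \<gamma> j constant_on I) \<and>
         (\<forall>j\<in>{6..2 * n - 1}. \<forall>t\<in>I. geodesic_curvature m \<gamma> j t = 0)"
proof -
  \<comment> \<open>Chart, lift and curvature operator depend on \<open>t\<close>; only statements
    about the curvatures, which do not refer to them, can be glued along the connected set
    \<open>I\<close>.\<close>
  have local: "\<exists>T. open T \<and> t \<in> T \<and> T \<subseteq> I \<and> (\<exists>c. \<forall>s\<in>T. geodesic_curvature m \<gamma> j s = c) \<and>
      (6 \<le> j \<longrightarrow> geodesic_curvature m \<gamma> j t = 0)" if t: "t \<in> I" for t j
  proof -
    obtain T p \<zeta> X K \<theta> where T: "open T" "convex T" "t \<in> T" "T \<subseteq> I"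
      and p: "\<And>s. s \<in> T \<Longrightarrow> fst (\<Gamma> s) = complex_line (p s)"
      and l: "lifted_geodesic (4 * \<delta>\<^sup>2 / m) (m / 4) T p \<zeta> X K \<theta>"
      by (rule berger_geodesic_locally_lifted[OF assms(2,5) t]) (rule that)
    have d: "4 * \<delta>\<^sup>2 / m \<ge> 0" using assms(2) by simp
    have \<gamma>: "\<gamma> s = complex_line (p s)" if "s \<in> T" for s
      using p[OF that] assms(6) by simp
    note curv = lifted_geodesic_curvatures[OF assms(2) d T(1,2) \<gamma> l]
    show ?thesis by (intro exI[of _ T] conjI impI T(1,3,4) curv)
  qed
  have const: "geodesic_curvature m \<gamma> j constant_on I" for j
  proof (rule locally_constant_imp_constant[OF assms(4)])
    fix t assume "t \<in> I"
    from local[OF this, of j]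
    obtain T where T: "open T" "t \<in> T" "T \<subseteq> I" "\<exists>c. \<forall>s\<in>T. geodesic_curvature m \<gamma> j s = c"
      by blast
    then show "\<exists>T. openin (top_of_set I) T \<and> t \<in> T \<and> (\<forall>x\<in>T. geodesic_curvature m \<gamma> j x = geodesic_curvature m \<gamma> j t)"
      by (intro exI[of _ T]) (auto simp: openin_open_eq[OF assms(3)])
  qed
  have "geodesic_curvature m \<gamma> j t = 0" if "j \<in> {6..2 * n - 1}" "t \<in> I" for j t
    using local[OF that(2), of j] that(1) by (elim exE conjE) simp
  with const show ?thesis by blast
qed

end
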